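(* Let $r\ge1$ be an integer. The number of symmetric quivers in $\mathcal{Q}_{2r-1}$ is $\frac12\binom{2r}{r}$. For an integer $r_2\ge0$, the number of symmetric quivers in $\mathcal{Q}_{2r-1}$ with exactly $2r_2$ oriented 3-cycles is $$2^{r-2r_2-1}\binom{r}{r_2,\,r_2,\,r-2r_2}.$$
   Context: Multinomial coefficients with a negative lower entry are $0$. All quivers are finite, connected, without loops and without oriented 2-cycles, considered up to isomorphism. A rooted quiver of type $A$ is a quiver with a distinguished vertex (the root), defined recursively as one of: (i) a single vertex, the root; (ii) a root $\rho$, a rooted quiver of type $A$ with root $v\ne\rho$, and one arrow between $\rho$ and $v$ (either direction); (iii) a root $\rho$, an oriented 3-cycle $\rho\to u\to w\to\rho$, and two vertex-disjoint rooted quivers of type $A$ with roots $u$ and $w$. For $n\ge2$, $\mathcal{Q}_{n-1}$ is the class of quivers with $n$ vertices such that: (1) there is exactly one full subquiver which is a non-oriented cycle (underlying graph a cycle, arrows not all oriented the same way) of length $\ge2$ (length 2 = double arrow); its arrows are base arrows; (2) for each base arrow $\alpha:x\to y$ there may be a vertex $z_\alpha$ off the cycle with arrows $y\to z_\alpha\to x$ (for a double arrow only one of its arrows is regarded as part of such a 3-cycle), and no other arrows are incident to cycle vertices; (3) removing the cycle vertices leaves a disjoint union of rooted quivers of type $A$, one with root $z_\alpha$ for each existing $z_\alpha$, attached to $\alpha$. These are exactly the quivers of type $\tilde A_{n-1}$ (mutation equivalent to a non-oriented $n$-cycle). A realization of $Q\in\mathcal{Q}_{n-1}$ is $Q$ with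 an embedding of its non-oriented cycle in the plane (a choice of clockwise direction), realizations being identified if a quiver isomorphism maps one to the other preserving the clockwise direction. Each quiver has at most two realizations; $Q$ is symmetric if its two possible realizations coincide (i.e. $Q$ has an automorphism reversing the cyclic direction of its non-oriented cycle). *)

theory Defs
  imports
    Complex_Main
    "HOL-Library.Disjoint_Sets"
    "Graph_Theory.Digraph_Component"
    "Graph_Theory.Digraph_Isomorphism"
begin

text \<open>A quiver is a directed multigraph \<open>Q :: ('a, 'b) pre_digraph\<close> with vertices in \<open>'a\<close>
  and arrows in \<open>'b\<close>; \<open>Q \<restriction> C\<close> is the full subquiver on \<open>C\<close>, and
  quiver isomorphisms (acting on vertices and arrows) are those of \<open>Digraph_Isomorphism\<close>.\<close>

definition quiver :: "('a, 'b) pre_digraph \<Rightarrow> bool" where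
  "quiver Q \<longleftrightarrow> fin_digraph Q \<and> Digraph_Component.connected Q \<and> loopfree_digraph Q \<and>
     (\<nexists>u v. u \<rightarrow>\<^bsub>Q\<^esub> v \<and> v \<rightarrow>\<^bsub>Q\<^esub> u)"

inductive rooted_type_A :: "('a, 'b) pre_digraph \<Rightarrow> 'a \<Rightarrow> bool" where
  single: "rooted_type_A Q \<rho>"
    if "verts Q = {\<rho>}" "arcs Q = {}"
| arrow: "rooted_type_A Q \<rho>"
    if "verts Q = insert \<rho> V" "\<rho> \<notin> V" "rooted_type_A (Q \<restriction> V) v"
      "arcs Q = insert a (arcs (Q \<restriction> V))"
      "arc_to_ends Q a = (\<rho>, v) \<or> arc_to_ends Q a = (v, \<rho>)"
| triangle: "rooted_type_A Q \<rho>"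
    if "verts Q = insert \<rho> (U \<union> W)" "\<rho> \<notin> U \<union> W" "U \<inter> W = {}"
      "rooted_type_A (Q \<restriction> U) u" "rooted_type_A (Q \<restriction> W) w"
      "arcs Q = {a, b, c} \<union> arcs (Q \<restriction> U) \<union> arcs (Q \<restriction> W)"
      "arc_to_ends Q a = (\<rho>, u)" "arc_to_ends Q b = (u, w)" "arc_to_ends Q c = (w, \<rho>)"

text \<open>\<open>cycle_traversal H (vs, as)\<close>: the underlying multigraph of \<open>H\<close> is a cycle, and
  \<open>vs ! 0, as ! 0, vs ! 1, as ! 1, \<dots>\<close> lists its vertices and edges in the order in which
  they are met when going once around it (ignoring the orientation of the arrows). The edges are
  recorded because for a cycle of length 2 the vertices alone do not determine a direction.\<close>

definition cycle_traversal :: "('a, 'b) pre_digraph \<Rightarrow> 'a list \<times> 'b list \<Rightarrow> bool" where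
  "cycle_traversal H T \<longleftrightarrow> (case T of (vs, as) \<Rightarrow>
     length vs \<ge> 2 \<and> length as = length vs \<and> distinct vs \<and> distinct as \<and>
     set vs = verts H \<and> set as = arcs H \<and>
     (\<forall>i < length vs. {tail H (as ! i), head H (as ! i)} = {vs ! i, vs ! (Suc i mod length vs)}))"

definition nonoriented_cycle :: "('a, 'b) pre_digraph \<Rightarrow> bool" where
  "nonoriented_cycle H \<longleftrightarrow> (\<exists>vs as. cycle_traversal H (vs, as) \<and>
     (\<exists>i < length vs. tail H (as ! i) = vs ! i) \<and>
     (\<exists>i < length vs. head H (as ! i) = vs ! i))"

text \<open>\<open>attachment Q C \<zeta>\<close>: the full subquiver on \<open>C\<close> is a non-oriented cycle,
  \<open>\<zeta> \<alpha> = Some z\<close> says that \<open>z\<close> is the vertex \<open>z\<^sub>\<alpha>\<close> of the base arrow \<open>\<alpha>\<close>, and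
  \<open>P z\<close> is the vertex set of the rooted quiver of type A with root \<open>z\<close>.
  Since \<open>\<zeta>\<close> is injective, a vertex forming oriented 3-cycles (as a bare quiver) with both
  arrows of a double arrow is assigned to only one of these two arrows.\<close>

definition attachment :: "('a, 'b) pre_digraph \<Rightarrow> 'a set \<Rightarrow> ('b \<rightharpoonup> 'a) \<Rightarrow> bool" where
  "attachment Q C \<zeta> \<longleftrightarrow>
     C \<subseteq> verts Q \<and> nonoriented_cycle (Q \<restriction> C) \<and>
     dom \<zeta> \<subseteq> arcs (Q \<restriction> C) \<and> ran \<zeta> \<subseteq> verts Q - C \<and> inj_on \<zeta> (dom \<zeta>) \<and>
     (\<forall>\<alpha> z. \<zeta> \<alpha> = Some z \<longrightarrow>
        (\<exists>!e. e \<in> arcs Q \<and> arc_to_ends Q e = (head Q \<alpha>, z)) \<and>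
        (\<exists>!e. e \<in> arcs Q \<and> arc_to_ends Q e = (z, tail Q \<alpha>))) \<and>
     (\<forall>e \<in> arcs Q. tail Q e \<in> C \<or> head Q e \<in> C \<longrightarrow>
        e \<in> arcs (Q \<restriction> C) \<or>
        (\<exists>\<alpha> z. \<zeta> \<alpha> = Some z \<and>
           (arc_to_ends Q e = (head Q \<alpha>, z) \<or> arc_to_ends Q e = (z, tail Q \<alpha>)))) \<and>
     (\<exists>P. disjoint_family_on P (ran \<zeta>) \<and>
        (\<Union>z \<in> ran \<zeta>. P z) = verts Q - C \<and>
        (\<Union>z \<in> ran \<zeta>. arcs (Q \<restriction> P z)) = arcs (Q \<restriction> (verts Q - C)) \<and>
        (\<forall>z \<in> ran \<zeta>. rooted_type_A (Q \<restriction> P z) z))"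

text \<open>\<open>quivers_A_tilde m\<close> is the class \<open>\<Q>\<^sub>m\<close>, whose members have \<open>m + 1\<close> vertices.\<close>

definition quivers_A_tilde :: "nat \<Rightarrow> ('a, 'b) pre_digraph set" where
  "quivers_A_tilde m = {Q. quiver Q \<and> card (verts Q) = Suc m \<and>
     (\<exists>!C. C \<subseteq> verts Q \<and> nonoriented_cycle (Q \<restriction> C)) \<and>
     (\<exists>C \<zeta>. attachment Q C \<zeta>)}"

text \<open>A choice of clockwise direction is a traversal of the non-oriented cycle up to rotation.\<close>

definition same_direction :: "'a list \<times> 'b list \<Rightarrow> 'a list \<times> 'b list \<Rightarrow> bool" where
  "same_direction T T' \<longleftrightarrow> (\<exists>k. fst T' = rotate k (fst T) \<and> snd T' = rotate k (snd T))"

definition reverse_traversal :: "'a list \<times> 'b list \<Rightarrow> 'a list \<times> 'b list" where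
  "reverse_traversal T = (case T of (vs, as) \<Rightarrow> (hd vs # rev (tl vs), rev as))"

definition realization ::
    "('a, 'b) pre_digraph \<Rightarrow> ('b \<rightharpoonup> 'a) \<Rightarrow> 'a list \<times> 'b list \<Rightarrow> bool" where
  "realization Q \<zeta> T \<longleftrightarrow>
     attachment Q (set (fst T)) \<zeta> \<and> cycle_traversal (Q \<restriction> set (fst T)) T"

text \<open>Isomorphisms of realizations have to respect \<open>\<zeta>\<close>. For a cycle of length at least 3 this
  is automatic, as \<open>\<zeta>\<close> is determined by the quiver. For a double arrow it expresses the
  convention that an attached vertex forms an oriented 3-cycle with only one of the two arrows:
  exchanging just the two arrows does not preserve a realization in which one of them
  carries an attached vertex.\<close>

definition same_realization ::
    "('a, 'b) pre_digraph \<Rightarrow> ('b \<rightharpoonup> 'a) \<Rightarrow> 'a list \<times> 'b list \<Rightarrow>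
     ('a, 'b) pre_digraph \<Rightarrow> ('b \<rightharpoonup> 'a) \<Rightarrow> 'a list \<times> 'b list \<Rightarrow> bool" where
  "same_realization Q \<zeta> T Q' \<zeta>' T' \<longleftrightarrow>
     (\<exists>\<phi>. pre_digraph.digraph_isomorphism Q \<phi> \<and> app_iso \<phi> Q = Q' \<and>
        (\<forall>\<alpha> \<in> arcs (Q \<restriction> set (fst T)).
           \<zeta>' (iso_arcs \<phi> \<alpha>) = map_option (iso_verts \<phi>) (\<zeta> \<alpha>)) \<and>
        same_direction (map (iso_verts \<phi>) (fst T), map (iso_arcs \<phi>) (snd T)) T')"

text \<open>The choice of \<open>\<zeta>\<close> and \<open>T\<close> is immaterial: \<open>T\<close> is unique up to direction, and for a
  double arrow the possible \<open>\<zeta>\<close> differ by exchanging its two arrows.\<close>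

definition symmetric_quiver :: "('a, 'b) pre_digraph \<Rightarrow> bool" where
  "symmetric_quiver Q \<longleftrightarrow>
     (\<exists>\<zeta> T. realization Q \<zeta> T \<and> same_realization Q \<zeta> T Q \<zeta> (reverse_traversal T))"

text \<open>Oriented 3-cycles are recorded by their vertex sets, so that a vertex attached to a double
  arrow contributes one oriented 3-cycle and not two (only one of the two parallel arrows is
  regarded as part of it). Without a double arrow, the vertex set determines the 3-cycle.\<close>

definition oriented_3_cycles :: "('a, 'b) pre_digraph \<Rightarrow> 'a set set" where
  "oriented_3_cycles Q = {{u, v, w} | u v w. u \<rightarrow>\<^bsub>Q\<^esub> v \<and> v \<rightarrow>\<^bsub>Q\<^esub> w \<and> w \<rightarrow>\<^bsub>Q\<^esub> u}"

text \<open>Every finite quiver is isomorphic to one with vertices and arrows in \<open>nat\<close>, so counting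
  classes of such quivers counts all quivers up to isomorphism.\<close>

definition iso_classes :: "(nat, nat) pre_digraph set \<Rightarrow> (nat, nat) pre_digraph set set" where
  "iso_classes S = S // {(Q, Q'). digraph_iso Q Q'}"

definition multinomial :: "nat \<Rightarrow> int list \<Rightarrow> nat" where
  "multinomial n ks =
     (if \<exists>k \<in> set ks. k < 0 then 0 else fact n div (\<Prod>k \<leftarrow> ks. fact (nat k)))"

end

theory Submission
  imports Defs "HOL-Library.Countable"
begin

text \<open>Cut the base cycle of a symmetric quiver along the axis of a reflection. A reflection cannot fix a
  base arrow (it would reverse it), so the axis passes through two cycle vertices, and the quiver is
  determined by one of the two halves: a code, that is, a sequence of oriented base arrows, each with
  an optional rooted quiver of type A attached. The word around the whole cycle is the code followed
  by its mirror image. As mirroring flips orientations, the minimal period of this word is even, say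
  \<open>2 q\<close>, and it is mirror-symmetric exactly at the multiples of \<open>q\<close>; hence every symmetric quiver has
  exactly two codes. Reading a code from left to right turns it into a lattice path from height 0 to
  height 0 with up steps, down steps and two kinds of level steps; an oriented 3-cycle in the half
  corresponds to a pair of an up and a down step. There are \<open>(2 * r) choose r\<close> such paths of length
  \<open>r\<close>, and the paths with \<open>j\<close> up steps are counted by a trinomial coefficient times a power of 2.\<close>

section \<open>Codes and their enumeration\<close>

text \<open>The paths are unrestricted in sign: the flag of a letter that carries a tree decides on
  which side of height 0 the excursion encoded by the tree runs. On the side of quivers everything
  is indexed by the integers with a period \<open>n\<close>. Base arrow \<open>i\<close> joins the
  cycle vertices \<open>i\<close> and \<open>i + 1\<close>, so the reflection in vertex 0 sends
  arrow \<open>i\<close> to arrow \<open>- 1 - i\<close>; this is the origin of all offsets by one.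
  Two facts make the word an invariant up to shifts. The tree of a rooted quiver of type A can be
  read off from its root, since the presence of an out-neighbour and of an in-neighbour tells which
  constructor was used. And the base cycle is the only non-oriented cycle, so two traversals of it
  differ by a rotation or a reflection. The obstacle is the double arrow, \<open>n = 2\<close>:
  vertices do not determine arrows there, and an attached root is adjacent to the ends of both
  parallel arrows, so the bare quiver does not tell which one carries it. Hence arrows belong to all
  coordinates, and uniqueness is settled separately in this case, where mirror symmetry forces equal
  trees, or none, on both arrows.\<close>

text \<open>The three constructors are the three clauses of \<open>rooted_type_A\<close>; the flag of \<open>Arr\<close> tells whether
  the arrow leaves the root, and \<open>Tri s t\<close> stands for the 3-cycle from the root to the root of \<open>s\<close>, to
  the root of \<open>t\<close> and back.\<close>

datatype rtree = Leaf | Arr bool rtree | Tri rtree rtree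

primrec tsize :: "rtree \<Rightarrow> nat" where
  "tsize Leaf = 1"
| "tsize (Arr d t) = Suc (tsize t)"
| "tsize (Tri s t) = Suc (tsize s + tsize t)"

primrec ttri :: "rtree \<Rightarrow> nat" where
  "ttri Leaf = 0"
| "ttri (Arr d t) = ttri t"
| "ttri (Tri s t) = Suc (ttri s + ttri t)"

type_synonym letter = "bool \<times> rtree option"

definition lsize :: "letter \<Rightarrow> nat" where
  "lsize x = Suc (case snd x of None \<Rightarrow> 0 | Some t \<Rightarrow> tsize t)"

definition ltri :: "letter \<Rightarrow> nat" where
  "ltri x = (case snd x of None \<Rightarrow> 0 | Some t \<Rightarrow> Suc (ttri t))"

text \<open>The codes of weight \<open>r\<close> are the case \<open>h = 0\<close>. In general, \<open>ts\<close> is the stack of trees still to be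
  read at height \<open>h\<close>, so that reading off one node is one step of a lattice path.\<close>

definition codes :: "nat \<Rightarrow> nat \<Rightarrow> (rtree list \<times> letter list) set" where
  "codes h r = {(ts, S). length ts = h \<and> sum_list (map tsize ts) + sum_list (map lsize S) = r}"

definition ntri :: "rtree list \<times> letter list \<Rightarrow> nat" where
  "ntri x = sum_list (map ttri (fst x)) + sum_list (map ltri (snd x))"

lemma tsize_neq_0 [simp]: "tsize t \<noteq> 0"
  by (cases t) auto

lemma lsize_pos [simp]: "lsize x \<noteq> 0"
  by (simp add: lsize_def)

lemma codes_0_0: "codes 0 0 = {([], [])}"
proof -
  have "(\<forall>a b. (a, b) \<notin> set xs) \<longleftrightarrow> xs = []" for xs :: "letter list"
    by (cases xs) auto
  then show ?thesis by (auto simp: codes_def)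
qed

lemma codes_Suc_0: "codes (Suc h) 0 = {}"
  by (auto simp: codes_def length_Suc_conv)

text \<open>The top node of the first tree on the stack is read: \<open>Leaf\<close> removes the
  tree (a step down), \<open>Arr\<close> with either flag keeps the height, \<open>Tri\<close>
  replaces the tree by its two subtrees (a step up).\<close>

lemma codes_Suc_Suc:
  "codes (Suc h) (Suc r) =
     (\<lambda>(ts, S). (Leaf # ts, S)) ` codes h r
   \<union> (\<lambda>(ts, S). (Arr True (hd ts) # tl ts, S)) ` codes (Suc h) r
   \<union> (\<lambda>(ts, S). (Arr False (hd ts) # tl ts, S)) ` codes (Suc h) r
   \<union> (\<lambda>(ts, S). (Tri (hd ts) (hd (tl ts)) # tl (tl ts), S)) ` codes (Suc (Suc h)) r"
  (is "?L = ?R")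
proof
  show "?L \<subseteq> ?R"
  proof
    fix x assume "x \<in> ?L"
    then obtain t ts S where x: "x = (t # ts, S)" "length ts = h"
        "tsize t + (sum_list (map tsize ts) + sum_list (map lsize S)) = Suc r"
      by (auto simp: codes_def length_Suc_conv)
    show "x \<in> ?R"
    proof (cases t)
      case Leaf
      then have "(ts, S) \<in> codes h r" using x by (simp add: codes_def)
      then show ?thesis using x Leaf by force
    next
      case (Arr d s)
      then have "(s # ts, S) \<in> codes (Suc h) r" using x by (simp add: codes_def)
      then show ?thesis using x Arr by (cases d) force+
    next
      case (Tri s s')
      then have "(s # s' # ts, S) \<in> codes (Suc (Suc h)) r" using x by (simp add: codes_def)
      then show ?thesis using x Tri by force
    qed
  qed
qed (auto simp: codes_def length_Suc_conv)

text \<open>With an empty stack the next letter is read. Without a tree it is one of the two level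
  steps; with a tree it puts that tree on the stack. In the latter case the two flags stand for
  leaving height 0 upwards and downwards.\<close>

lemma codes_0_Suc:
  "codes 0 (Suc r) =
     (\<lambda>(ts, S). ([], (True, None) # S)) ` codes 0 r
   \<union> (\<lambda>(ts, S). ([], (False, None) # S)) ` codes 0 r
   \<union> (\<lambda>(ts, S). ([], (True, Some (hd ts)) # S)) ` codes 1 r
   \<union> (\<lambda>(ts, S). ([], (False, Some (hd ts)) # S)) ` codes 1 r"
  (is "?L = ?R")
proof
  show "?L \<subseteq> ?R"
  proof
    fix x assume "x \<in> ?L"
    then obtain S' where x': "x = ([], S')" "sum_list (map lsize S') = Suc r"
      by (auto simp: codes_def)
    then obtain d t S where x: "x = ([], (d, t) # S)" "lsize (d, t) + sum_list (map lsize S) = Suc r"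
      by (cases S') auto
    show "x \<in> ?R"
    proof (cases t)
      case None
      then have "([], S) \<in> codes 0 r" using x by (simp add: codes_def lsize_def)
      then show ?thesis using x None by (cases d) force+
    next
      case (Some s)
      then have "([s], S) \<in> codes 1 r" using x by (simp add: codes_def lsize_def)
      then show ?thesis using x Some by (cases d) force+
    qed
  qed
qed (auto simp: codes_def length_Suc_conv lsize_def)

lemma finite_codes: "finite (codes h r)"
proof (induction r arbitrary: h)
  case 0 then show ?case by (cases h) (simp_all add: codes_0_0 codes_Suc_0)
next
  case (Suc r) then show ?case by (cases h) (simp_all add: codes_0_Suc codes_Suc_Suc)
qed

lemma codes_SucD: "x \<in> codes (Suc h) r \<Longrightarrow> \<exists>t ts S. x = (t # ts, S) \<and> (ts, S) \<in> codes h (r - tsize t)"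
  by (cases x; cases "fst x") (auto simp: codes_def)

lemma inj_on_codes_Suc:
  "inj_on (\<lambda>x. (Leaf # fst x, snd x)) (codes h r)"
  "inj_on (\<lambda>x. (Arr d (hd (fst x)) # tl (fst x), snd x)) (codes (Suc h) r)"
  "inj_on (\<lambda>x. (Tri (hd (fst x)) (hd (tl (fst x))) # tl (tl (fst x)), snd x)) (codes (Suc (Suc h)) r)"
  "inj_on (\<lambda>x. ([] :: rtree list, (d, None) # snd x)) (codes 0 r)"
  "inj_on (\<lambda>x. ([] :: rtree list, (d, Some (hd (fst x))) # snd x)) (codes (Suc 0) r)"
      apply (auto simp: inj_on_def prod_eq_iff)[1]
     apply (rule inj_onI, (drule codes_SucD)+, force)
    apply (rule inj_onI, (drule codes_SucD)+, (elim exE conjE), (drule codes_SucD)+, force)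
   apply (auto simp: inj_on_def codes_def)[1]
  apply (rule inj_onI, (drule codes_SucD)+, force simp: codes_def)
  done

lemma sum_Un4:
  assumes "finite A" "finite B" "finite C" "finite D"
    "A \<inter> B = {}" "A \<inter> C = {}" "A \<inter> D = {}" "B \<inter> C = {}" "B \<inter> D = {}" "C \<inter> D = {}"
  shows "sum g (A \<union> B \<union> C \<union> D) = sum g A + sum g B + sum g C + sum g D"
  using assms by (simp add: sum.union_disjoint Int_Un_distrib2)

text \<open>With a weight \<open>\<phi>\<close> the enumeration by size (\<open>\<phi> = 1\<close>) and the one by size and number of triangles
  (\<open>\<phi>\<close> an indicator function) satisfy one and the same recurrence.\<close>

definition wcodes :: "(nat \<Rightarrow> nat) \<Rightarrow> nat \<Rightarrow> nat \<Rightarrow> nat" where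
  "wcodes \<phi> h r = (\<Sum>x \<in> codes h r. \<phi> (ntri x))"

lemma wcodes_0_0: "wcodes \<phi> 0 0 = \<phi> 0"
  by (simp add: wcodes_def codes_0_0 ntri_def)

lemma wcodes_Suc_0: "wcodes \<phi> (Suc h) 0 = 0"
  by (simp add: wcodes_def codes_Suc_0)

lemma wcodes_Suc_Suc:
  "wcodes \<phi> (Suc h) (Suc r) = wcodes \<phi> h r + 2 * wcodes \<phi> (Suc h) r + wcodes (\<phi> \<circ> Suc) (Suc (Suc h)) r"
proof -
  have n1: "ntri (Leaf # fst x, snd x) = ntri x" for x by (simp add: ntri_def)
  have n2: "x \<in> codes (Suc h) r \<Longrightarrow> ntri (Arr d (hd (fst x)) # tl (fst x), snd x) = ntri x" for x d
    by (drule codes_SucD) (auto simp: ntri_def)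
  have n3: "x \<in> codes (Suc (Suc h)) r \<Longrightarrow>
      ntri (Tri (hd (fst x)) (hd (tl (fst x))) # tl (tl (fst x)), snd x) = Suc (ntri x)" for x
    by (drule codes_SucD, elim exE conjE, drule codes_SucD) (auto simp: ntri_def)
  show ?thesis
    unfolding wcodes_def codes_Suc_Suc case_prod_beta'
    apply (subst sum_Un4)
              apply (simp_all add: finite_codes)
          apply blast+
    apply (simp add: sum.reindex inj_on_codes_Suc n1 n2 n3)
    done
qed

lemma wcodes_0_Suc:
  "wcodes \<phi> 0 (Suc r) = 2 * wcodes \<phi> 0 r + 2 * wcodes (\<phi> \<circ> Suc) 1 r"
proof -
  have n1: "x \<in> codes 0 r \<Longrightarrow> ntri ([], (d, None) # snd x) = ntri x" for x d
    by (auto simp: ntri_def ltri_def codes_def)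
  have n2: "x \<in> codes (Suc 0) r \<Longrightarrow> ntri ([], (d, Some (hd (fst x))) # snd x) = Suc (ntri x)" for x d
    by (drule codes_SucD) (auto simp: ntri_def ltri_def codes_def)
  show ?thesis
    unfolding wcodes_def codes_0_Suc case_prod_beta' One_nat_def
    apply (subst sum_Un4)
              apply (simp_all add: finite_codes)
          apply blast+
    apply (simp add: sum.reindex inj_on_codes_Suc n1 n2)
    done
qed
text \<open>Cutting every step into two steps of height 1/2 or -1/2, the level steps being the two
  mixed orders, gives all sequences of \<open>2 * r\<close> signs with a prescribed sum. The proof
  checks the recurrence, which is Pascal's rule applied twice.\<close>

lemma card_codes: "card (codes h r) = (2 * r) choose (r + h)"
proof -
  have "wcodes (\<lambda>_. 1) h r = (2 * r) choose (r + h)"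
  proof (induction r arbitrary: h)
    case 0
    then show ?case by (cases h) (simp_all add: wcodes_0_0 wcodes_Suc_0)
  next
    case (Suc r)
    show ?case
    proof (cases h)
      case 0
      \<comment> \<open>The two neighbours of height 0 contribute equally; this matches the factor 2
        of \<open>wcodes_0_Suc\<close> with the two outer terms of the doubled Pascal rule.\<close>
      have "(2 * r) choose (r - 1) = (2 * r) choose (Suc r)" if "r > 0"
        using binomial_symmetric[of "r - 1" "2 * r"] that by (simp add: algebra_simps)
      moreover have "Suc (Suc (2 * r)) choose Suc r = 
          (if r > 0 then (2 * r) choose (r - 1) else 0) + 2 * ((2 * r) choose r) + ((2 * r) choose (Suc r))"
        by (cases r) simp_all
      ultimately show ?thesis using 0 Suc.IH[of 0] Suc.IH[of 1]
        by (cases r) (simp_all add: wcodes_0_Suc o_def)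
    next
      case (Suc h')
      then show ?thesis using Suc.IH[of h'] Suc.IH[of "Suc h'"] Suc.IH[of "Suc (Suc h')"]
        by (simp add: wcodes_Suc_Suc o_def)
    qed
  qed
  then show ?thesis by (simp add: wcodes_def)
qed

section \<open>Trinomial coefficients and paths with a given number of up steps\<close>

definition trinomial :: "nat \<Rightarrow> nat \<Rightarrow> nat \<Rightarrow> nat" where
  "trinomial r a b = (r choose a) * ((r - a) choose b)"

lemma trinomial_Suc:
  "trinomial (Suc r) (Suc a) (Suc b) = trinomial r (Suc a) (Suc b) + trinomial r a (Suc b) + trinomial r (Suc a) b"
proof (cases "a < r")
  case True
  then obtain k where "r - a = Suc k" "r - Suc a = k" by (metis Suc_diff_Suc)
  then show ?thesis by (simp add: trinomial_def algebra_simps)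
qed (simp add: trinomial_def)

lemma trinomial_0: "trinomial r 0 b = r choose b" "trinomial r a 0 = r choose a"
  by (simp_all add: trinomial_def)

lemma trinomial_sym: "trinomial r a b = trinomial r b a"
proof (induction r arbitrary: a b)
  case 0 then show ?case by (cases a; cases b) (simp_all add: trinomial_def)
next
  case (Suc r) then show ?case by (cases a; cases b) (simp_all add: trinomial_0 trinomial_Suc)
qed

lemma trinomial_eq_0: "r < a + b \<Longrightarrow> trinomial r a b = 0"
  by (auto simp: trinomial_def)

text \<open>Counts the words of length \<open>r\<close> with \<open>a\<close> letters of one kind,
  \<open>b\<close> of a second kind and the rest from two further kinds, that is, paths with
  \<open>a\<close> steps up and \<open>b\<close> steps down. For \<open>a + b > r\<close> the
  trinomial factor is 0, whatever the truncated exponent.\<close>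

definition steps :: "nat \<Rightarrow> nat \<Rightarrow> nat \<Rightarrow> nat" where
  "steps r a b = 2 ^ (r - a - b) * trinomial r a b"

lemma steps_Suc:
  "steps (Suc r) (Suc a) (Suc b) = 2 * steps r (Suc a) (Suc b) + steps r a (Suc b) + steps r (Suc a) b"
proof (cases "Suc a + Suc b \<le> r")
  case True
  then obtain k where k: "r - Suc a - Suc b = k" "r - a - Suc b = Suc k" "r - Suc a - b = Suc k" by force
  then show ?thesis by (simp add: steps_def trinomial_Suc algebra_simps)
next
  case False
  then show ?thesis by (simp add: steps_def trinomial_Suc trinomial_eq_0 algebra_simps)
qed

lemma steps_sym: "steps r a b = steps r b a"
  by (simp add: steps_def trinomial_sym[of r a b] add.commute diff_diff_left)

lemma steps_0_Suc: "steps (Suc r) 0 (Suc b) = 2 * steps r 0 (Suc b) + steps r 0 b"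
proof (cases "Suc b \<le> r")
  case True
  then obtain k where k: "r - Suc b = k" "r - b = Suc k" by force
  then show ?thesis by (simp add: steps_def trinomial_0 algebra_simps)
next
  case False
  then show ?thesis by (simp add: steps_def trinomial_0 algebra_simps)
qed

text \<open>\<open>j\<close> counts the steps leading away from height 0. Excursions below 0 contain
  as many steps up as down, so \<open>j\<close> is also the number of steps up of a path from
  \<open>h\<close> to 0, and \<open>j + h\<close> that of its steps down.\<close>

lemma wcodes_indicator:
  "wcodes (\<lambda>i. of_bool (i = j)) h r = steps r j (j + h)"
proof (induction r arbitrary: h j)
  case 0
  then show ?case by (cases h; cases j) (simp_all add: wcodes_0_0 wcodes_Suc_0 steps_def trinomial_def)
next
  case (Suc r)
  have ind: "(\<lambda>i. of_bool (i = 0)) \<circ> Suc = (\<lambda>_. 0 :: nat)"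
    "(\<lambda>i. of_bool (i = Suc k)) \<circ> Suc = (\<lambda>i. of_bool (i = k) :: nat)" for k
    by (auto simp: o_def)
  have 0: "wcodes (\<lambda>_. 0) h r = 0" for h by (simp add: wcodes_def)
  show ?case
  proof (cases h)
    case h0: 0
    show ?thesis
    proof (cases j)
      case 0
      then show ?thesis using h0 Suc.IH[of 0 0]
        by (simp add: wcodes_0_Suc ind \<open>\<And>h. wcodes (\<lambda>_. 0) h r = 0\<close>) (simp add: steps_def trinomial_def)
    next
      case (Suc k)
      \<comment> \<open>By \<open>steps_sym\<close> the doubled term for leaving height 0 splits
        into the two different outer terms of \<open>steps_Suc\<close>.\<close>
      then show ?thesis using h0 Suc.IH[of j 0] Suc.IH[of k 1]
        by (simp add: wcodes_0_Suc ind steps_Suc steps_sym[of r "Suc k" k])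
    qed
  next
    case (Suc h')
    show ?thesis
    proof (cases j)
      case 0
      then show ?thesis using \<open>h = Suc h'\<close> Suc.IH[of j h'] Suc.IH[of j "Suc h'"]
        by (simp add: wcodes_Suc_Suc ind 0 steps_0_Suc \<open>\<And>h. wcodes (\<lambda>_. 0) h r = 0\<close>)
    next
      case (Suc k)
      then show ?thesis using \<open>h = Suc h'\<close> Suc.IH[of j h'] Suc.IH[of j "Suc h'"] Suc.IH[of k "Suc (Suc h')"]
        by (simp add: wcodes_Suc_Suc ind steps_Suc)
    qed
  qed
qed

lemma card_codes_ntri:
  "card {x \<in> codes h r. ntri x = j} = steps r j (j + h)"
proof -
  have "card {x \<in> codes h r. ntri x = j} = wcodes (\<lambda>i. of_bool (i = j)) h r"
    by (simp add: wcodes_def sum.If_cases finite_codes of_bool_def Int_def cong: conj_cong)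
  then show ?thesis by (simp add: wcodes_indicator)
qed

text \<open>For \<open>2 * j > r\<close> both sides vanish, the right one by the convention on
  negative entries; otherwise the two binomials multiply to the quotient of factorials.\<close>

lemma steps_multinomial:
  "real (steps r j j) = 2 powi (int r - 2 * int j) * real (multinomial r [int j, int j, int r - 2 * int j])"
proof (cases "2 * j \<le> r")
  case False
  then have "int r - 2 * int j < 0" by linarith
  then show ?thesis using False by (simp add: multinomial_def steps_def trinomial_eq_0)
next
  case True
  then have e: "int r - 2 * int j = int (r - 2 * j)" by simp
  have jj: "r - j - j = r - 2 * j" by simp
  have f1: "fact j * fact (r - 2 * j) * ((r - j) choose j) = fact (r - j)"
    using binomial_fact_lemma[of j "r - j"] True unfolding jj by simp
  have f2: "fact j * fact (r - j) * (r choose j) = fact r"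
    using binomial_fact_lemma[of j r] True by simp
  have "fact j * fact j * fact (r - 2 * j) * trinomial r j j = fact r"
    unfolding trinomial_def f2[symmetric] f1[symmetric] by simp
  then have "fact r div (fact j * (fact j * fact (r - 2 * j))) = trinomial r j j"
    by (metis fact_nonzero mult.assoc mult_eq_0_iff nonzero_mult_div_cancel_left)
  moreover have "r - j - j = r - 2 * j" by simp
  ultimately show ?thesis
    unfolding e by (simp add: multinomial_def steps_def)
qed


section \<open>Mirror-symmetric periodic words and their two codes\<close>

definition flip :: "letter \<Rightarrow> letter" where
  "flip x = (\<not> fst x, snd x)"

lemma flip_simps [simp]:
  "flip x \<noteq> x" "x \<noteq> flip x" "flip (flip x) = x" "fst (flip x) = (\<not> fst x)" "snd (flip x) = snd x"
  by (auto simp: flip_def prod_eq_iff)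

text \<open>The code followed by its mirror image, repeated periodically. The letter at
  \<open>i\<close> belongs to the base arrow between vertices \<open>i\<close> and
  \<open>i + 1\<close>, so the reflection in vertex 0 sends \<open>i\<close> to
  \<open>- 1 - i\<close>. It reverses the arrow relative to the order of the indices, but a rooted
  quiver has no planar structure and stays as it is; thus \<open>flip\<close> changes the first
  component only.\<close>

definition word :: "letter list \<Rightarrow> int \<Rightarrow> letter" where
  "word S i = (let n = 2 * int (length S); j = i mod n in
     if j < int (length S) then S ! nat j else flip (S ! nat (n - 1 - j)))"

lemma word_periodic: "word S (i + 2 * int (length S)) = word S i"
  by (simp add: word_def)

lemma word_mirror:
  assumes "S \<noteq> []"
  shows "word S (- 1 - i) = flip (word S i)"
proof -
  define m where "m = int (length S)"
  have m: "m > 0" using assms by (simp add: m_def)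
  define j where "j = i mod (2 * m)"
  have j: "0 \<le> j" "j < 2 * m" using m by (auto simp: j_def)
  have "i = 2 * m * (i div (2 * m)) + j" by (simp add: j_def)
  then have "- 1 - i = (2 * m - 1 - j) + (2 * m) * (- 1 - i div (2 * m))" by (simp add: algebra_simps)
  then have "(- 1 - i) mod (2 * m) = (2 * m - 1 - j) mod (2 * m)" by (metis mod_mult_self2)
  also have "\<dots> = 2 * m - 1 - j" using j by (intro mod_pos_pos_trivial) auto
  finally have *: "(- 1 - i) mod (2 * m) = 2 * m - 1 - j" .
  show ?thesis
    using j unfolding word_def Let_def m_def[symmetric] * j_def[symmetric] by auto
qed

lemma word_nth: "i < length S \<Longrightarrow> word S (int i) = S ! i"
  by (simp add: word_def)

text \<open>The first \<open>m\<close> positions are a fundamental domain for the group generated by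
  the translation by \<open>2 * m\<close> and the reflection in vertex 0.\<close>

lemma word_determined:
  assumes per: "\<And>i. w (i + 2 * int m) = w i" and mir: "\<And>i. w (- 1 - i) = flip (w i)" and m: "m > 0"
  shows "word (map (\<lambda>i. w (int i)) [0..<m]) = w"
proof
  fix i
  define n where "n = 2 * int m"
  define j where "j = i mod n"
  have j: "0 \<le> j" "j < n" using m by (auto simp: j_def n_def)
  have per': "w (i + int k * n) = w i" for i k
  proof (induction k)
    case (Suc k)
    then show ?case using per[of "i + int k * n"] by (simp add: n_def algebra_simps)
  qed simp
  have per'': "w (i + k * n) = w i" for i k
  proof (cases "k \<ge> 0")
    case True
    then show ?thesis using per'[of i "nat k"] by simp
  next
    case False
    then show ?thesis using per'[of "i + k * n" "nat (- k)"] by (simp add: algebra_simps)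
  qed
  have wi: "w i = w j"
    using per''[of j "i div n"] by (simp add: j_def algebra_simps)
  have "w (n - 1 - j) = flip (w j)"
    using per[of "- 1 - j"] mir[of j] by (simp add: n_def algebra_simps)
  moreover have "w (int (nat (n - 1 - j))) = w (n - 1 - j)" using j by simp
  moreover have "w (int (nat j)) = w j" using j by simp
  ultimately show "word (map (\<lambda>i. w (int i)) [0..<m]) i = w i"
    using j unfolding word_def Let_def wi by (simp add: n_def[symmetric] j_def[symmetric]) (auto simp: n_def)
qed

lemma word_inject: "length S = length S' \<Longrightarrow> word S = word S' \<Longrightarrow> S = S'"
  by (metis nth_equalityI word_nth)

text \<open>These turn out to be all codes of the quiver with code \<open>S\<close>. Shifts suffice:
  the mirror symmetry turns every reversal of the word into a shift.\<close>

definition codes_of :: "letter list \<Rightarrow> letter list set" where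
  "codes_of S = {S'. length S' = length S \<and> (\<exists>j. \<forall>i. word S' i = word S (i + j))}"

text \<open>The periods form a subgroup of the integers, generated by its least positive
  element.\<close>

lemma periods_multiple:
  fixes w :: "int \<Rightarrow> 'x"
  assumes n: "n > 0" "\<And>i. w (i + n) = w i"
  obtains p where "p > 0" "\<And>d. (\<forall>i. w (i + d) = w i) \<longleftrightarrow> p dvd d"
proof -
  define P where "P d \<longleftrightarrow> (\<forall>i. w (i + d) = w i)" for d
  have add: "P (a + b)" if "P a" "P b" for a b
    using that unfolding P_def by (metis add.assoc)
  have neg: "P (- a)" if "P a" for a
    using that unfolding P_def by (metis add.assoc add.right_inverse add_0_right add.commute)
  have P0: "P 0" by (simp add: P_def)
  have mult: "P (int k * a)" if "P a" for a k
    by (induction k) (auto simp: P0 distrib_right intro: add that)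
  have mult': "P (k * a)" if "P a" for a k
    using mult[OF that, of "nat \<bar>k\<bar>"] neg[of "nat \<bar>k\<bar> * a"] by (cases "k \<ge> 0") auto
  define p where "p = (LEAST k. k > 0 \<and> P (int k))"
  have "nat n > 0 \<and> P (int (nat n))" using n by (simp add: P_def)
  then have p: "p > 0" "P (int p)" unfolding p_def by (rule LeastI2, blast)+
  have "int p dvd d" if "P d" for d
  proof (rule ccontr)
    assume "\<not> int p dvd d"
    then have "d mod int p \<noteq> 0" by (simp add: mod_eq_0_iff_dvd)
    moreover have "0 \<le> d mod int p" "d mod int p < int p" using p(1) by simp_all
    ultimately have r: "d mod int p > 0" "d mod int p < int p" by simp_all
    have "P (d mod int p)" using add[OF that neg[OF mult'[OF p(2), of "d div int p"]]]
      by (simp add: minus_div_mult_eq_mod)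
    then have "nat (d mod int p) > 0 \<and> P (int (nat (d mod int p)))" using r by simp
    then have "p \<le> nat (d mod int p)" unfolding p_def by (rule Least_le)
    then show False using r by linarith
  qed
  moreover have "P d" if "int p dvd d" for d
    using that mult'[OF p(2)] by (metis dvdE mult.commute)
  ultimately show thesis using that[of "int p"] p unfolding P_def by auto
qed

lemma card_codes_of:
  assumes "S \<noteq> []"
  shows "card (codes_of S) = 2"
proof -
  define w where "w = word S"
  define m where "m = length S"
  have m: "m > 0" using assms by (simp add: m_def)
  have per: "w (i + 2 * int m) = w i" for i by (simp add: w_def m_def word_periodic)
  have mir: "w (- 1 - i) = flip (w i)" for i using assms by (simp add: w_def word_mirror)
  obtain p where p: "p > 0" "\<And>d. (\<forall>i. w (i + d) = w i) \<longleftrightarrow> p dvd d"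
    using periods_multiple[of "2 * int m" w] m per by auto
  have "even p"
  proof (rule ccontr)
    assume "odd p"
    then obtain k where k: "p = 2 * k + 1" by (auto elim: oddE)
    \<comment> \<open>Both the translation by \<open>p\<close> and the reflection carry
      \<open>- 1 - k\<close> to \<open>k\<close>, the latter with a flip.\<close>
    have "w (- 1 - k + p) = w (- 1 - k)" using p(2)[of p] by simp
    then show False using mir[of k] by (simp add: k)
  qed
  then obtain q where q: "p = 2 * q" by auto
  \<comment> \<open>Modulo the period there are exactly two centres of symmetry, 0 and
    \<open>q\<close>; the second code starts at \<open>q\<close>.\<close>
  define w' where "w' i = w (i + q)" for i
  define B where "B = map (\<lambda>i. w' (int i)) [0..<m]"
  have shift: "w (i + d * p) = w i" for i d using p(2)[of "d * p"] by simp
  have wB: "word B = w'"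
    unfolding B_def
  proof (rule word_determined[OF _ _ m])
    show "w' (i + 2 * int m) = w' i" for i
      using per[of "i + q"] by (simp add: w'_def algebra_simps)
    show "w' (- 1 - i) = flip (w' i)" for i
      using mir[of "i + q"] shift[of "- 1 - i - q" 1] by (simp add: w'_def q algebra_simps)
  qed
  have lB: "length B = m" by (simp add: B_def)
  have "\<not> p dvd q" using p(1) q by (auto dest: zdvd_imp_le)
  then have "w' \<noteq> w" unfolding p(2)[symmetric] by (auto simp: w'_def fun_eq_iff)
  then have "B \<noteq> S" using wB by (auto simp: w_def)
  moreover have "codes_of S = {S, B}"
  proof
    show "{S, B} \<subseteq> codes_of S"
      using lB wB by (auto simp: codes_of_def m_def w'_def w_def intro: exI[of _ 0] exI[of _ q])
    show "codes_of S \<subseteq> {S, B}"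
    proof
      fix S' assume "S' \<in> codes_of S"
      then obtain j where j: "length S' = m" "\<And>i. word S' i = w (i + j)"
        by (auto simp: codes_of_def m_def w_def)
      \<comment> \<open>The word is mirror-symmetric about 0 and, because of \<open>S'\<close>,
        about \<open>j\<close>; the two reflections compose to the translation by
        \<open>2 * j\<close>.\<close>
      have "w (i + 2 * j) = w i" for i
      proof -
        have "word S' (- 1 - (i + j)) = flip (word S' (i + j))" using j(1) m by (intro word_mirror) auto
        then have "w (- 1 - i) = flip (w (i + 2 * j))" by (simp add: j algebra_simps)
        then show ?thesis using mir[of i] by (metis flip_simps(3))
      qed
      then have "p dvd 2 * j" using p(2) by auto
      then have "q dvd j" by (simp add: q)
      then obtain l where l: "j = q * l" by auto
      show "S' \<in> {S, B}"
      proof (cases "even l")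
        case True
        then have "word S' i = word S i" for i
          using shift[of i "l div 2"] by (simp add: j l q w_def[symmetric] algebra_simps)
        then have "S' = S" using j(1) by (intro word_inject) (auto simp: m_def)
        then show ?thesis by simp
      next
        case False
        then obtain k where "l = 2 * k + 1" by (auto elim: oddE)
        then have "word S' i = word B i" for i
          using shift[of "i + q" k] by (simp add: j l q wB w'_def algebra_simps)
        then have "S' = B" using j(1) lB by (intro word_inject) auto
        then show ?thesis by simp
      qed
    qed
  qed
  ultimately show ?thesis by (simp add: card_insert_if)
qed

section \<open>Rooted quivers of type A\<close>

text \<open>Vertices are addresses with \<open>[]\<close> as the root. \<open>True\<close> leads to
  the only child of an \<open>Arr\<close> node and to the second one of a \<open>Tri\<close> node;
  prefixing keeps the vertices of different subtrees apart.\<close>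

primrec pos :: "rtree \<Rightarrow> bool list set" where
  "pos Leaf = {[]}"
| "pos (Arr d t) = insert [] (Cons True ` pos t)"
| "pos (Tri s t) = insert [] (Cons False ` pos s \<union> Cons True ` pos t)"

primrec edges :: "rtree \<Rightarrow> (bool list \<times> bool list) set" where
  "edges Leaf = {}"
| "edges (Arr d t) = insert (if d then ([], [True]) else ([True], []))
     (map_prod (Cons True) (Cons True) ` edges t)"
| "edges (Tri s t) = {([], [False]), ([False], [True]), ([True], [])} \<union>
     map_prod (Cons False) (Cons False) ` edges s \<union> map_prod (Cons True) (Cons True) ` edges t"

lemma Nil_in_pos [simp]: "[] \<in> pos t"
  by (cases t) auto

lemma finite_pos [simp]: "finite (pos t)"
  by (induction t) auto

lemma finite_edges [simp]: "finite (edges t)"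
  by (induction t) auto

lemma card_pos: "card (pos t) = tsize t"
proof (induction t)
  case (Tri s t)
  have "card (Cons False ` pos s \<union> Cons True ` pos t) = card (pos s) + card (pos t)"
    by (subst card_Un_disjoint) (auto simp: card_image)
  then show ?case using Tri by (subst pos.simps, subst card_insert_disjoint) auto
qed (auto simp: card_insert_if card_image)

lemma edges_subset: "edges t \<subseteq> pos t \<times> pos t"
  by (induction t) auto

lemma edges_in_pos: "(p, q) \<in> edges t \<Longrightarrow> p \<in> pos t \<and> q \<in> pos t"
  using edges_subset by blast

lemma edges_asym: "(p, q) \<in> edges t \<Longrightarrow> (q, p) \<notin> edges t"
  by (induction t arbitrary: p q) (auto split: if_splits dest: edges_in_pos)

lemma edges_irrefl: "(p, p) \<notin> edges t"
  using edges_asym by blast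

section \<open>Oriented 3-cycles in a tree\<close>

definition cyc3 :: "('a \<times> 'a) set \<Rightarrow> 'a set set" where
  "cyc3 R = {{x, y, z} | x y z. (x, y) \<in> R \<and> (y, z) \<in> R \<and> (z, x) \<in> R}"

lemma cyc3E:
  assumes "c \<in> cyc3 R"
  obtains x y z where "c = {x, y, z}" "(x, y) \<in> R" "(y, z) \<in> R" "(z, x) \<in> R"
  using assms unfolding cyc3_def by blast

lemma cyc3I: "(x, y) \<in> R \<Longrightarrow> (y, z) \<in> R \<Longrightarrow> (z, x) \<in> R \<Longrightarrow> {x, y, z} \<in> cyc3 R"
  unfolding cyc3_def by blast

text \<open>Only the edges of the new triangle touch the root or pass between the subtrees, and a
  3-cycle using one of them has to use all three.\<close>

lemma cyc3_edges_Tri: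
  "cyc3 (edges (Tri s t)) = insert {[], [False], [True]}
     (image (Cons False) ` cyc3 (edges s) \<union> image (Cons True) ` cyc3 (edges t))" (is "?L = ?R")
proof
  show "?R \<subseteq> ?L"
    by (auto simp: cyc3_def) (blast | force)+
  show "?L \<subseteq> ?R"
  proof
    fix c assume "c \<in> ?L"
    then obtain x y z where c: "c = {x, y, z}" "(x, y) \<in> edges (Tri s t)" "(y, z) \<in> edges (Tri s t)"
      "(z, x) \<in> edges (Tri s t)" by (rule cyc3E)
    consider "x \<in> range (Cons False)" "y \<in> range (Cons False)" "z \<in> range (Cons False)"
      | "x \<in> range (Cons True)" "y \<in> range (Cons True)" "z \<in> range (Cons True)"
      | "c = {[], [False], [True]}"
      using c by auto
    then show "c \<in> ?R"
    proof cases
      case 1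
      then obtain p q r where xyz: "x = False # p" "y = False # q" "z = False # r" by blast
      have "{p, q, r} \<in> cyc3 (edges s)" by (rule cyc3I) (use c xyz in auto)
      moreover have "c = Cons False ` {p, q, r}" using c xyz by simp
      ultimately show ?thesis by blast
    next
      case 2
      then obtain p q r where xyz: "x = True # p" "y = True # q" "z = True # r" by blast
      have "{p, q, r} \<in> cyc3 (edges t)" by (rule cyc3I) (use c xyz in auto)
      moreover have "c = Cons True ` {p, q, r}" using c xyz by simp
      ultimately show ?thesis by blast
    qed simp
  qed
qed

text \<open>The root has a single neighbour, so it lies on no 3-cycle.\<close>

lemma cyc3_edges_Arr: "cyc3 (edges (Arr d t)) = image (Cons True) ` cyc3 (edges t)" (is "?L = ?R")
proof
  show "?R \<subseteq> ?L"
    by (auto simp: cyc3_def)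
  show "?L \<subseteq> ?R"
  proof
    fix c assume "c \<in> ?L"
    then obtain x y z where c: "c = {x, y, z}" "(x, y) \<in> edges (Arr d t)" "(y, z) \<in> edges (Arr d t)"
      "(z, x) \<in> edges (Arr d t)" by (rule cyc3E)
    then have "x \<in> range (Cons True)" "y \<in> range (Cons True)" "z \<in> range (Cons True)"
      by (auto split: if_splits dest: edges_in_pos)
    then obtain p q r where xyz: "x = True # p" "y = True # q" "z = True # r" by blast
    have "{p, q, r} \<in> cyc3 (edges t)" by (rule cyc3I) (use c xyz in \<open>auto split: if_splits\<close>)
    moreover have "c = Cons True ` {p, q, r}" using c xyz by simp
    ultimately show "c \<in> ?R" by blast
  qed
qed

lemma cyc3_edges_subset: "cyc3 (edges t) \<subseteq> Pow (pos t)"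
  using edges_subset by (fastforce simp: cyc3_def)

lemma finite_cyc3_edges: "finite (cyc3 (edges t))"
  using finite_subset[OF cyc3_edges_subset] by simp

lemma card_cyc3_edges: "card (cyc3 (edges t)) = ttri t"
proof (induction t)
  case Leaf
  then show ?case by (simp add: cyc3_def)
next
  case (Arr d t)
  have "inj (image (Cons True))" by (simp add: inj_image_eq_iff inj_def)
  then show ?case using Arr
    unfolding cyc3_edges_Arr by (subst card_image) (auto intro: inj_on_subset)
next
  case (Tri s t)
  have i: "inj (image (Cons b))" for b :: bool by (simp add: inj_image_eq_iff inj_def)
  have ne: "c \<noteq> {}" if "c \<in> cyc3 R" for c and R :: "(bool list \<times> bool list) set" using that by (auto simp: cyc3_def)
  have d: "image (Cons False) ` cyc3 (edges s) \<inter> image (Cons True) ` cyc3 (edges t) = {}"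
  proof -
    have "Cons False ` c \<noteq> Cons True ` c'" if "c \<noteq> {}" for c c' :: "bool list set" using that by auto
    then show ?thesis using ne by (intro disjoint_iff[THEN iffD2]) (metis imageE)
  qed
  have "{[], [False], [True]} \<notin> image (Cons False) ` cyc3 (edges s) \<union> image (Cons True) ` cyc3 (edges t)"
    by auto
  then show ?case using Tri
    unfolding cyc3_edges_Tri
    by (simp add: finite_cyc3_edges card_Un_disjoint d card_image inj_on_subset[OF i])
qed

lemma arcs_endsE:
  assumes "x \<in> arcs_ends Q"
  obtains e where "e \<in> arcs Q" "arc_to_ends Q e = x"
  using assms unfolding arcs_ends_def by blast

section \<open>Rooted quivers of type A inside a larger quiver\<close>

definition touching :: "('a, 'b) pre_digraph \<Rightarrow> 'a set \<Rightarrow> 'b set" where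
  "touching Q V = {e \<in> arcs Q. tail Q e \<in> V \<or> head Q e \<in> V}"

text \<open>A rooted quiver of type A with vertex set \<open>f ` pos t\<close> inside \<open>Q\<close>, joined to the rest of \<open>Q\<close>
  only by arrows between its root \<open>f []\<close> and \<open>X\<close>.\<close>

definition emb :: "('a, 'b) pre_digraph \<Rightarrow> 'a set \<Rightarrow> (bool list \<Rightarrow> 'a) \<Rightarrow> rtree \<Rightarrow> bool" where
  "emb Q X f t \<longleftrightarrow> inj_on f (pos t) \<and> X \<inter> f ` pos t = {} \<and>
     map_prod f f ` edges t \<subseteq> arcs_ends Q \<and>
     inj_on (arc_to_ends Q) (touching Q (f ` pos t)) \<and>
     arc_to_ends Q ` touching Q (f ` pos t) \<subseteq> map_prod f f ` edges t \<union> ({f []} \<times> X \<union> X \<times> {f []})"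

text \<open>Lets inductions descend from a tree to a subtree: the addresses \<open>Y\<close> outside
  the subtree that are adjacent to its root take over the role of \<open>X\<close>.\<close>

lemma emb_subtree:
  assumes emb: "emb Q X f t" and pos: "Cons b ` pos s \<subseteq> pos t" and Y: "Y \<subseteq> pos t - range (Cons b)"
    and edges: "map_prod (Cons b) (Cons b) ` edges s \<subseteq> edges t"
    and border: "\<And>p q. (p, q) \<in> edges t \<Longrightarrow> p \<in> Cons b ` pos s \<or> q \<in> Cons b ` pos s \<Longrightarrow>
      (p, q) \<in> map_prod (Cons b) (Cons b) ` edges s \<union> ({[b]} \<times> Y \<union> Y \<times> {[b]})"
  shows "emb Q (f ` Y) (f \<circ> Cons b) s"
proof -
  let ?g = "f \<circ> Cons b"
  have inj: "inj_on f (pos t)" and X: "X \<inter> f ` pos t = {}" and sub: "map_prod f f ` edges t \<subseteq> arcs_ends Q"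
    and simple: "inj_on (arc_to_ends Q) (touching Q (f ` pos t))"
    and tou: "arc_to_ends Q ` touching Q (f ` pos t) \<subseteq> map_prod f f ` edges t \<union> ({f []} \<times> X \<union> X \<times> {f []})"
    using emb by (simp_all only: emb_def)
  have gs: "?g ` pos s = f ` Cons b ` pos s" by (simp add: image_comp)
  have mem: "p \<in> Cons b ` pos s" if "p \<in> pos t" "f p \<in> ?g ` pos s" for p
    using that(2) unfolding gs inj_on_image_mem_iff[OF inj that(1) pos] .
  have T: "touching Q (?g ` pos s) \<subseteq> touching Q (f ` pos t)" using pos by (auto simp: touching_def)
  have root: "f [] \<notin> ?g ` pos s" using mem[of "[]"] by auto
  have Xg: "X \<inter> ?g ` pos s = {}" using X pos unfolding gs by blast
  have "arc_to_ends Q e \<in> map_prod ?g ?g ` edges s \<union> ({?g []} \<times> f ` Y \<union> f ` Y \<times> {?g []})"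
    if e: "e \<in> touching Q (?g ` pos s)" for e
  proof -
    have "arc_to_ends Q e \<notin> {f []} \<times> X \<union> X \<times> {f []}"
      using e root Xg by (auto simp: touching_def arc_to_ends_def)
    then have "arc_to_ends Q e \<in> map_prod f f ` edges t" using e T tou by blast
    then obtain p q where pq: "(p, q) \<in> edges t" "tail Q e = f p" "head Q e = f q"
      by (auto simp: arc_to_ends_def)
    then have "p \<in> Cons b ` pos s \<or> q \<in> Cons b ` pos s"
      using e mem edges_in_pos[OF pq(1)] by (auto simp: touching_def)
    with pq(1) have "(p, q) \<in> map_prod (Cons b) (Cons b) ` edges s \<union> ({[b]} \<times> Y \<union> Y \<times> {[b]})" by (rule border)
    moreover have "map_prod f f ` map_prod (Cons b) (Cons b) ` edges s = map_prod ?g ?g ` edges s"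
      by (simp add: image_comp map_prod.comp)
    moreover have "arc_to_ends Q e = map_prod f f (p, q)" using pq by (simp add: arc_to_ends_def)
    ultimately show ?thesis by auto
  qed
  moreover have "inj_on ?g (pos s)" by (intro comp_inj_on inj_on_subset[OF inj pos]) simp
  moreover have "map_prod ?g ?g ` edges s \<subseteq> arcs_ends Q" using sub edges by force
  moreover have "inj_on (arc_to_ends Q) (touching Q (?g ` pos s))" using simple T by (rule inj_on_subset)
  moreover have "f ` Y \<inter> ?g ` pos s = {}" using mem Y by blast
  ultimately show ?thesis unfolding emb_def by blast
qed

lemma emb_Arr: "emb Q X f (Arr d t) \<Longrightarrow> emb Q {f []} (f \<circ> Cons True) t"
  using emb_subtree[of Q X f "Arr d t" True t "{[]}"] by (force split: if_splits)

lemma emb_Tri: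
  assumes "emb Q X f (Tri s t)"
  shows "emb Q {f [], f [True]} (f \<circ> Cons False) s" and "emb Q {f [], f [False]} (f \<circ> Cons True) t"
proof -
  have "emb Q (f ` {[], [True]}) (f \<circ> Cons False) s" using assms by (rule emb_subtree) (auto dest: edges_in_pos)
  moreover have "emb Q (f ` {[], [False]}) (f \<circ> Cons True) t" using assms by (rule emb_subtree) (auto dest: edges_in_pos)
  ultimately show "emb Q {f [], f [True]} (f \<circ> Cons False) s" "emb Q {f [], f [False]} (f \<circ> Cons True) t" by simp_all
qed

text \<open>The left-hand sides mention the quiver, the root and \<open>X\<close> only, so they
  agree for any two embeddings with the same root and the same \<open>X\<close>. This is what
  \<open>emb_unique\<close> compares.\<close>

lemma emb_root_out:
  assumes "emb Q X f t"
  shows "{y. (f [], y) \<in> arcs_ends Q} - X = f ` {p. ([], p) \<in> edges t}"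
    and "{y. (y, f []) \<in> arcs_ends Q} - X = f ` {p. (p, []) \<in> edges t}"
proof -
  have inj: "inj_on f (pos t)" and X: "X \<inter> f ` pos t = {}"
    and sub: "map_prod f f ` edges t \<subseteq> arcs_ends Q"
    and tou: "arc_to_ends Q ` touching Q (f ` pos t) \<subseteq> map_prod f f ` edges t \<union> ({f []} \<times> X \<union> X \<times> {f []})"
    using assms by (auto simp only: emb_def)
  have rootX: "f [] \<notin> X" using X by (metis Nil_in_pos disjoint_iff imageI)
  have root: "(x, y) \<in> map_prod f f ` edges t \<union> ({f []} \<times> X \<union> X \<times> {f []})"
    if xy: "(x, y) \<in> arcs_ends Q" "x = f [] \<or> y = f []" for x y
  proof -
    from xy(1) obtain e where e: "e \<in> arcs Q" "arc_to_ends Q e = (x, y)" by (rule arcs_endsE)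
    then have "e \<in> touching Q (f ` pos t)" using xy(2) by (auto simp: touching_def arc_to_ends_def)
    then show ?thesis using tou e(2) by force
  qed
  have i: "f [] = f p \<Longrightarrow> p \<in> pos t \<Longrightarrow> p = []" for p using inj by (auto dest: inj_onD)
  show "{y. (f [], y) \<in> arcs_ends Q} - X = f ` {p. ([], p) \<in> edges t}"
  proof (intro equalityI subsetI)
    fix y assume "y \<in> {y. (f [], y) \<in> arcs_ends Q} - X"
    then have "(f [], y) \<in> map_prod f f ` edges t" using root[of "f []" y] rootX by auto
    then show "y \<in> f ` {p. ([], p) \<in> edges t}" using i by (auto dest: edges_in_pos)
  next
    fix y assume "y \<in> f ` {p. ([], p) \<in> edges t}"
    then obtain p where "([], p) \<in> edges t" "y = f p" by auto
    then show "y \<in> {y. (f [], y) \<in> arcs_ends Q} - X"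
      using sub X edges_in_pos[of "[]" p t] by force
  qed
  show "{y. (y, f []) \<in> arcs_ends Q} - X = f ` {p. (p, []) \<in> edges t}"
  proof (intro equalityI subsetI)
    fix y assume "y \<in> {y. (y, f []) \<in> arcs_ends Q} - X"
    then have "(y, f []) \<in> map_prod f f ` edges t" using root[of y "f []"] rootX by auto
    then show "y \<in> f ` {p. (p, []) \<in> edges t}" using i by (auto dest: edges_in_pos)
  next
    fix y assume "y \<in> f ` {p. (p, []) \<in> edges t}"
    then obtain p where "(p, []) \<in> edges t" "y = f p" by auto
    then show "y \<in> {y. (y, f []) \<in> arcs_ends Q} - X"
      using sub X edges_in_pos[of p "[]" t] by force
  qed
qed

lemma root_edges:
  "f ` {p. ([], p) \<in> edges Leaf} = {}" "f ` {p. (p, []) \<in> edges Leaf} = {}"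
  "f ` {p. ([], p) \<in> edges (Arr d t)} = (if d then {f [True]} else {})"
  "f ` {p. (p, []) \<in> edges (Arr d t)} = (if d then {} else {f [True]})"
  "f ` {p. ([], p) \<in> edges (Tri s t)} = {f [False]}" "f ` {p. (p, []) \<in> edges (Tri s t)} = {f [True]}"
  by (auto split: if_splits)

text \<open>Apart from \<open>X\<close>, the root has no neighbour for \<open>Leaf\<close>, one for
  \<open>Arr\<close> (its direction being the flag), and one out-neighbour and one in-neighbour for
  \<open>Tri\<close>, which are the roots of the first and the second subtree. So the constructors
  agree, and the subtrees have the same roots and the same borders.\<close>

lemma emb_unique:
  assumes "emb Q X f t" "emb Q X f' t'" "f [] = f' []"
  shows "t = t'"
  using assms
proof (induction t arbitrary: X f f' t')
  case Leaf
  have r: "f ` {p. ([], p) \<in> edges Leaf} = f' ` {p. ([], p) \<in> edges t'}"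
    "f ` {p. (p, []) \<in> edges Leaf} = f' ` {p. (p, []) \<in> edges t'}"
    using emb_root_out[OF Leaf(1)] emb_root_out[OF Leaf(2)] Leaf(3) by simp_all
  then show ?case by (cases t') (auto simp: root_edges simp del: edges.simps split: if_splits)
next
  case (Arr d t)
  have r: "f ` {p. ([], p) \<in> edges (Arr d t)} = f' ` {p. ([], p) \<in> edges t'}"
    "f ` {p. (p, []) \<in> edges (Arr d t)} = f' ` {p. (p, []) \<in> edges t'}"
    using emb_root_out[OF Arr.prems(1)] emb_root_out[OF Arr.prems(2)] Arr.prems(3) by simp_all
  then obtain t'' where t': "t' = Arr d t''" "f' [True] = f [True]"
    by (cases t'; cases d) (auto simp: root_edges simp del: edges.simps split: if_splits)
  show ?case
    using Arr.IH[OF emb_Arr[OF Arr.prems(1)], of "f' \<circ> Cons True" t''] emb_Arr[of Q X f' d t''] Arr.prems t'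
    by (simp add: o_def)
next
  case (Tri s t)
  have r: "f ` {p. ([], p) \<in> edges (Tri s t)} = f' ` {p. ([], p) \<in> edges t'}"
    "f ` {p. (p, []) \<in> edges (Tri s t)} = f' ` {p. (p, []) \<in> edges t'}"
    using emb_root_out[OF Tri.prems(1)] emb_root_out[OF Tri.prems(2)] Tri.prems(3) by simp_all
  then obtain s' t'' where t': "t' = Tri s' t''" "f' [True] = f [True]" "f' [False] = f [False]"
    by (cases t') (auto simp: root_edges simp del: edges.simps split: if_splits)
  show ?case
    using Tri.IH(1)[OF emb_Tri(1)[OF Tri.prems(1)], of "f' \<circ> Cons False" s'] emb_Tri[of Q X f' s' t'']
      Tri.IH(2)[OF emb_Tri(2)[OF Tri.prems(1)], of "f' \<circ> Cons True" t''] Tri.prems t'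
    by (simp add: o_def)
qed

lemma induce_induce: "V \<subseteq> W \<Longrightarrow> (Q \<restriction> W) \<restriction> V = Q \<restriction> V"
  by (auto simp: induce_subgraph_def)

lemma induce_ends [simp]: "tail (Q \<restriction> V) = tail Q" "head (Q \<restriction> V) = head Q" "arc_to_ends (Q \<restriction> V) = arc_to_ends Q"
  by (auto simp: induce_subgraph_def arc_to_ends_def fun_eq_iff)

lemma emb_arcs:
  assumes "emb Q X f t" "e \<in> arcs (Q \<restriction> (f ` pos t))"
  shows "arc_to_ends Q e \<in> map_prod f f ` edges t"
proof -
  have "e \<in> touching Q (f ` pos t)" using assms(2) by (auto simp: touching_def induce_subgraph_arcs)
  then have "arc_to_ends Q e \<in> map_prod f f ` edges t \<union> ({f []} \<times> X \<union> X \<times> {f []})"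
    using assms(1) by (auto simp: emb_def)
  moreover have "arc_to_ends Q e \<notin> {f []} \<times> X \<union> X \<times> {f []}"
    using assms by (auto simp: emb_def arc_to_ends_def induce_subgraph_arcs)
  ultimately show ?thesis by blast
qed

lemma emb_edge:
  assumes "emb Q X f t" "(p, q) \<in> edges t"
  obtains e where "e \<in> arcs Q" "arc_to_ends Q e = (f p, f q)"
    "\<And>e'. e' \<in> arcs Q \<Longrightarrow> arc_to_ends Q e' = (f p, f q) \<Longrightarrow> e' = e"
proof -
  have "(f p, f q) \<in> arcs_ends Q" using assms by (force simp: emb_def)
  then obtain e where e: "e \<in> arcs Q" "arc_to_ends Q e = (f p, f q)" by (rule arcs_endsE)
  have "e' = e" if "e' \<in> arcs Q" "arc_to_ends Q e' = (f p, f q)" for e'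
  proof -
    have "e \<in> touching Q (f ` pos t)" "e' \<in> touching Q (f ` pos t)"
      using that e edges_in_pos[OF assms(2)] by (auto simp: touching_def arc_to_ends_def)
    moreover have "inj_on (arc_to_ends Q) (touching Q (f ` pos t))" using assms(1) by (simp only: emb_def)
    ultimately show ?thesis using that e by (metis inj_onD)
  qed
  then show thesis using that e by blast
qed

lemma emb_rooted: "emb Q X f t \<Longrightarrow> rooted_type_A (Q \<restriction> (f ` pos t)) (f [])"
proof (induction t arbitrary: X f)
  case Leaf
  have "arcs (Q \<restriction> (f ` pos Leaf)) = {}" using emb_arcs[OF Leaf] by fastforce
  then show ?case by (intro rooted_type_A.single) auto
next
  case (Arr d t)
  let ?H = "Q \<restriction> (f ` pos (Arr d t))" and ?V = "(f \<circ> Cons True) ` pos t"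
  define p q where "p = (if d then [] else [True])" and "q = (if d then [True] else [])"
  have pq: "(p, q) \<in> edges (Arr d t)" by (simp add: p_def q_def)
  from emb_edge[OF Arr.prems pq] obtain e where e: "e \<in> arcs Q" "arc_to_ends Q e = (f p, f q)"
    "\<And>e'. e' \<in> arcs Q \<Longrightarrow> arc_to_ends Q e' = (f p, f q) \<Longrightarrow> e' = e" by blast
  have HV: "?H \<restriction> ?V = Q \<restriction> ?V" by (intro induce_induce) auto
  have "arcs ?H = insert e (arcs (?H \<restriction> ?V))"
  proof (intro equalityI subsetI)
    fix a assume a: "a \<in> arcs ?H"
    then have "arc_to_ends Q a \<in> map_prod f f ` edges (Arr d t)" by (rule emb_arcs[OF Arr.prems])
    then have "arc_to_ends Q a = (f p, f q) \<or> arc_to_ends Q a \<in> ?V \<times> ?V"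
      by (auto simp: p_def q_def split: if_splits dest!: edges_in_pos)
    then show "a \<in> insert e (arcs (?H \<restriction> ?V))" using a e(3)[of a]
      unfolding HV by (auto simp: induce_subgraph_arcs arc_to_ends_def)
  next
    fix a assume "a \<in> insert e (arcs (?H \<restriction> ?V))"
    then show "a \<in> arcs ?H" using e(1,2) unfolding HV
      by (auto simp: induce_subgraph_arcs arc_to_ends_def p_def q_def split: if_splits)
  qed
  moreover have inj: "inj_on f (pos (Arr d t))" using Arr.prems by (simp only: emb_def)
  have "f [] \<notin> ?V" using inj_onD[OF inj, of "[]"] by auto
  moreover have "rooted_type_A (?H \<restriction> ?V) (f [True])"
    unfolding HV using Arr.IH[OF emb_Arr[OF Arr.prems]] by simp
  ultimately show ?case
  proof (intro rooted_type_A.arrow[of ?H "f []" ?V "f [True]" e])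
    show "verts ?H = insert (f []) ?V" by (simp add: image_comp)
    show "arc_to_ends ?H e = (f [], f [True]) \<or> arc_to_ends ?H e = (f [True], f [])"
      using e(2) by (cases d) (simp_all add: p_def q_def)
  qed
next
  case (Tri s t)
  let ?H = "Q \<restriction> (f ` pos (Tri s t))" and ?U = "(f \<circ> Cons False) ` pos s" and ?W = "(f \<circ> Cons True) ` pos t"
  have pq: "([], [False]) \<in> edges (Tri s t)" "([False], [True]) \<in> edges (Tri s t)" "([True], []) \<in> edges (Tri s t)"
    by simp_all
  from emb_edge[OF Tri.prems pq(1)] obtain a where a: "a \<in> arcs Q" "arc_to_ends Q a = (f [], f [False])"
    "\<And>e'. e' \<in> arcs Q \<Longrightarrow> arc_to_ends Q e' = (f [], f [False]) \<Longrightarrow> e' = a" by blast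
  from emb_edge[OF Tri.prems pq(2)] obtain b where b: "b \<in> arcs Q" "arc_to_ends Q b = (f [False], f [True])"
    "\<And>e'. e' \<in> arcs Q \<Longrightarrow> arc_to_ends Q e' = (f [False], f [True]) \<Longrightarrow> e' = b" by blast
  from emb_edge[OF Tri.prems pq(3)] obtain c where c: "c \<in> arcs Q" "arc_to_ends Q c = (f [True], f [])"
    "\<And>e'. e' \<in> arcs Q \<Longrightarrow> arc_to_ends Q e' = (f [True], f []) \<Longrightarrow> e' = c" by blast
  have HU: "?H \<restriction> ?U = Q \<restriction> ?U" and HW: "?H \<restriction> ?W = Q \<restriction> ?W" by (intro induce_induce; auto)+
  have "arcs ?H = {a, b, c} \<union> arcs (?H \<restriction> ?U) \<union> arcs (?H \<restriction> ?W)"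
  proof (intro equalityI subsetI)
    fix e assume e: "e \<in> arcs ?H"
    then have "arc_to_ends Q e \<in> map_prod f f ` edges (Tri s t)" by (rule emb_arcs[OF Tri.prems])
    then have "arc_to_ends Q e \<in> {(f [], f [False]), (f [False], f [True]), (f [True], f [])} \<or>
        arc_to_ends Q e \<in> ?U \<times> ?U \<or> arc_to_ends Q e \<in> ?W \<times> ?W"
      by (auto dest!: edges_in_pos)
    then show "e \<in> {a, b, c} \<union> arcs (?H \<restriction> ?U) \<union> arcs (?H \<restriction> ?W)" using e a(3)[of e] b(3)[of e] c(3)[of e]
      unfolding HU HW by (auto simp: induce_subgraph_arcs arc_to_ends_def)
  next
    fix e assume "e \<in> {a, b, c} \<union> arcs (?H \<restriction> ?U) \<union> arcs (?H \<restriction> ?W)"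
    then show "e \<in> arcs ?H" using a(1,2) b(1,2) c(1,2) unfolding HU HW
      by (auto simp: induce_subgraph_arcs arc_to_ends_def)
  qed
  moreover have inj: "inj_on f (pos (Tri s t))" using Tri.prems by (simp only: emb_def)
  have "f [] \<notin> ?U \<union> ?W" "?U \<inter> ?W = {}"
    using inj_onD[OF inj, of "[]"] inj_onD[OF inj, of "False # p" "True # q" for p q] by (auto simp: image_iff)
  moreover have "rooted_type_A (?H \<restriction> ?U) (f [False])" "rooted_type_A (?H \<restriction> ?W) (f [True])"
    unfolding HU HW using Tri.IH(1)[OF emb_Tri(1)[OF Tri.prems]] Tri.IH(2)[OF emb_Tri(2)[OF Tri.prems]] by simp_all
  ultimately show ?case
  proof (intro rooted_type_A.triangle[of ?H "f []" ?U ?W "f [False]" "f [True]" a b c])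
    show "verts ?H = insert (f []) (?U \<union> ?W)" by (simp add: image_comp image_Un)
    show "arc_to_ends ?H a = (f [], f [False])" "arc_to_ends ?H b = (f [False], f [True])"
      "arc_to_ends ?H c = (f [True], f [])" using a(2) b(2) c(2) by simp_all
  qed
qed

text \<open>The derivation of \<open>rooted_type_A\<close> is itself the tree; coordinates of the
  parts are glued by prefixing addresses. The injectivity of \<open>arc_to_ends\<close> records that
  there are no parallel arrows.\<close>

lemma rooted_coordinates:
  assumes "rooted_type_A H \<rho>"
  obtains t f where "inj_on f (pos t)" "f ` pos t = verts H" "f [] = \<rho>"
    "inj_on (arc_to_ends H) (arcs H)" "arc_to_ends H ` arcs H = map_prod f f ` edges t"
proof -
  have "\<exists>t f. inj_on f (pos t) \<and> f ` pos t = verts H \<and> f [] = \<rho> \<and>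
    inj_on (arc_to_ends H) (arcs H) \<and> arc_to_ends H ` arcs H = map_prod f f ` edges t"
    using assms
  proof induction
    case (single Q \<rho>)
    then show ?case by (intro exI[of _ Leaf] exI[of _ "\<lambda>_. \<rho>"]) auto
  next
    case (arrow Q \<rho> V v a)
    from arrow.IH obtain t f where tf: "inj_on f (pos t)" "f ` pos t = V" "f [] = v"
      "inj_on (arc_to_ends Q) (arcs (Q \<restriction> V))" "arc_to_ends Q ` arcs (Q \<restriction> V) = map_prod f f ` edges t"
      unfolding induce_subgraph_verts induce_ends by blast
    define d where "d \<longleftrightarrow> arc_to_ends Q a = (\<rho>, v)"
    define g where "g p = (case p of [] \<Rightarrow> \<rho> | b # p' \<Rightarrow> f p')" for p :: "bool list"
    have gC: "g \<circ> Cons True = f" "g [] = \<rho>" by (auto simp: g_def)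
    have gp: "g ` pos (Arr d t) = insert \<rho> V" using tf(2) by (simp add: image_comp gC)
    have "inj_on g (pos (Arr d t))"
      using tf(1,2) arrow.hyps(2) by (auto simp: inj_on_def g_def)
    moreover have ends: "arc_to_ends Q a = map_prod g g (if d then ([], [True]) else ([True], []))"
      using arrow.hyps(5) tf(3) by (auto simp: d_def g_def)
    moreover have mp: "map_prod g g ` map_prod (Cons True) (Cons True) ` edges t = map_prod f f ` edges t"
      by (simp add: image_comp map_prod.comp gC)
    have "arc_to_ends Q ` arcs Q = map_prod g g ` edges (Arr d t)"
      unfolding arrow.hyps(4) edges.simps image_insert ends mp by (simp only: tf(5))
    moreover have "arc_to_ends Q a \<notin> arc_to_ends Q ` arcs (Q \<restriction> V)"
      using arrow.hyps(2,5) by (auto simp: induce_subgraph_arcs arc_to_ends_def)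
    then have "inj_on (arc_to_ends Q) (arcs Q)"
      unfolding arrow.hyps(4) using tf(4) by auto
    ultimately show ?case using gp gC arrow.hyps(1) by (intro exI[of _ "Arr d t"] exI[of _ g]) auto
  next
    case (triangle Q \<rho> U W u w a b c)
    from triangle.IH obtain s f t h where s: "inj_on f (pos s)" "f ` pos s = U" "f [] = u"
      "inj_on (arc_to_ends Q) (arcs (Q \<restriction> U))" "arc_to_ends Q ` arcs (Q \<restriction> U) = map_prod f f ` edges s"
     and t: "inj_on h (pos t)" "h ` pos t = W" "h [] = w"
      "inj_on (arc_to_ends Q) (arcs (Q \<restriction> W))" "arc_to_ends Q ` arcs (Q \<restriction> W) = map_prod h h ` edges t"
      unfolding induce_subgraph_verts induce_ends by blast
    define g where "g p = (case p of [] \<Rightarrow> \<rho> | b # p' \<Rightarrow> if b then h p' else f p')" for p :: "bool list"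
    have gC: "g \<circ> Cons True = h" "g \<circ> Cons False = f" "g [] = \<rho>" by (auto simp: g_def)
    have gp: "g ` pos (Tri s t) = insert \<rho> (U \<union> W)" using s(2) t(2) by (simp add: image_Un image_comp gC)
    have uw: "u \<in> U" "w \<in> W" using s(2,3) t(2,3) by auto
    have "inj_on g (Cons False ` pos s)" "inj_on g (Cons True ` pos t)"
      using s(1) t(1) by (auto intro!: inj_on_imageI simp: gC)
    moreover have gUW: "g ` Cons False ` pos s = U" "g ` Cons True ` pos t = W"
      using s(2) t(2) by (simp_all add: image_comp gC)
    ultimately have "inj_on g (Cons False ` pos s \<union> Cons True ` pos t)"
      using triangle.hyps(3) by (subst inj_on_Un) blast
    moreover have "g [] \<notin> g ` (Cons False ` pos s \<union> Cons True ` pos t)"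
      unfolding image_Un gUW gC(3) by (rule triangle.hyps(2))
    ultimately have "inj_on g (pos (Tri s t))" by (auto simp: inj_on_insert)
    moreover have ends: "arc_to_ends Q a = map_prod g g ([], [False])"
       "arc_to_ends Q b = map_prod g g ([False], [True])" "arc_to_ends Q c = map_prod g g ([True], [])"
      using triangle.hyps(7-9) s(3) t(3) by (auto simp: g_def)
    moreover have mp: "map_prod g g ` map_prod (Cons True) (Cons True) ` edges t = map_prod h h ` edges t"
      "map_prod g g ` map_prod (Cons False) (Cons False) ` edges s = map_prod f f ` edges s"
      by (simp_all add: image_comp map_prod.comp gC)
    have "arc_to_ends Q ` arcs Q = map_prod g g ` edges (Tri s t)"
      unfolding triangle.hyps(6) edges.simps image_insert image_Un ends mp image_empty by (simp only: s(5) t(5))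
    moreover have "inj_on (arc_to_ends Q) (arcs Q)"
    proof -
      have "inj_on (arc_to_ends Q) (arcs (Q \<restriction> U) \<union> arcs (Q \<restriction> W))"
        using s(4) t(4) triangle.hyps(3) by (fastforce simp: inj_on_def induce_subgraph_arcs arc_to_ends_def)
      moreover have "arc_to_ends Q e \<notin> arc_to_ends Q ` (arcs (Q \<restriction> U) \<union> arcs (Q \<restriction> W))" if "e \<in> {a, b, c}" for e
        using triangle.hyps(2,3,7-9) that uw by (auto simp: induce_subgraph_arcs arc_to_ends_def)
      moreover have "inj_on (arc_to_ends Q) {a, b, c}"
        using triangle.hyps(2,3,7-9) uw by (auto simp: inj_on_def)
      ultimately show ?thesis unfolding triangle.hyps(6) Un_assoc by (subst inj_on_Un) blast
    qed
    ultimately show ?case using gp gC triangle.hyps(1) by (intro exI[of _ "Tri s t"] exI[of _ g]) auto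
  qed
  then show thesis using that by blast
qed

section \<open>Traversals of cycles\<close>

lemma dvd_diff_imp_eq:
  fixes n :: int
  shows "n dvd i - j \<Longrightarrow> 0 \<le> i \<Longrightarrow> i < n \<Longrightarrow> 0 \<le> j \<Longrightarrow> j < n \<Longrightarrow> i = j"
  by (metis mod_eq_dvd_iff mod_pos_pos_trivial)

text \<open>Traversals of a cycle of length \<open>n\<close>, as \<open>n\<close>-periodic sequences indexed by the integers:
  rotations are shifts and the reversal is negation of the index.\<close>

locale cyc =
  fixes H :: "('a, 'b) pre_digraph" and n :: int and v :: "int \<Rightarrow> 'a" and a :: "int \<Rightarrow> 'b"
  assumes two_le: "2 \<le> n"
    and v_eq: "v i = v j \<longleftrightarrow> n dvd i - j"
    and a_eq: "a i = a j \<longleftrightarrow> n dvd i - j"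
    and range_v: "range v = verts H"
    and range_a: "range a = arcs H"
    and ends: "{tail H (a i), head H (a i)} = {v i, v (i + 1)}"
begin

lemma v_in_verts [simp]: "v i \<in> verts H" and a_in_arcs [simp]: "a i \<in> arcs H"
  using range_v range_a by auto

lemma not_dvd_1: "\<not> n dvd 1" "\<not> n dvd - 1"
  using two_le by auto

lemma v_Suc: "v i \<noteq> v (i + 1)" "v (i + 1) \<noteq> v i" "v (i - 1) \<noteq> v i" "v i \<noteq> v (i - 1)"
  using not_dvd_1 by (auto simp: v_eq)

lemma a_Suc: "a i \<noteq> a (i + 1)" "a (i + 1) \<noteq> a i" "a (i - 1) \<noteq> a i" "a i \<noteq> a (i - 1)"
  using not_dvd_1 by (auto simp: a_eq)

lemma incident:
  assumes "v i \<in> {tail H (a j), head H (a j)}"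
  shows "a j = a i \<or> a j = a (i - 1)"
  using assms unfolding ends by (auto simp: v_eq a_eq dvd_diff_commute algebra_simps)

lemma ends_prev: "{tail H (a (i - 1)), head H (a (i - 1))} = {v (i - 1), v i}"
  using ends[of "i - 1"] by simp

lemma arc_ends_cases: "(tail H (a i) = v i \<and> head H (a i) = v (i + 1)) \<or> (tail H (a i) = v (i + 1) \<and> head H (a i) = v i)"
  using ends[of i] by (auto simp: doubleton_eq_iff)

lemma card_verts: "card (verts H) = nat n"
proof -
  have "range v = v ` {0..<n}"
  proof -
    have "v i \<in> v ` {0..<n}" for i
    proof (rule image_eqI[of _ _ "i mod n"])
      show "v i = v (i mod n)" by (simp add: v_eq minus_mod_eq_mult_div)
    qed (use two_le in auto)
    then show ?thesis by blast
  qed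
  moreover have "inj_on v {0..<n}"
  proof (rule inj_onI)
    fix i j assume ij: "i \<in> {0..<n}" "j \<in> {0..<n}" "v i = v j"
    then show "i = j" by (intro dvd_diff_imp_eq[of n]) (simp_all add: v_eq)
  qed
  ultimately show ?thesis unfolding range_v[symmetric] by (simp add: card_image)
qed

text \<open>Arrow \<open>i\<close> lies between vertices \<open>i\<close> and \<open>i + 1\<close>,
  so a reflection that sends vertex \<open>i\<close> to \<open>k - i\<close> sends arrow
  \<open>i\<close> to \<open>k - 1 - i\<close>.\<close>

lemma reversal: "cyc H n (\<lambda>i. v (k - i)) (\<lambda>i. a (k - 1 - i))"
proof
  have "range (\<lambda>i. k - i) = UNIV" for k :: int by (metis diff_diff_eq2 diff_add_cancel add_diff_cancel_left' surj_def)
  then show "range (\<lambda>i. v (k - i)) = verts H" "range (\<lambda>i. a (k - 1 - i)) = arcs H"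
    by (simp_all add: range_v[symmetric] range_a[symmetric] image_image[of v "\<lambda>i. k - i", symmetric]
        image_image[of a "\<lambda>i. k - 1 - i", symmetric])
  show "{tail H (a (k - 1 - i)), head H (a (k - 1 - i))} = {v (k - i), v (k - (i + 1))}" for i
    using ends_prev[of "k - i"] by (simp add: algebra_simps insert_commute)
qed (auto simp: two_le v_eq a_eq dvd_diff_commute)

lemma connected_closed:
  assumes "v i \<in> S" "\<And>e. e \<in> arcs H \<Longrightarrow> tail H e \<in> S \<longleftrightarrow> head H e \<in> S"
  shows "verts H \<subseteq> S"
proof -
  have step: "v j \<in> S \<longleftrightarrow> v (j + 1) \<in> S" for j
    using assms(2)[of "a j"] arc_ends_cases[of j] by auto
  have "v j \<in> S" for j
  proof (induction j rule: int_induct[of _ i])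
    case base then show ?case by (rule assms(1))
  next
    case (step1 j) then show ?case using step by blast
  next
    case (step2 j) then show ?case using step[of "j - 1"] by simp
  qed
  then show ?thesis by (auto simp: range_v[symmetric])
qed

end

text \<open>Vertex and arrow together fix the direction of travel; for \<open>n = 2\<close> the next
  vertex alone would not.\<close>

lemma (in cyc) same_start:
  assumes "cyc H n v' a'" "v' 0 = v k" "a' 0 = a k"
  shows "v' i = v (k + i)" "a' i = a (k + i)"
proof -
  interpret c': cyc H n v' a' by fact
  have nat: "v' (int m) = v (k + int m) \<and> a' (int m) = a (k + int m)" for m
  proof (induction m)
    case 0
    then show ?case using assms by simp
  next
    case (Suc m)
    have v: "v' (int (Suc m)) = v (k + int (Suc m))"
      using Suc c'.ends[of "int m"] ends[of "k + int m"] by (auto simp: doubleton_eq_iff algebra_simps)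
    obtain j where j: "a' (int (Suc m)) = a j" using c'.range_a range_a by blast
    have "v (k + int (Suc m)) \<in> {tail H (a j), head H (a j)}"
      unfolding v[symmetric] j[symmetric] c'.ends by simp
    then have "a j = a (k + int (Suc m)) \<or> a j = a (k + int (Suc m) - 1)" by (rule incident)
    \<comment> \<open>Of the two arrows at the vertex just reached, one has just been traversed, so
      the next arrow is the other one.\<close>
    moreover have "a j \<noteq> a (k + int (Suc m) - 1)"
      using Suc j c'.a_Suc(2)[of "int m"] by (simp add: algebra_simps)
    ultimately show ?case using v j by simp
  qed
  have m: "n dvd i - i mod n" "n dvd k + i - (k + i mod n)" by (simp_all add: minus_mod_eq_mult_div)
  have "v' i = v' (i mod n)" "a' i = a' (i mod n)" using m by (auto simp: c'.v_eq c'.a_eq)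
  moreover have "v (k + i) = v (k + i mod n)" "a (k + i) = a (k + i mod n)" using m by (auto simp: v_eq a_eq)
  moreover have "int (nat (i mod n)) = i mod n" using two_le by simp
  ultimately show "v' i = v (k + i)" "a' i = a (k + i)" using nat[of "nat (i mod n)"] by simp_all
qed

text \<open>The first arrow of the second traversal is one of the two arrows at its first vertex;
  the two choices give the rotation and the reflection.\<close>

lemma (in cyc) dihedral:
  assumes "cyc H m v' a'"
  shows "m = n" and "\<exists>k. (\<forall>i. v' i = v (i + k) \<and> a' i = a (i + k)) \<or> (\<forall>i. v' i = v (k - i) \<and> a' i = a (k - 1 - i))"
proof -
  interpret c': cyc H m v' a' by fact
  show mn: "m = n" using card_verts c'.card_verts two_le c'.two_le by simp
  obtain k where k: "v' 0 = v k" using range_v c'.range_v by blast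
  obtain j where j: "a' 0 = a j" using range_a c'.range_a by blast
  have "v k \<in> {tail H (a j), head H (a j)}" unfolding j[symmetric] k[symmetric] c'.ends by simp
  then have "a' 0 = a k \<or> a' 0 = a (k - 1)" using incident j by simp
  then show "\<exists>k. (\<forall>i. v' i = v (i + k) \<and> a' i = a (i + k)) \<or> (\<forall>i. v' i = v (k - i) \<and> a' i = a (k - 1 - i))"
  proof
    assume "a' 0 = a k"
    then show ?thesis using same_start[OF assms[unfolded mn] k] by (intro exI[of _ k]) (simp add: add.commute)
  next
    assume a0: "a' 0 = a (k - 1)"
    interpret r: cyc H n "\<lambda>i. v (k - i)" "\<lambda>i. a (k - 1 - i)" by (rule reversal)
    show ?thesis using r.same_start[OF assms[unfolded mn], of 0] k a0 by (intro exI[of _ k]) simp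
  qed
qed

section \<open>Periodic sequences as lists over one period\<close>

definition lst :: "int \<Rightarrow> (int \<Rightarrow> 'a) \<Rightarrow> 'a list" where
  "lst n f = map (\<lambda>i. f (int i)) [0..<nat n]"

lemma length_lst [simp]: "length (lst n f) = nat n"
  by (simp add: lst_def)

lemma nth_lst [simp]: "i < nat n \<Longrightarrow> lst n f ! i = f (int i)"
  by (simp add: lst_def)

lemma map_lst: "map g (lst n f) = lst n (g \<circ> f)"
  by (simp add: lst_def)

lemma rotate_lst:
  assumes "\<And>i j. n dvd i - j \<Longrightarrow> f i = f j" "n > 0"
  shows "rotate k (lst n f) = lst n (\<lambda>i. f (i + int k))"
proof (rule nth_equalityI)
  fix i assume "i < length (rotate k (lst n f))"
  then have i: "i < nat n" by simp
  have lt: "(k + i) mod nat n < nat n" using assms(2) by simp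
  have "n dvd int ((k + i) mod nat n) - (int i + int k)"
    using assms(2) by (simp add: zmod_int mod_eq_dvd_iff[symmetric] add.commute)
  then show "rotate k (lst n f) ! i = lst n (\<lambda>i. f (i + int k)) ! i"
    using i lt assms(1) by (simp add: nth_rotate)
qed simp

lemma set_lst:
  assumes "\<And>i j. n dvd i - j \<Longrightarrow> f i = f j" "n > 0"
  shows "set (lst n f) = range f"
proof -
  have "f i \<in> set (lst n f)" for i
  proof -
    have "f i = f (i mod n)" using assms(1) by (simp add: minus_mod_eq_mult_div)
    then show ?thesis using assms(2) unfolding lst_def
      by (auto intro!: image_eqI[of _ _ "nat (i mod n)"] simp: nat_less_iff)
  qed
  then show ?thesis by (auto simp: lst_def)
qed

lemma lst_inject:
  assumes "lst n f = lst n g" "n > 0"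
    "\<And>i j. n dvd i - j \<Longrightarrow> f i = f j" "\<And>i j. n dvd i - j \<Longrightarrow> g i = g j"
  shows "f = g"
proof
  fix i
  have m: "n dvd i - i mod n" by (simp add: minus_mod_eq_mult_div)
  have lt: "nat (i mod n) < nat n" using assms(2) by (simp add: nat_less_iff)
  have "f (i mod n) = g (i mod n)"
    using arg_cong[OF assms(1), of "\<lambda>l. l ! nat (i mod n)"] lt assms(2) by simp
  then show "f i = g i" using assms(3,4)[OF m] by simp
qed

text \<open>The first vertex is kept while the whole list of arrows is reversed, so this is the
  reflection in vertex 0.\<close>

lemma reverse_traversal_lst:
  assumes "\<And>i j. n dvd i - j \<Longrightarrow> f i = f j" "\<And>i j. n dvd i - j \<Longrightarrow> g i = g j" "n > 0"
  shows "reverse_traversal (lst n f, lst n g) = (lst n (\<lambda>i. f (- i)), lst n (\<lambda>i. g (- 1 - i)))"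
proof -
  have ne: "lst n f \<noteq> []" using assms(3) by (metis length_lst list.size(3) zero_less_nat_eq less_irrefl)
  have "hd (lst n f) # rev (tl (lst n f)) = lst n (\<lambda>i. f (- i))"
  proof (rule nth_equalityI)
    fix i assume "i < length (hd (lst n f) # rev (tl (lst n f)))"
    then have i: "i < nat n" using assms(3) by auto
    show "(hd (lst n f) # rev (tl (lst n f))) ! i = lst n (\<lambda>i. f (- i)) ! i"
    proof (cases i)
      case 0
      then show ?thesis using i ne by (simp add: hd_conv_nth)
    next
      case (Suc j)
      have "(hd (lst n f) # rev (tl (lst n f))) ! i = tl (lst n f) ! (nat n - 1 - Suc j)"
        using Suc i by (simp add: rev_nth)
      also have "\<dots> = f (int (nat n - 1 - Suc j + 1))"
        using Suc i by (subst nth_tl) (auto simp del: of_nat_Suc)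
      also have "\<dots> = f (- int i)"
        using Suc i by (intro assms(1)) (simp add: of_nat_diff)
      finally show ?thesis using i by simp
    qed
  qed (use assms(3) in auto)
  moreover have "rev (lst n g) = lst n (\<lambda>i. g (- 1 - i))"
  proof (rule nth_equalityI)
    fix i assume "i < length (rev (lst n g))"
    then have i: "i < nat n" by simp
    then have "rev (lst n g) ! i = g (int (nat n - Suc i))" by (simp add: rev_nth)
    also have "\<dots> = g (- 1 - int i)" using i by (intro assms(2)) (simp add: of_nat_diff)
    finally show "rev (lst n g) ! i = lst n (\<lambda>i. g (- 1 - i)) ! i" using i by simp
  qed simp
  ultimately show ?thesis by (simp add: reverse_traversal_def)
qed

lemma (in cyc) v_periodic: "n dvd i - j \<Longrightarrow> v i = v j" and a_periodic: "n dvd i - j \<Longrightarrow> a i = a j"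
  by (simp_all add: v_eq a_eq)

lemma (in cyc) traversal: "cycle_traversal H (lst n v, lst n a)"
proof -
  have n: "n > 0" using two_le by simp
  have inj: "i = j" if "n dvd int i - int j" "i < nat n" "j < nat n" for i j
    using dvd_diff_imp_eq[of n "int i" "int j"] that by simp
  have "distinct (lst n v)" "distinct (lst n a)"
    unfolding distinct_conv_nth by (auto simp: v_eq a_eq dest: inj)
  moreover have "set (lst n v) = verts H" "set (lst n a) = arcs H"
    using set_lst[of n v] set_lst[of n a] v_periodic a_periodic n range_v range_a by auto
  moreover have "{tail H (lst n a ! i), head H (lst n a ! i)} = {lst n v ! i, lst n v ! (Suc i mod nat n)}" if "i < nat n" for i
  proof -
    have lt: "Suc i mod nat n < nat n" using n by simp
    have "n dvd int (Suc i mod nat n) - (int i + 1)"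
      using n by (simp add: zmod_int mod_eq_dvd_iff[symmetric] add.commute)
    then show ?thesis using that lt ends[of "int i"] v_periodic[of "int (Suc i mod nat n)" "int i + 1"] by simp
  qed
  ultimately show ?thesis using two_le by (simp add: cycle_traversal_def)
qed

lemma traversal_cyc:
  assumes "cycle_traversal H (vs, as)"
  defines "n \<equiv> int (length vs)"
  obtains v a where "cyc H n v a" "vs = lst n v" "as = lst n a"
proof -
  from assms have *: "length vs \<ge> 2" "length as = length vs" "distinct vs" "distinct as" "set vs = verts H" "set as = arcs H"
    "\<And>i. i < length vs \<Longrightarrow> {tail H (as ! i), head H (as ! i)} = {vs ! i, vs ! (Suc i mod length vs)}"
    by (auto simp: cycle_traversal_def)
  have n: "n \<ge> 2" using * by (simp add: n_def)
  define v a where "v i = vs ! nat (i mod n)" and "a i = as ! nat (i mod n)" for i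
  have lt: "nat (i mod n) < length vs" for i
  proof -
    have "i mod n < n" "0 \<le> i mod n" using n by simp_all
    then show ?thesis by (simp only: n_def nat_less_iff)
  qed
  have eq: "nat (i mod n) = nat (j mod n) \<longleftrightarrow> n dvd i - j" for i j
    using n by (simp add: eq_nat_nat_iff mod_eq_dvd_iff)
  have "cyc H n v a"
  proof
    show "v i = v j \<longleftrightarrow> n dvd i - j" for i j using *(3) lt by (simp add: v_def nth_eq_iff_index_eq eq)
    show "a i = a j \<longleftrightarrow> n dvd i - j" for i j using *(2,4) lt by (simp add: a_def nth_eq_iff_index_eq eq)
    have va: "vs ! i = v (int i)" "as ! i = a (int i)" if "i < length vs" for i using that by (simp_all add: v_def a_def n_def)
    have "v i \<in> set vs" "a i \<in> set as" for i using lt[of i] *(2) by (simp_all add: v_def a_def)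
    moreover have "set vs \<subseteq> range v" "set as \<subseteq> range a" using va *(2) by (auto simp: in_set_conv_nth)
    ultimately show "range v = verts H" "range a = arcs H"
      unfolding *(5,6)[symmetric] by blast+
    show "{tail H (a i), head H (a i)} = {v i, v (i + 1)}" for i
    proof -
      have "int (Suc (nat (i mod n))) = i mod n + 1" using n by simp
      then have "int (Suc (nat (i mod n)) mod length vs) = (i mod n + 1) mod n"
        by (simp only: zmod_int n_def)
      also have "\<dots> = (i + 1) mod n" by (rule mod_add_left_eq)
      finally have "Suc (nat (i mod n)) mod length vs = nat ((i + 1) mod n)" by (metis nat_int)
      then show ?thesis using *(7)[OF lt[of i]] by (simp add: v_def a_def)
    qed
  qed (rule n)
  moreover have "vs = lst n v" "as = lst n a"
    using *(2) by (auto intro!: nth_equalityI simp: n_def v_def a_def)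
  ultimately show thesis using that by blast
qed

section \<open>Non-oriented cycles, and why they avoid attached trees\<close>

lemma nonoriented_cycle_cyc:
  assumes "nonoriented_cycle H"
  obtains n v a i j where "cyc H n v a" "tail H (a i) = v i" "head H (a j) = v j"
proof -
  from assms obtain vs as i j where *: "cycle_traversal H (vs, as)" "i < length vs" "tail H (as ! i) = vs ! i"
    "j < length vs" "head H (as ! j) = vs ! j"
    by (auto simp: nonoriented_cycle_def)
  obtain v a where va: "cyc H (int (length vs)) v a" "vs = lst (int (length vs)) v" "as = lst (int (length vs)) a"
    using traversal_cyc[OF *(1)] by blast
  have "tail H (a (int i)) = v (int i)" "head H (a (int j)) = v (int j)"
    using *(2-5) va(2,3) nth_lst[of i "int (length vs)" v] nth_lst[of i "int (length vs)" a]
      nth_lst[of j "int (length vs)" v] nth_lst[of j "int (length vs)" a] by simp_all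
  then show thesis using that va(1) by blast
qed

lemma (in cyc) nonoriented_cycle:
  assumes "tail H (a i) = v i" "head H (a j) = v j"
  shows "nonoriented_cycle H"
proof -
  have *: "nat (k mod n) < nat n" "int (nat (k mod n)) = k mod n" for k using two_le by (simp_all add: nat_less_iff)
  have "v (k mod n) = v k" "a (k mod n) = a k" for k by (simp_all add: v_eq a_eq mod_eq_dvd_iff[symmetric])
  then have "tail H (lst n a ! nat (i mod n)) = lst n v ! nat (i mod n)" 
    "head H (lst n a ! nat (j mod n)) = lst n v ! nat (j mod n)"
    using assms * by simp_all
  then show ?thesis unfolding nonoriented_cycle_def
    using traversal *(1)[of i] *(1)[of j] by (metis length_lst)
qed

lemma nonoriented_cycle_nonempty: "nonoriented_cycle H \<Longrightarrow> verts H \<noteq> {}"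
  by (auto elim!: nonoriented_cycle_cyc simp: cyc.range_v[symmetric])

lemma nonoriented_cycle_two_arcs:
  assumes "nonoriented_cycle H" "x \<in> verts H"
  obtains e e' where "e \<in> arcs H" "e' \<in> arcs H" "e \<noteq> e'" "x \<in> {tail H e, head H e}" "x \<in> {tail H e', head H e'}"
    "\<And>e''. e'' \<in> arcs H \<Longrightarrow> x \<in> {tail H e'', head H e''} \<Longrightarrow> e'' = e \<or> e'' = e'"
proof -
  obtain n v a where "cyc H n v a" using assms(1) by (auto elim!: nonoriented_cycle_cyc)
  then interpret cyc H n v a .
  obtain i where i: "x = v i" using assms(2) range_v by blast
  show thesis
  proof (rule that[of "a i" "a (i - 1)"])
    show "a i \<in> arcs H" "a (i - 1) \<in> arcs H" using range_a by auto
    show "e'' = a i \<or> e'' = a (i - 1)" if "e'' \<in> arcs H" "x \<in> {tail H e'', head H e''}" for e''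
      using that(2) incident[of i] i range_a that(1) by (metis rangeE)
  qed (use i ends[of i] ends_prev[of i] a_Suc in auto)
qed

text \<open>Going round the cycle, the arrows change somewhere from pointing backwards to pointing
  forwards, and the vertex in between is the tail of both.\<close>

lemma nonoriented_cycle_source:
  assumes "nonoriented_cycle H"
  obtains e e' where "e \<in> arcs H" "e' \<in> arcs H" "e \<noteq> e'" "tail H e = tail H e'"
proof -
  obtain n v a i j where "cyc H n v a" and ij: "tail H (a i) = v i" "head H (a j) = v j"
    using assms by (rule nonoriented_cycle_cyc)
  then interpret cyc H n v a by simp
  define P where "P k \<longleftrightarrow> tail H (a k) = v k" for k
  have "\<exists>k. P k \<and> \<not> P (k - 1)"
  proof (rule ccontr)
    \<comment> \<open>Otherwise the forward direction of arrow \<open>i\<close> propagates backwards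
      through all residues modulo \<open>n\<close> and reaches arrow \<open>j\<close>, which points
      backwards.\<close>
    assume "\<not> ?thesis"
    then have step: "P k \<Longrightarrow> P (k - 1)" for k by blast
    have "P (i - int m)" for m
    proof (induction m)
      case 0 then show ?case using ij by (simp add: P_def)
    next
      case (Suc m) then show ?case using step[of "i - int m"] by (simp add: algebra_simps)
    qed
    then have "P (i - int (nat ((i - j) mod n)))" .
    moreover have "int (nat ((i - j) mod n)) = (i - j) mod n" using two_le by simp
    moreover have "i - (i - j) mod n - j = n * ((i - j) div n)" using mult_div_mod_eq[of n "i - j"] by linarith
    then have "n dvd i - (i - j) mod n - j" by simp
    then have "a (i - (i - j) mod n) = a j" "v (i - (i - j) mod n) = v j" by (simp_all add: v_eq a_eq)
    ultimately have "tail H (a j) = v j" by (simp add: P_def)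
    then show False using ij(2) arc_ends_cases[of j] v_Suc by auto
  qed
  then obtain k where "tail H (a k) = v k" "tail H (a (k - 1)) \<noteq> v (k - 1)" by (auto simp: P_def)
  then have "tail H (a (k - 1)) = tail H (a k)" using arc_ends_cases[of "k - 1"] by auto
  then show thesis using that[of "a (k - 1)" "a k"] range_a a_Suc by auto
qed

text \<open>Vertices of a cycle have degree two, so the triangle would be closed under adjacency and
  hence the whole cycle. But an oriented triangle has no vertex that is the tail of two
  arrows.\<close>

lemma nonoriented_cycle_no_triangle:
  assumes nc: "nonoriented_cycle H" and e: "e1 \<in> arcs H" "e2 \<in> arcs H" "e3 \<in> arcs H"
    "arc_to_ends H e1 = (x, y)" "arc_to_ends H e2 = (y, z)" "arc_to_ends H e3 = (z, x)"
    and d: "x \<noteq> y" "y \<noteq> z" "z \<noteq> x"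
  shows False
proof -
  have e': "tail H e1 = x" "head H e1 = y" "tail H e2 = y" "head H e2 = z" "tail H e3 = z" "head H e3 = x"
    using e by (auto simp: arc_to_ends_def)
  obtain n v a where "cyc H n v a" using nc by (auto elim!: nonoriented_cycle_cyc)
  then interpret cyc H n v a .
  have xyz: "x \<in> verts H" "y \<in> verts H" "z \<in> verts H"
    using e e' arc_ends_cases range_a range_v by (metis (no_types, lifting) rangeE rangeI)+
  have dist: "e1 \<noteq> e2" "e2 \<noteq> e3" "e3 \<noteq> e1" using e' d by auto
  have at: "b = c \<or> b = c'"
    if "q \<in> verts H" "c \<in> arcs H" "c' \<in> arcs H" "c \<noteq> c'" "q \<in> {tail H c, head H c}" "q \<in> {tail H c', head H c'}"
      and b: "b \<in> arcs H" "q \<in> {tail H b, head H b}" for q c c' b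
  proof -
    obtain f f' where "\<And>e''. e'' \<in> arcs H \<Longrightarrow> q \<in> {tail H e'', head H e''} \<Longrightarrow> e'' = f \<or> e'' = f'"
      using nonoriented_cycle_two_arcs[OF nc \<open>q \<in> verts H\<close>] by metis
    from this[of c] this[of c'] this[of b] show ?thesis using that by auto
  qed
  have x: "b = e1 \<or> b = e3" if "b \<in> arcs H" "x \<in> {tail H b, head H b}" for b
    using at[OF xyz(1) e(1,3) _ _ _ that] e' dist by auto
  have y: "b = e1 \<or> b = e2" if "b \<in> arcs H" "y \<in> {tail H b, head H b}" for b
    using at[OF xyz(2) e(1,2) _ _ _ that] e' dist by auto
  have z: "b = e2 \<or> b = e3" if "b \<in> arcs H" "z \<in> {tail H b, head H b}" for b
    using at[OF xyz(3) e(2,3) _ _ _ that] e' dist by auto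
  obtain i where "v i = x" using xyz unfolding range_v[symmetric] by blast
  have T: "b = e1 \<or> b = e2 \<or> b = e3" if "b \<in> arcs H" "tail H b \<in> {x, y, z} \<or> head H b \<in> {x, y, z}" for b
    using that x[of b] y[of b] z[of b] by auto
  have "tail H b \<in> {x, y, z} \<longleftrightarrow> head H b \<in> {x, y, z}" if "b \<in> arcs H" for b
    using T[OF that] e' by auto
  then have "verts H \<subseteq> {x, y, z}"
    using \<open>v i = x\<close> by (intro connected_closed[of i]) auto
  moreover obtain f f' where f: "f \<in> arcs H" "f' \<in> arcs H" "f \<noteq> f'" "tail H f = tail H f'"
    using nonoriented_cycle_source[OF nc] by blast
  moreover have "tail H f \<in> verts H" using f(1) arc_ends_cases range_a range_v by (metis rangeE rangeI)
  ultimately have "tail H f \<in> {x, y, z}" by blast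
  then show False using f x[of f] x[of f'] y[of f] y[of f'] z[of f] z[of f'] e' d by auto
qed

lemma nonoriented_cycle_two_arcs_induced:
  assumes nc: "nonoriented_cycle (Q \<restriction> C)" and "x \<in> C"
  obtains e e' where "e \<in> arcs (Q \<restriction> C)" "e' \<in> arcs (Q \<restriction> C)" "e \<noteq> e'"
    "x \<in> {tail Q e, head Q e}" "x \<in> {tail Q e', head Q e'}"
proof -
  have x: "x \<in> verts (Q \<restriction> C)" using assms(2) by simp
  obtain e e' where "e \<in> arcs (Q \<restriction> C)" "e' \<in> arcs (Q \<restriction> C)" "e \<noteq> e'"
    "x \<in> {tail (Q \<restriction> C) e, head (Q \<restriction> C) e}" "x \<in> {tail (Q \<restriction> C) e', head (Q \<restriction> C) e'}"
    by (rule nonoriented_cycle_two_arcs[OF nc x])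
  then show thesis unfolding induce_ends by (rule that)
qed

lemma emb_arc_within:
  assumes emb: "emb Q X f t" and D: "C \<inter> f ` pos t \<subseteq> f ` D" "D \<subseteq> pos t"
    and e: "e \<in> arcs (Q \<restriction> C)" and p: "p \<in> pos t" "p \<noteq> []" "f p \<in> {tail Q e, head Q e}"
  obtains q r where "(q, r) \<in> edges t" "q \<in> D" "r \<in> D" "arc_to_ends Q e = (f q, f r)" "e \<in> touching Q (f ` pos t)"
proof -
  have inj: "inj_on f (pos t)" and X: "X \<inter> f ` pos t = {}"
    and tou: "arc_to_ends Q ` touching Q (f ` pos t) \<subseteq> map_prod f f ` edges t \<union> ({f []} \<times> X \<union> X \<times> {f []})"
    using emb by (simp_all only: emb_def)
  have et: "e \<in> touching Q (f ` pos t)" using e p(3) imageI[OF p(1), of f] by (auto simp: touching_def)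
  have "f p \<noteq> f []" "f p \<notin> X" using inj_onD[OF inj _ p(1)] X p(1,2) by auto
  then have "arc_to_ends Q e \<notin> {f []} \<times> X \<union> X \<times> {f []}" using p(3) by (auto simp: arc_to_ends_def)
  then have "arc_to_ends Q e \<in> map_prod f f ` edges t" using et tou by blast
  then obtain q r where qr: "(q, r) \<in> edges t" "tail Q e = f q" "head Q e = f r" by (auto simp: arc_to_ends_def)
  have "f q \<in> C \<inter> f ` pos t" "f r \<in> C \<inter> f ` pos t" using qr e edges_in_pos[OF qr(1)] by auto
  then have "f q \<in> f ` D" "f r \<in> f ` D" using D(1) by blast+
  then have "q \<in> D" "r \<in> D" using inj_on_image_mem_iff[OF inj _ D(2)] edges_in_pos[OF qr(1)] by simp_all
  then show thesis using that qr et by (simp add: arc_to_ends_def)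
qed

text \<open>By induction the cycle meets each subtree at most in its root. If such a root lay on the
  cycle, it would have two cycle arrows there. Below an \<open>Arr\<close> node only one arrow is
  available; below a \<open>Tri\<close> node they would be two arrows of the oriented triangle,
  which would then lie entirely in the cycle.\<close>

lemma nonoriented_cycle_emb:
  assumes nc: "nonoriented_cycle (Q \<restriction> C)"
  shows "emb Q X f t \<Longrightarrow> C \<inter> f ` pos t \<subseteq> {f []}"
proof (induction t arbitrary: X f)
  case Leaf
  then show ?case by auto
next
  case (Arr d t)
  let ?t = "Arr d t" and ?D = "{[], [True]}"
  have simple: "inj_on (arc_to_ends Q) (touching Q (f ` pos ?t))" using Arr.prems by (simp only: emb_def)
  have D: "C \<inter> f ` pos ?t \<subseteq> f ` ?D" "?D \<subseteq> pos ?t"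
    using Arr.IH[OF emb_Arr[OF Arr.prems]] by auto
  have "f [True] \<notin> C"
  proof
    assume "f [True] \<in> C"
    then obtain e e' where e: "e \<in> arcs (Q \<restriction> C)" "e' \<in> arcs (Q \<restriction> C)" "e \<noteq> e'"
      "f [True] \<in> {tail Q e, head Q e}" "f [True] \<in> {tail Q e', head Q e'}"
      using nonoriented_cycle_two_arcs_induced[OF nc] by metis
    have "arc_to_ends Q b = map_prod f f (if d then ([], [True]) else ([True], [])) \<and> b \<in> touching Q (f ` pos ?t)"
      if b: "b \<in> arcs (Q \<restriction> C)" "f [True] \<in> {tail Q b, head Q b}" for b
    proof -
      obtain q r where qr: "(q, r) \<in> edges ?t" "q \<in> ?D" "r \<in> ?D" "arc_to_ends Q b = (f q, f r)"
        "b \<in> touching Q (f ` pos ?t)"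
        by (rule emb_arc_within[OF Arr.prems D b(1) _ _ b(2)]) simp_all
      have "(q, r) = (if d then ([], [True]) else ([True], []))"
        using qr(1-3) edges_irrefl[of "[]" t] by (auto split: if_splits)
      then show ?thesis using qr(4,5) by auto
    qed
    from this[OF e(1,4)] this[OF e(2,5)] show False using e(3) inj_onD[OF simple] by auto
  qed
  then show ?case using D(1) by auto
next
  case (Tri s t)
  let ?t = "Tri s t" and ?D = "{[], [True], [False]}"
  have inj: "inj_on f (pos ?t)" and simple: "inj_on (arc_to_ends Q) (touching Q (f ` pos ?t))"
    using Tri.prems by (simp_all only: emb_def)
  have D: "C \<inter> f ` pos ?t \<subseteq> f ` ?D" "?D \<subseteq> pos ?t"
    using Tri.IH(1)[OF emb_Tri(1)[OF Tri.prems]] Tri.IH(2)[OF emb_Tri(2)[OF Tri.prems]] by auto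
  have "f [b] \<notin> C" for b
  proof
    assume "f [b] \<in> C"
    then obtain e e' where e: "e \<in> arcs (Q \<restriction> C)" "e' \<in> arcs (Q \<restriction> C)" "e \<noteq> e'"
      "f [b] \<in> {tail Q e, head Q e}" "f [b] \<in> {tail Q e', head Q e'}"
      using nonoriented_cycle_two_arcs_induced[OF nc] by metis
    have *: "arc_to_ends Q e \<in> {(f [], f [False]), (f [False], f [True]), (f [True], f [])} \<and> e \<in> touching Q (f ` pos ?t)"
      if b: "e \<in> arcs (Q \<restriction> C)" "f [b] \<in> {tail Q e, head Q e}" for e
    proof -
      have "[b] \<in> pos ?t" by (cases b) simp_all
      then obtain q r where qr: "(q, r) \<in> edges ?t" "q \<in> ?D" "r \<in> ?D" "arc_to_ends Q e = (f q, f r)"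
        "e \<in> touching Q (f ` pos ?t)"
        by (rule emb_arc_within[OF Tri.prems D b(1) _ _ b(2)]) simp_all
      have "(q, r) \<in> {([], [False]), ([False], [True]), ([True], [])}"
        using qr(1-3) edges_irrefl by auto
      then show ?thesis using qr(4,5) by auto
    qed
    note ends_e = *[OF e(1,4)] and ends_e' = *[OF e(2,5)]
    have "arc_to_ends Q e \<noteq> arc_to_ends Q e'"
      using inj_onD[OF simple, of e e'] ends_e ends_e' e(3) by blast
    \<comment> \<open>Two of the three arrows of a triangle already meet all its vertices, so the
      third arrow belongs to the full subquiver as well.\<close>
    moreover have "{x, z, y} \<subseteq> {fst P, snd P, fst P', snd P'}"
      if "P \<in> {(x, y), (y, z), (z, x)}" "P' \<in> {(x, y), (y, z), (z, x)}" "P \<noteq> P'" for x y z and P P' :: "'a \<times> 'a"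
      using that by auto
    ultimately have "{f [], f [True], f [False]} \<subseteq> {tail Q e, head Q e, tail Q e', head Q e'}"
      using conjunct1[OF ends_e] conjunct1[OF ends_e'] by (metis arc_to_ends_def fst_conv snd_conv)
    moreover have "{tail Q e, head Q e, tail Q e', head Q e'} \<subseteq> C" using e(1,2) by simp
    ultimately have C: "{f [], f [True], f [False]} \<subseteq> C" by (rule order_trans)
    have "([], [False]) \<in> edges ?t" "([False], [True]) \<in> edges ?t" "([True], []) \<in> edges ?t" by simp_all
    then obtain e1 e2 e3 where e123: "e1 \<in> arcs Q" "arc_to_ends Q e1 = (f [], f [False])"
       "e2 \<in> arcs Q" "arc_to_ends Q e2 = (f [False], f [True])" "e3 \<in> arcs Q" "arc_to_ends Q e3 = (f [True], f [])"
      by (meson emb_edge[OF Tri.prems])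
    moreover have "e1 \<in> arcs (Q \<restriction> C)" "e2 \<in> arcs (Q \<restriction> C)" "e3 \<in> arcs (Q \<restriction> C)"
      using e123 C by (auto simp: arc_to_ends_def)
    moreover have "f [] \<noteq> f [False]" "f [False] \<noteq> f [True]" "f [True] \<noteq> f []"
      using inj_onD[OF inj, of "[False]" "[]"] inj_onD[OF inj, of "[True]" "[]"] inj_onD[OF inj, of "[False]" "[True]"] by auto
    ultimately show False
      using nonoriented_cycle_no_triangle[OF nc, of e1 e2 e3 "f []" "f [False]" "f [True]"] by simp
  qed
  then show ?case using D(1) by auto
qed

section \<open>Coordinates on quivers of type affine A\<close>

definition opos :: "letter \<Rightarrow> bool list set" where
  "opos x = (case snd x of None \<Rightarrow> {} | Some t \<Rightarrow> pos t)"

definition src :: "(int \<Rightarrow> letter) \<Rightarrow> (int \<Rightarrow> 'a) \<Rightarrow> int \<Rightarrow> 'a" where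
  "src w v i = (if fst (w i) then v i else v (i + 1))"

definition tgt :: "(int \<Rightarrow> letter) \<Rightarrow> (int \<Rightarrow> 'a) \<Rightarrow> int \<Rightarrow> 'a" where
  "tgt w v i = (if fst (w i) then v (i + 1) else v i)"

text \<open>The ends of all arrows belonging to position \<open>i\<close> apart from the base arrow.
  The first two complete the base arrow to an oriented 3-cycle through the root.\<close>

definition spokes :: "(int \<Rightarrow> letter) \<Rightarrow> (int \<Rightarrow> 'a) \<Rightarrow> (int \<Rightarrow> bool list \<Rightarrow> 'a) \<Rightarrow> int \<Rightarrow> ('a \<times> 'a) set" where
  "spokes w v u i = (case snd (w i) of None \<Rightarrow> {}
     | Some t \<Rightarrow> {(tgt w v i, u i []), (u i [], src w v i)} \<union> map_prod (u i) (u i) ` edges t)"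

lemma finite_opos [simp]: "finite (opos x)"
  by (auto simp: opos_def split: option.split)

lemma opos_Some: "snd x = Some t \<Longrightarrow> opos x = pos t"
  by (simp add: opos_def)

lemma oposE:
  assumes "p \<in> opos x"
  obtains t where "snd x = Some t"
  using assms by (cases "snd x") (auto simp: opos_def)

text \<open>Coordinates on a quiver of type affine A: the letter \<open>w i\<close> gives the orientation of the base
  arrow \<open>a i\<close>, joining the cycle vertices \<open>v i\<close> and \<open>v (i + 1)\<close>, and the shape of the rooted quiver
  attached to it, whose vertices are \<open>u i p\<close>. All sequences have period \<open>n\<close>.\<close>

locale wheel =
  fixes Q :: "('a, 'b) pre_digraph" and n :: int and w :: "int \<Rightarrow> letter"
    and v :: "int \<Rightarrow> 'a" and a :: "int \<Rightarrow> 'b" and u :: "int \<Rightarrow> bool list \<Rightarrow> 'a"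
  assumes two_le: "2 \<le> n"
    and w_per: "n dvd i - j \<Longrightarrow> w i = w j"
    and u_per: "n dvd i - j \<Longrightarrow> u i = u j"
    and v_eq: "v i = v j \<longleftrightarrow> n dvd i - j"
    and a_eq: "a i = a j \<longleftrightarrow> n dvd i - j"
    and u_eq: "p \<in> opos (w i) \<Longrightarrow> q \<in> opos (w j) \<Longrightarrow> u i p = u j q \<Longrightarrow> n dvd i - j \<and> p = q"
    and v_neq_u: "p \<in> opos (w j) \<Longrightarrow> v i \<noteq> u j p"
    and verts_eq: "verts Q = range v \<union> (\<Union>i. u i ` opos (w i))"
    and base: "arc_to_ends Q (a i) = (src w v i, tgt w v i)"
    and a_arcs: "range a \<subseteq> arcs Q"
    and simple: "inj_on (arc_to_ends Q) (arcs Q - range a)"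
    and spokes_eq: "arc_to_ends Q ` (arcs Q - range a) = (\<Union>i. spokes w v u i)"
begin

lemma v_per: "n dvd i - j \<Longrightarrow> v i = v j" and a_per: "n dvd i - j \<Longrightarrow> a i = a j"
  by (simp_all add: v_eq a_eq)

lemma src_per: "n dvd i - j \<Longrightarrow> src w v i = src w v j" and tgt_per: "n dvd i - j \<Longrightarrow> tgt w v i = tgt w v j"
  using w_per[of i j] v_per[of i j] v_per[of "i + 1" "j + 1"] by (simp_all add: src_def tgt_def)

lemma spokes_per: "n dvd i - j \<Longrightarrow> spokes w v u i = spokes w v u j"
  using w_per[of i j] u_per[of i j] src_per[of i j] tgt_per[of i j] by (simp add: spokes_def split: option.split)

lemma src_tgt: "{src w v i, tgt w v i} = {v i, v (i + 1)}"
  by (auto simp: src_def tgt_def)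

lemma src_in_range [simp]: "src w v i \<in> range v" and tgt_in_range [simp]: "tgt w v i \<in> range v"
  by (auto simp: src_def tgt_def)

lemma v_Suc: "v i \<noteq> v (i + 1)"
proof -
  have "\<not> n dvd 1" using two_le by (simp add: zdvd_not_zless)
  then show ?thesis by (simp add: v_eq)
qed

lemma src_neq_tgt: "src w v i \<noteq> tgt w v i"
  using v_Suc[of i] by (auto simp: src_def tgt_def)

lemma u_notin_range: "p \<in> opos (w i) \<Longrightarrow> u i p \<notin> range v"
  using v_neq_u by fastforce

lemma cycle_tree_disjoint: "x \<in> range v \<Longrightarrow> x \<notin> u i ` opos (w i)"
  using u_notin_range by blast

lemma mod_per: "n dvd i - i mod n"
  by (simp add: minus_mod_eq_mult_div)

lemma mod_range: "i mod n \<in> {0..<n}"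
  using two_le by simp

lemma range_per:
  assumes "\<And>i j. n dvd i - j \<Longrightarrow> f i = f j"
  shows "range f = f ` {0..<n}"
proof -
  have "f i \<in> f ` {0..<n}" for i
    using assms[OF mod_per[of i]] mod_range[of i] by (metis imageI)
  then show ?thesis by blast
qed

lemma a_in_arcs [simp]: "a i \<in> arcs Q"
  using a_arcs by blast

lemma tail_a: "tail Q (a i) = src w v i" and head_a: "head Q (a i) = tgt w v i"
  using base[of i] by (simp_all add: arc_to_ends_def)

lemma v_in_verts [simp]: "v i \<in> verts Q"
  by (auto simp: verts_eq)

lemma u_in_verts: "p \<in> opos (w i) \<Longrightarrow> u i p \<in> verts Q"
  by (auto simp: verts_eq)

lemma verts_cases:
  assumes "x \<in> verts Q"
  obtains (cycle) i where "x = v i" | (tree) i p where "p \<in> opos (w i)" "x = u i p"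
  using assms by (auto simp: verts_eq)

lemma spokes_cases:
  assumes "x \<in> spokes w v u i"
  obtains (into) t where "snd (w i) = Some t" "x = (tgt w v i, u i [])"
    | (out) t where "snd (w i) = Some t" "x = (u i [], src w v i)"
    | (inner) t p q where "snd (w i) = Some t" "(p, q) \<in> edges t" "x = (u i p, u i q)"
  using assms by (auto simp: spokes_def split: option.splits)

lemma spokes_verts: "x \<in> spokes w v u i \<Longrightarrow> fst x \<in> range v \<union> u i ` opos (w i) \<and> snd x \<in> range v \<union> u i ` opos (w i)
    \<and> (fst x \<in> u i ` opos (w i) \<or> snd x \<in> u i ` opos (w i))"
  by (erule spokes_cases) (auto simp: opos_Some dest: edges_in_pos)

lemma base_ends_range: "e \<in> range a \<Longrightarrow> tail Q e \<in> range v \<and> head Q e \<in> range v"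
  by (auto simp: tail_a head_a)

lemma nonbase:
  assumes "e \<in> arcs Q" "e \<notin> range a"
  obtains i where "arc_to_ends Q e \<in> spokes w v u i"
  using assms spokes_eq by blast

lemma spoke_arc:
  assumes "x \<in> spokes w v u i"
  obtains e where "e \<in> arcs Q" "e \<notin> range a" "arc_to_ends Q e = x"
proof -
  have "x \<in> arc_to_ends Q ` (arcs Q - range a)" using assms spokes_eq by blast
  then show thesis using that by blast
qed

lemma spoke_nonbase: "arc_to_ends Q e \<in> spokes w v u i \<Longrightarrow> e \<notin> range a"
  using spokes_verts[of "arc_to_ends Q e" i] base_ends_range[of e] cycle_tree_disjoint
  unfolding arc_to_ends_def fst_conv snd_conv by blast

lemma spoke_unique:
  assumes "e \<in> arcs Q" "e' \<in> arcs Q" "arc_to_ends Q e = arc_to_ends Q e'" "arc_to_ends Q e \<in> spokes w v u i"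
  shows "e = e'"
  using spoke_nonbase[OF assms(4)] spoke_nonbase[OF assms(4)[unfolded assms(3)]] assms(1-3) simple
  by (auto dest: inj_onD)

lemma spokes_touch:
  assumes "p \<in> opos (w i)" "e \<in> arcs Q" "u i p \<in> {tail Q e, head Q e}"
  shows "arc_to_ends Q e \<in> spokes w v u i"
proof -
  have "e \<notin> range a" using base_ends_range[of e] u_notin_range[OF assms(1)] assms(3) by auto
  then obtain j where j: "arc_to_ends Q e \<in> spokes w v u j" using nonbase assms(2) by blast
  have "u i p \<in> u j ` opos (w j)"
    using spokes_verts[OF j] assms(3) u_notin_range[OF assms(1)] by (auto simp: arc_to_ends_def)
  then have "n dvd i - j" using u_eq[OF assms(1)] by blast
  then show ?thesis using j spokes_per by blast
qed

lemma dominates_touch: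
  "p \<in> opos (w i) \<Longrightarrow> (x, y) \<in> arcs_ends Q \<Longrightarrow> x = u i p \<or> y = u i p \<Longrightarrow> (x, y) \<in> spokes w v u i"
proof (erule arcs_endsE)
  fix e assume "p \<in> opos (w i)" "x = u i p \<or> y = u i p" "e \<in> arcs Q" "arc_to_ends Q e = (x, y)"
  then show "(x, y) \<in> spokes w v u i" using spokes_touch[of p i e] by (auto simp: arc_to_ends_def)
qed

lemma spokes_dominates: "x \<in> spokes w v u i \<Longrightarrow> x \<in> arcs_ends Q"
  by (erule spoke_arc) (auto simp: arcs_ends_def)

lemma base_dominates: "(src w v i, tgt w v i) \<in> arcs_ends Q"
  unfolding base[symmetric] arcs_ends_def by simp

lemma dominates_base:
  assumes "(x, y) \<in> arcs_ends Q" "x \<in> range v" "y \<in> range v"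
  obtains i where "x = src w v i" "y = tgt w v i"
proof -
  obtain e where e: "e \<in> arcs Q" "arc_to_ends Q e = (x, y)" using assms(1) by (rule arcs_endsE)
  have "e \<in> range a"
  proof (rule ccontr)
    assume "e \<notin> range a"
    then obtain j where "arc_to_ends Q e \<in> spokes w v u j" using nonbase e(1) by blast
    then show False using spokes_verts[of "(x, y)" j] e(2) assms(2,3) cycle_tree_disjoint by auto
  qed
  then show thesis using that e base by auto
qed

lemma wf: "wf_digraph Q"
proof
  fix e assume e: "e \<in> arcs Q"
  have "tail Q e \<in> verts Q \<and> head Q e \<in> verts Q"
  proof (cases "e \<in> range a")
    case True
    then show ?thesis using base_ends_range verts_eq by blast
  next
    case False
    then obtain j where "arc_to_ends Q e \<in> spokes w v u j" using nonbase e by blast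
    from spokes_verts[OF this] show ?thesis unfolding verts_eq by (auto simp: arc_to_ends_def)
  qed
  then show "tail Q e \<in> verts Q" "head Q e \<in> verts Q" by auto
qed

lemma opos_per: "n dvd i - j \<Longrightarrow> u i ` opos (w i) = u j ` opos (w j)"
  using u_per w_per by metis

lemma fin: "fin_digraph Q"
proof -
  interpret wf_digraph Q by (rule wf)
  have "finite (range v)" "finite (range a)" by (simp_all add: range_per[OF v_per] range_per[OF a_per])
  moreover have "finite (\<Union>i. u i ` opos (w i))" by (simp add: range_per[OF opos_per])
  moreover have "finite (spokes w v u i)" for i by (auto simp: spokes_def split: option.split)
  then have "finite (\<Union>i. spokes w v u i)" by (simp add: range_per[OF spokes_per])
  then have "finite (arcs Q - range a)"
    unfolding spokes_eq[symmetric] using simple by (simp add: finite_image_iff)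
  then have "finite (arcs Q)" using \<open>finite (range a)\<close> by (rule finite_Diff2[THEN iffD1, rotated])
  ultimately show ?thesis by unfold_locales (simp_all add: verts_eq)
qed

lemma arcs_cycle: "arcs (Q \<restriction> range v) = range a"
proof
  show "range a \<subseteq> arcs (Q \<restriction> range v)" using base_ends_range by auto
  show "arcs (Q \<restriction> range v) \<subseteq> range a"
  proof
    fix e assume e: "e \<in> arcs (Q \<restriction> range v)"
    show "e \<in> range a"
    proof (rule ccontr)
      assume "e \<notin> range a"
      then obtain j where "arc_to_ends Q e \<in> spokes w v u j" using nonbase e by auto
      from spokes_verts[OF this] have "tail Q e \<in> u j ` opos (w j) \<or> head Q e \<in> u j ` opos (w j)"
        by (simp add: arc_to_ends_def)
      moreover have "tail Q e \<in> range v" "head Q e \<in> range v" using e by simp_all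
      ultimately show False using cycle_tree_disjoint by blast
    qed
  qed
qed

lemma cycle: "cyc (Q \<restriction> range v) n v a"
proof
  show "range a = arcs (Q \<restriction> range v)" by (rule arcs_cycle[symmetric])
  show "{tail (Q \<restriction> range v) (a i), head (Q \<restriction> range v) (a i)} = {v i, v (i + 1)}" for i
    using src_tgt[of i] by (simp add: tail_a head_a)
qed (simp_all add: two_le v_eq a_eq)

lemma emb:
  assumes "snd (w i) = Some t"
  shows "emb Q {v i, v (i + 1)} (u i) t"
proof -
  have o: "opos (w i) = pos t" using assms by (rule opos_Some)
  have T: "arc_to_ends Q e \<in> spokes w v u i" if "e \<in> touching Q (u i ` pos t)" for e
    using that spokes_touch[of _ i e] o by (auto simp: touching_def)
  have sp: "spokes w v u i = {(tgt w v i, u i []), (u i [], src w v i)} \<union> map_prod (u i) (u i) ` edges t"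
    using assms by (simp add: spokes_def)
  have "inj_on (u i) (pos t)" using u_eq[of _ i _ i] o by (auto simp: inj_on_def)
  moreover have "{v i, v (i + 1)} \<inter> u i ` pos t = {}" using v_neq_u o by auto
  moreover have "map_prod (u i) (u i) ` edges t \<subseteq> arcs_ends Q" using spokes_dominates[of _ i] sp by auto
  moreover have "inj_on (arc_to_ends Q) (touching Q (u i ` pos t))"
    using T spoke_unique[of _ _ i] by (auto intro!: inj_onI simp: touching_def)
  moreover have "arc_to_ends Q ` touching Q (u i ` pos t) \<subseteq>
     map_prod (u i) (u i) ` edges t \<union> ({u i []} \<times> {v i, v (i + 1)} \<union> {v i, v (i + 1)} \<times> {u i []})"
  proof -
    have "spokes w v u i \<subseteq> map_prod (u i) (u i) ` edges t \<union> ({u i []} \<times> {v i, v (i + 1)} \<union> {v i, v (i + 1)} \<times> {u i []})"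
      unfolding sp using src_tgt[of i] by auto
    then show ?thesis using T by blast
  qed
  ultimately show ?thesis unfolding emb_def by blast
qed

text \<open>A non-oriented cycle meets the attached trees at most in their roots. A root on it would
  bring both of its arrows to the base cycle, hence an oriented triangle. So it lies in the base
  cycle, and having two arrows at each vertex it is closed under adjacency there.\<close>

lemma unique_cycle:
  assumes C: "C \<subseteq> verts Q" and nc: "nonoriented_cycle (Q \<restriction> C)"
  shows "C = range v"
proof -
  have root: "u i [] \<notin> C" if t: "snd (w i) = Some t" for i t
  proof
    assume uC: "u i [] \<in> C"
    have o: "opos (w i) = pos t" using t by (rule opos_Some)
    have inj: "inj_on (u i) (pos t)" using emb[OF t] by (simp only: emb_def)
    obtain e e' where e: "e \<in> arcs (Q \<restriction> C)" "e' \<in> arcs (Q \<restriction> C)" "e \<noteq> e'"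
      "u i [] \<in> {tail Q e, head Q e}" "u i [] \<in> {tail Q e', head Q e'}"
      using nonoriented_cycle_two_arcs_induced[OF nc uC] .
    have *: "b \<in> arcs Q" "arc_to_ends Q b \<in> spokes w v u i" "arc_to_ends Q b \<in> {(tgt w v i, u i []), (u i [], src w v i)}"
      if b: "b \<in> arcs (Q \<restriction> C)" "u i [] \<in> {tail Q b, head Q b}" for b
    proof -
      show "b \<in> arcs Q" using b by simp
      then show s: "arc_to_ends Q b \<in> spokes w v u i" using spokes_touch[of "[]" i b] o b(2) by simp
      show "arc_to_ends Q b \<in> {(tgt w v i, u i []), (u i [], src w v i)}"
        using s
      proof (cases rule: spokes_cases)
        case (inner t' p q)
        then have pq: "p \<in> pos t" "q \<in> pos t" "(p, q) \<in> edges t" using t edges_in_pos by auto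
        have "u i p \<in> C" "u i q \<in> C" using b(1) inner(3) by (auto simp: arc_to_ends_def)
        then have "u i p = u i []" "u i q = u i []" using nonoriented_cycle_emb[OF nc emb[OF t]] pq by auto
        then have "p = q" using inj_onD[OF inj] pq by auto
        then show ?thesis using pq edges_irrefl by blast
      qed auto
    qed
    have "arc_to_ends Q e \<noteq> arc_to_ends Q e'"
      using spoke_unique[OF *(1)[OF e(1,4)] *(1)[OF e(2,5)] _ *(2)[OF e(1,4)]] e(3) by blast
    then obtain e2 e3 where e23: "e2 \<in> arcs (Q \<restriction> C)" "e3 \<in> arcs (Q \<restriction> C)"
      "arc_to_ends Q e2 = (tgt w v i, u i [])" "arc_to_ends Q e3 = (u i [], src w v i)"
      using *(3)[OF e(1,4)] *(3)[OF e(2,5)] e(1,2) by (metis empty_iff insert_iff)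
    have "src w v i \<in> C" "tgt w v i \<in> C" using e23 by (auto simp: arc_to_ends_def)
    then have "a i \<in> arcs (Q \<restriction> C)" by (simp add: tail_a head_a)
    then show False
      using nonoriented_cycle_no_triangle[OF nc _ e23(1,2), of "a i" "src w v i" "tgt w v i" "u i []"] e23 base
        src_neq_tgt[of i] u_notin_range[of "[]" i] o src_in_range[of i] tgt_in_range[of i]
      by (metis Nil_in_pos induce_ends(3))
  qed
  have "u i p \<notin> C" if p: "p \<in> opos (w i)" for i p
  proof
    assume "u i p \<in> C"
    obtain t where t: "snd (w i) = Some t" using p by (rule oposE)
    then have "u i p = u i []" using nonoriented_cycle_emb[OF nc emb[OF t]] \<open>u i p \<in> C\<close> p by (auto simp: opos_Some)
    then show False using root[OF t] \<open>u i p \<in> C\<close> by simp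
  qed
  then have sub: "C \<subseteq> range v" using C by (auto simp: verts_eq)
  interpret cyc "Q \<restriction> range v" n v a by (rule cycle)
  have arcs_at: "a i \<in> arcs (Q \<restriction> C) \<and> a (i - 1) \<in> arcs (Q \<restriction> C)" if "v i \<in> C" for i
  proof -
    obtain e e' where e: "e \<in> arcs (Q \<restriction> C)" "e' \<in> arcs (Q \<restriction> C)" "e \<noteq> e'"
      "v i \<in> {tail Q e, head Q e}" "v i \<in> {tail Q e', head Q e'}"
      using nonoriented_cycle_two_arcs_induced[OF nc \<open>v i \<in> C\<close>] .
    have "e \<in> range a" "e' \<in> range a" using e(1,2) sub unfolding arcs_cycle[symmetric] by auto
    then obtain j j' where "e = a j" "e' = a j'" by blast
    then show ?thesis using incident[of i j] incident[of i j'] e by auto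
  qed
  have "tail Q b \<in> C \<longleftrightarrow> head Q b \<in> C" if "b \<in> range a" for b
  proof -
    have "b \<in> arcs (Q \<restriction> C)" if x: "x \<in> C" "x \<in> {tail Q b, head Q b}" for x
    proof -
      obtain i j where "x = v i" "b = a j" using x(1) sub \<open>b \<in> range a\<close> by blast
      then show ?thesis using arcs_at[of i] incident[of i j] x by auto
    qed
    then show ?thesis by auto
  qed
  then have closed: "tail (Q \<restriction> range v) b \<in> C \<longleftrightarrow> head (Q \<restriction> range v) b \<in> C" if "b \<in> arcs (Q \<restriction> range v)" for b
    using that unfolding arcs_cycle induce_ends by blast
  obtain i where "v i \<in> C" using nonoriented_cycle_nonempty[OF nc] sub by auto
  from connected_closed[of i C, OF this closed] show ?thesis using sub by auto
qed

text \<open>Indices range over all integers, so every set of the union recurs with period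
  \<open>n\<close> and is counted once per period.\<close>

lemma sum_UN_card:
  assumes "\<And>i. finite (T i)" "\<And>i j. n dvd i - j \<Longrightarrow> T i = T j"
    "\<And>i j x. x \<in> T i \<Longrightarrow> x \<in> T j \<Longrightarrow> n dvd i - j"
  shows "card (\<Union>i. T i) = (\<Sum>i\<in>{0..<n}. card (T i))"
proof -
  have "T i \<inter> T j = {}" if "i \<in> {0..<n}" "j \<in> {0..<n}" "i \<noteq> j" for i j
    using assms(3)[of _ i j] dvd_diff_imp_eq[of n i j] that by auto
  then have "card (\<Union>i\<in>{0..<n}. T i) = (\<Sum>i\<in>{0..<n}. card (T i))"
    using assms(1) by (intro card_UN_disjoint) blast+
  then show ?thesis by (simp only: range_per[of T, OF assms(2)])
qed

lemma card_verts: "card (verts Q) = (\<Sum>i\<in>{0..<n}. lsize (w i))"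
proof -
  have "card (range v) = nat n" using cyc.card_verts[OF cycle] by simp
  moreover have "card (\<Union>i. u i ` opos (w i)) = (\<Sum>i\<in>{0..<n}. card (u i ` opos (w i)))"
    using u_eq opos_per by (intro sum_UN_card) auto
  moreover have "card (u i ` opos (w i)) = (case snd (w i) of None \<Rightarrow> 0 | Some t \<Rightarrow> tsize t)" for i
  proof -
    have "inj_on (u i) (opos (w i))" using u_eq[of _ i _ i] by (auto simp: inj_on_def)
    then have "card (u i ` opos (w i)) = card (opos (w i))" by (rule card_image)
    then show ?thesis by (simp add: opos_def card_pos split: option.split)
  qed
  moreover have "range v \<inter> (\<Union>i. u i ` opos (w i)) = {}"
    unfolding disjoint_iff using cycle_tree_disjoint by blast
  moreover have "finite (range v)" "finite (\<Union>i. u i ` opos (w i))"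
    by (simp_all add: range_per[OF v_per] range_per[OF opos_per])
  ultimately show ?thesis
    by (simp add: verts_eq card_Un_disjoint lsize_def sum_Suc)
qed

end

section \<open>Connectedness\<close>

lemma edges_connected:
  assumes "[] \<in> S" "\<And>p q. (p, q) \<in> edges t \<Longrightarrow> p \<in> S \<longleftrightarrow> q \<in> S"
  shows "pos t \<subseteq> S"
  using assms
proof (induction t arbitrary: S)
  case Leaf
  then show ?case by simp
next
  case (Arr d t)
  have "[True] \<in> S" using Arr.prems(1) Arr.prems(2)[of "[]" "[True]"] Arr.prems(2)[of "[True]" "[]"] by (cases d) auto
  then have "pos t \<subseteq> {p. True # p \<in> S}"
    using Arr.prems(2) by (intro Arr.IH) auto
  then show ?case using Arr.prems(1) by auto
next
  case (Tri s t)
  have "[True] \<in> S" "[False] \<in> S"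
    using Tri.prems(1) Tri.prems(2)[of "[]" "[False]"] Tri.prems(2)[of "[True]" "[]"] by auto
  then have "pos t \<subseteq> {p. True # p \<in> S}" "pos s \<subseteq> {p. False # p \<in> S}"
    using Tri.prems(2) by (intro Tri.IH; auto)+
  then show ?case using Tri.prems(1) by auto
qed

text \<open>The set of vertices reachable from \<open>x\<close> in the symmetric closure is closed
  under arrows in both directions. In this form connectedness can be shown by induction along the
  cycle and the trees.\<close>

lemma connectedI:
  assumes "wf_digraph Q" "x \<in> verts Q"
    "\<And>S. x \<in> S \<Longrightarrow> (\<And>e. e \<in> arcs Q \<Longrightarrow> tail Q e \<in> S \<longleftrightarrow> head Q e \<in> S) \<Longrightarrow> verts Q \<subseteq> S"
  shows "Digraph_Component.connected Q"
proof -
  interpret wf_digraph Q by fact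
  let ?R = "rtrancl_on (verts Q) (parcs (mk_symmetric Q))"
  have sym: "sym ?R" by (intro rtrancl_on_sym symI) (auto simp: mk_symmetric_def)
  have arc: "(tail Q e, head Q e) \<in> parcs (mk_symmetric Q)" "(head Q e, tail Q e) \<in> parcs (mk_symmetric Q)"
    if "e \<in> arcs Q" for e using that by (auto simp: mk_symmetric_def)
  have "verts Q \<subseteq> {y. (x, y) \<in> ?R}"
  proof (rule assms(3))
    show "x \<in> {y. (x, y) \<in> ?R}" using assms(2) by simp
    fix e assume e: "e \<in> arcs Q"
    show "tail Q e \<in> {y. (x, y) \<in> ?R} \<longleftrightarrow> head Q e \<in> {y. (x, y) \<in> ?R}"
      using arc[OF e] e by (auto intro: rtrancl_on_into_rtrancl_on)
  qed
  then have xy: "(x, y) \<in> ?R" if "y \<in> verts Q" for y using that by blast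
  have "(y, z) \<in> ?R" if "y \<in> verts Q" "z \<in> verts Q" for y z
    by (rule rtrancl_on_trans[OF symD[OF sym xy] xy]) fact+
  then have "strongly_connected (with_proj (mk_symmetric Q))"
    using assms(2) by (intro strongly_connectedI) (auto simp: reachable_def mk_symmetric_def)
  then show ?thesis by (simp add: connected_def)
qed

lemma (in wheel) connected: "Digraph_Component.connected Q"
proof (rule connectedI[OF wf v_in_verts[of 0]])
  fix S assume S: "v 0 \<in> S" "\<And>e. e \<in> arcs Q \<Longrightarrow> tail Q e \<in> S \<longleftrightarrow> head Q e \<in> S"
  then have dom: "x \<in> S \<longleftrightarrow> y \<in> S" if "(x, y) \<in> arcs_ends Q" for x y
    using that by (auto elim!: arcs_endsE simp: arc_to_ends_def)
  interpret c: cyc "Q \<restriction> range v" n v a by (rule cycle)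
  have v: "v i \<in> S" for i using c.connected_closed[OF S(1)] S(2) by auto
  have "u i p \<in> S" if p: "p \<in> opos (w i)" for i p
  proof -
    obtain t where t: "snd (w i) = Some t" using p by (rule oposE)
    have "(tgt w v i, u i []) \<in> spokes w v u i" using t by (simp add: spokes_def)
    moreover have "tgt w v i \<in> S" using v by (simp add: tgt_def)
    ultimately have "u i [] \<in> S" using dom[OF spokes_dominates] by blast
    moreover have "u i p \<in> S \<longleftrightarrow> u i q \<in> S" if "(p, q) \<in> edges t" for p q
    proof -
      have "(u i p, u i q) \<in> spokes w v u i" using that t by (force simp: spokes_def)
      then show ?thesis using dom[OF spokes_dominates] by blast
    qed
    ultimately have "pos t \<subseteq> {p. u i p \<in> S}" by (intro edges_connected) auto
    then show ?thesis using p t by (auto simp: opos_Some)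
  qed
  then show "verts Q \<subseteq> S" using v by (auto simp: verts_eq)
qed

section \<open>Changes of coordinates and isomorphisms\<close>

lemma range_reflect: "range (\<lambda>i. f (k - i :: int)) = range f"
proof -
  have "f i \<in> range (\<lambda>i. f (k - i))" for i
    by (rule image_eqI[of _ _ "k - i"]) auto
  then show ?thesis by auto
qed

context wheel
begin

text \<open>Source and target of each base arrow stay the same, but the order of the indices is
  reversed; therefore the letters are flipped.\<close>

lemma wheel_reversal:
  "wheel Q n (\<lambda>i. flip (w (k - 1 - i))) (\<lambda>i. v (k - i)) (\<lambda>i. a (k - 1 - i)) (\<lambda>i. u (k - 1 - i))"
proof
  have st: "src (\<lambda>i. flip (w (k - 1 - i))) (\<lambda>i. v (k - i)) i = src w v (k - 1 - i)"
    "tgt (\<lambda>i. flip (w (k - 1 - i))) (\<lambda>i. v (k - i)) i = tgt w v (k - 1 - i)" for i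
    by (simp_all add: src_def tgt_def algebra_simps)
  have sp: "spokes (\<lambda>i. flip (w (k - 1 - i))) (\<lambda>i. v (k - i)) (\<lambda>i. u (k - 1 - i)) i = spokes w v u (k - 1 - i)" for i
    unfolding spokes_def st by simp
  have o: "opos (flip x) = opos x" for x by (simp add: opos_def)
  have r: "range (\<lambda>i. a (k - 1 - i)) = range a" by (rule range_reflect)
  show "arc_to_ends Q (a (k - 1 - i)) = (src (\<lambda>i. flip (w (k - 1 - i))) (\<lambda>i. v (k - i)) i,
      tgt (\<lambda>i. flip (w (k - 1 - i))) (\<lambda>i. v (k - i)) i)" for i
    unfolding st by (rule base)
  show "verts Q = range (\<lambda>i. v (k - i)) \<union> (\<Union>i. u (k - 1 - i) ` opos (flip (w (k - 1 - i))))"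
    unfolding range_reflect[of v] o range_reflect[of "\<lambda>i. u i ` opos (w i)"] by (rule verts_eq)
  show "arc_to_ends Q ` (arcs Q - range (\<lambda>i. a (k - 1 - i))) =
      (\<Union>i. spokes (\<lambda>i. flip (w (k - 1 - i))) (\<lambda>i. v (k - i)) (\<lambda>i. u (k - 1 - i)) i)"
    unfolding r sp range_reflect[of "spokes w v u"] by (rule spokes_eq)
  show "inj_on (arc_to_ends Q) (arcs Q - range (\<lambda>i. a (k - 1 - i)))" unfolding r by (rule simple)
  show "range (\<lambda>i. a (k - 1 - i)) \<subseteq> arcs Q" unfolding r by (rule a_arcs)
  have d: "n dvd (k - 1 - i) - (k - 1 - j) \<longleftrightarrow> n dvd i - j" for i j by (simp add: dvd_diff_commute)
  show "flip (w (k - 1 - i)) = flip (w (k - 1 - j))" "u (k - 1 - i) = u (k - 1 - j)" if "n dvd i - j" for i j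
    using that w_per u_per d by metis+
  show "n dvd i - j \<and> p = q" if "p \<in> opos (flip (w (k - 1 - i)))" "q \<in> opos (flip (w (k - 1 - j)))"
    "u (k - 1 - i) p = u (k - 1 - j) q" for i j p q
    using u_eq[OF that[unfolded o]] unfolding d .
  show "v (k - i) = v (k - j) \<longleftrightarrow> n dvd i - j" for i j by (simp add: v_eq dvd_diff_commute)
  show "a (k - 1 - i) = a (k - 1 - j) \<longleftrightarrow> n dvd i - j" for i j by (simp add: a_eq dvd_diff_commute)
  show "v (k - i) \<noteq> u (k - 1 - j) p" if "p \<in> opos (flip (w (k - 1 - j)))" for i j p
    using that v_neq_u unfolding o by blast
qed (rule two_le)

text \<open>A translation is the composition of two reflections, and the two flips cancel.\<close>

lemma wheel_shift: "wheel Q n (\<lambda>i. w (i + k)) (\<lambda>i. v (i + k)) (\<lambda>i. a (i + k)) (\<lambda>i. u (i + k))"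
proof -
  interpret R: wheel Q n "\<lambda>i. flip (w (0 - 1 - i))" "\<lambda>i. v (0 - i)" "\<lambda>i. a (0 - 1 - i)" "\<lambda>i. u (0 - 1 - i)"
    by (rule wheel_reversal)
  have "0 - 1 - (- k - 1 - i) = i + k" "0 - (- k - i) = i + k" for i by simp_all
  then show ?thesis using R.wheel_reversal[of "- k"] by (simp only: flip_simps)
qed

lemma wheel_transfer:
  assumes f: "inj_on f (verts Q)" "verts Q' = f ` verts Q" and g: "inj_on g (arcs Q)" "arcs Q' = g ` arcs Q"
    and ends: "\<And>e. e \<in> arcs Q \<Longrightarrow> arc_to_ends Q' (g e) = map_prod f f (arc_to_ends Q e)"
  shows "wheel Q' n w (\<lambda>i. f (v i)) (\<lambda>i. g (a i)) (\<lambda>i p. f (u i p))"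
proof
  interpret wf_digraph Q by (rule wf)
  have st: "src w (\<lambda>i. f (v i)) i = f (src w v i)" "tgt w (\<lambda>i. f (v i)) i = f (tgt w v i)" for i
    by (simp_all add: src_def tgt_def)
  have sp: "spokes w (\<lambda>i. f (v i)) (\<lambda>i p. f (u i p)) i = map_prod f f ` spokes w v u i" for i
  proof (cases "snd (w i)")
    case (Some t)
    have "map_prod (\<lambda>p. f (u i p)) (\<lambda>p. f (u i p)) ` edges t = map_prod f f ` map_prod (u i) (u i) ` edges t"
      unfolding image_image by (intro image_cong) auto
    then show ?thesis using Some by (simp add: spokes_def st)
  qed (simp add: spokes_def)
  have r: "range (\<lambda>i. g (a i)) = g ` range a" by auto
  have N: "arcs Q' - g ` range a = g ` (arcs Q - range a)"
    unfolding g(2) using g(1) a_arcs by (simp add: inj_on_image_set_diff[of _ "arcs Q"])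
  have ends': "arc_to_ends Q' ` g ` (arcs Q - range a) = map_prod f f ` arc_to_ends Q ` (arcs Q - range a)"
    using ends by (auto simp: image_image intro!: image_cong)
  show "arc_to_ends Q' ` (arcs Q' - range (\<lambda>i. g (a i))) = (\<Union>i. spokes w (\<lambda>i. f (v i)) (\<lambda>i p. f (u i p)) i)"
    unfolding r N ends' spokes_eq sp by blast
  show "inj_on (arc_to_ends Q') (arcs Q' - range (\<lambda>i. g (a i)))"
    unfolding r N
  proof (rule inj_onI)
    fix x y assume "x \<in> g ` (arcs Q - range a)" "y \<in> g ` (arcs Q - range a)" "arc_to_ends Q' x = arc_to_ends Q' y"
    then obtain e e' where e: "e \<in> arcs Q - range a" "e' \<in> arcs Q - range a" "x = g e" "y = g e'"
      "map_prod f f (arc_to_ends Q e) = map_prod f f (arc_to_ends Q e')" using ends by auto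
    then have "arc_to_ends Q e = arc_to_ends Q e'" by (auto simp: arc_to_ends_def inj_on_eq_iff[OF f(1)])
    then show "x = y" using simple e by (auto dest: inj_onD)
  qed
  show "range (\<lambda>i. g (a i)) \<subseteq> arcs Q'" using g(2) a_arcs by auto
  show "arc_to_ends Q' (g (a i)) = (src w (\<lambda>i. f (v i)) i, tgt w (\<lambda>i. f (v i)) i)" for i
    unfolding st by (simp add: ends base)
  show "verts Q' = range (\<lambda>i. f (v i)) \<union> (\<Union>i. (\<lambda>p. f (u i p)) ` opos (w i))"
    unfolding f(2) verts_eq by auto
  show "f (v i) = f (v j) \<longleftrightarrow> n dvd i - j" for i j
    using inj_on_eq_iff[OF f(1) v_in_verts v_in_verts] by (simp add: v_eq)
  show "g (a i) = g (a j) \<longleftrightarrow> n dvd i - j" for i j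
    using inj_on_eq_iff[OF g(1) a_in_arcs a_in_arcs] by (simp add: a_eq)
  show "n dvd i - j \<and> p = q" if "p \<in> opos (w i)" "q \<in> opos (w j)" "f (u i p) = f (u j q)" for i j p q
    using that u_eq inj_onD[OF f(1)] u_in_verts by metis
  show "f (v i) \<noteq> f (u j p)" if "p \<in> opos (w j)" for i j p
    using inj_on_eq_iff[OF f(1) v_in_verts u_in_verts[OF that]] v_neq_u[OF that] by simp
  show "w i = w j" "(\<lambda>p. f (u i p)) = (\<lambda>p. f (u j p))" if "n dvd i - j" for i j
    using that w_per u_per by metis+
qed (rule two_le)

lemma wheel_app_iso:
  assumes "pre_digraph.digraph_isomorphism Q \<phi>"
  shows "wheel (app_iso \<phi> Q) n w (\<lambda>i. iso_verts \<phi> (v i)) (\<lambda>i. iso_arcs \<phi> (a i)) (\<lambda>i p. iso_verts \<phi> (u i p))"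
  using assms by (intro wheel_transfer) (auto simp: pre_digraph.digraph_isomorphism_def arc_to_ends_def)

end

text \<open>The word determines the quiver up to isomorphism, and the isomorphism can be chosen to
  respect coordinates. Applied to two coordinate systems of one quiver it produces
  automorphisms.\<close>

lemma wheel_iso:
  assumes "wheel Q n w v a u" "wheel Q' n w v' a' u'"
  obtains \<phi> where "pre_digraph.digraph_isomorphism Q \<phi>" "app_iso \<phi> Q = Q'"
    "\<And>i. iso_verts \<phi> (v i) = v' i" "\<And>i. iso_arcs \<phi> (a i) = a' i"
    "\<And>i p. p \<in> opos (w i) \<Longrightarrow> iso_verts \<phi> (u i p) = u' i p"
proof -
  interpret A: wheel Q n w v a u by fact
  interpret B: wheel Q' n w v' a' u' by fact
  \<comment> \<open>Each vertex goes to the one with the same coordinates. \<open>inv v\<close> and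
    \<open>SOME\<close> pick an index, and any two possible indices are congruent modulo
    \<open>n\<close>.\<close>
  define f where "f x = (if x \<in> range v then v' (inv v x)
    else case SOME (i, p). p \<in> opos (w i) \<and> u i p = x of (i, p) \<Rightarrow> u' i p)" for x
  have fv: "f (v i) = v' i" for i
  proof -
    have "v (inv v (v i)) = v i" by (rule f_inv_into_f) simp
    then have "n dvd inv v (v i) - i" by (simp add: A.v_eq)
    then show ?thesis by (simp add: f_def B.v_eq)
  qed
  have fu: "f (u i p) = u' i p" if p: "p \<in> opos (w i)" for i p
  proof -
    let ?P = "\<lambda>(j, q). q \<in> opos (w j) \<and> u j q = u i p"
    have "?P (SOME x. ?P x)" by (rule someI[of ?P "(i, p)"]) (simp add: p)
    then obtain j q where jq: "(SOME x. ?P x) = (j, q)" "q \<in> opos (w j)" "u j q = u i p"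
      by (cases "SOME x. ?P x") auto
    then have "n dvd j - i" "q = p" using A.u_eq[OF jq(2) p] by auto
    then have "u' j q = u' i p" using B.u_per by simp
    moreover have "f (u i p) = (case SOME x. ?P x of (j, q) \<Rightarrow> u' j q)"
      unfolding f_def using A.u_notin_range[OF p] by (simp only: if_False)
    ultimately show ?thesis by (simp only: jq(1) prod.case)
  qed
  have fst: "f (src w v i) = src w v' i" "f (tgt w v i) = tgt w v' i" for i
    by (simp_all add: src_def tgt_def fv)
  have sp: "spokes w v' u' i = map_prod f f ` spokes w v u i" for i
  proof (cases "snd (w i)")
    case (Some t)
    have "map_prod (u' i) (u' i) ` edges t = map_prod f f ` map_prod (u i) (u i) ` edges t"
      unfolding image_image using fu[of _ i] Some by (intro image_cong) (auto simp: opos_Some dest!: edges_in_pos)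
    then show ?thesis using fu[of "[]" i] Some by (simp add: spokes_def fst opos_Some)
  qed (simp add: spokes_def)
  have fV: "f ` verts Q = verts Q'"
    unfolding A.verts_eq B.verts_eq image_Un image_UN by (simp add: image_image fv fu cong: image_cong)
  have inj: "inj_on f (verts Q)"
  proof (rule inj_onI)
    fix x y assume "x \<in> verts Q" "y \<in> verts Q" and eq: "f x = f y"
    from this(1) show "x = y"
    proof (cases rule: A.verts_cases)
      case x: (cycle i)
      from \<open>y \<in> verts Q\<close> show ?thesis
      proof (cases rule: A.verts_cases)
        case (cycle j)
        then show ?thesis using eq x by (simp add: fv A.v_eq B.v_eq)
      next
        case (tree j q)
        then show ?thesis using eq x B.v_neq_u[of q j i] by (simp add: fv fu)
      qed
    next
      case x: (tree i p)
      from \<open>y \<in> verts Q\<close> show ?thesis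
      proof (cases rule: A.verts_cases)
        case (cycle j)
        then show ?thesis using eq x B.v_neq_u[of p i j] by (simp add: fv fu)
      next
        case (tree j q)
        then have "n dvd i - j \<and> p = q" using eq x B.u_eq[of p i q j] by (simp add: fu)
        then show ?thesis using x tree A.u_per[of i j] by simp
      qed
    qed
  qed
  let ?N = "arcs Q - range a" and ?N' = "arcs Q' - range a'"
  have N: "arc_to_ends Q' ` ?N' = map_prod f f ` arc_to_ends Q ` ?N"
    unfolding A.spokes_eq B.spokes_eq sp by blast
  \<comment> \<open>Base arrows are matched by index, because a double arrow has two with the same
    ends; every other arrow is determined by its ends.\<close>
  define g where "g e = (if e \<in> range a then a' (inv a e)
    else inv_into ?N' (arc_to_ends Q') (map_prod f f (arc_to_ends Q e)))" for e
  have ga: "g (a i) = a' i" for i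
  proof -
    have "a (inv a (a i)) = a i" by (rule f_inv_into_f) simp
    then have "n dvd inv a (a i) - i" by (simp add: A.a_eq)
    then show ?thesis by (simp add: g_def B.a_eq)
  qed
  have gN: "g e \<in> ?N'" "arc_to_ends Q' (g e) = map_prod f f (arc_to_ends Q e)" if "e \<in> ?N" for e
  proof -
    have m: "map_prod f f (arc_to_ends Q e) \<in> arc_to_ends Q' ` ?N'" unfolding N using that by blast
    have ge: "g e = inv_into ?N' (arc_to_ends Q') (map_prod f f (arc_to_ends Q e))"
      unfolding g_def using that by simp
    show "g e \<in> ?N'" unfolding ge by (rule inv_into_into[OF m])
    show "arc_to_ends Q' (g e) = map_prod f f (arc_to_ends Q e)" unfolding ge by (rule f_inv_into_f[OF m])
  qed
  have gends: "arc_to_ends Q' (g e) = map_prod f f (arc_to_ends Q e)" if "e \<in> arcs Q" for e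
  proof (cases "e \<in> range a")
    case True
    then obtain i where "e = a i" by blast
    then show ?thesis by (simp add: ga A.base B.base fst)
  qed (use gN that in blast)
  interpret wf_digraph Q by (rule A.wf)
  have fends: "arc_to_ends Q e = arc_to_ends Q e'"
    if "e \<in> arcs Q" "e' \<in> arcs Q" "map_prod f f (arc_to_ends Q e) = map_prod f f (arc_to_ends Q e')" for e e'
    using that by (simp add: arc_to_ends_def inj_on_eq_iff[OF inj])
  have ginj: "inj_on g (arcs Q)"
  proof (rule inj_onI)
    fix e e' assume e: "e \<in> arcs Q" "e' \<in> arcs Q" "g e = g e'"
    show "e = e'"
    proof (cases "e \<in> range a")
      case True
      then obtain i where i: "e = a i" by blast
      have "g e' \<in> range a'" using e(3) i ga by (metis rangeI)
      then have "e' \<in> range a" using gN(1)[of e'] e(2) by blast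
      then obtain j where "e' = a j" by blast
      then show ?thesis using i e by (simp add: ga A.a_eq B.a_eq)
    next
      case False
      have "g e' \<notin> range a'" using gN(1)[of e] e False by auto
      then have "e' \<notin> range a" using ga by auto
      moreover have "arc_to_ends Q e = arc_to_ends Q e'" using fends e gends by metis
      ultimately show ?thesis using A.simple False e by (auto dest: inj_onD)
    qed
  qed
  have gA: "g ` arcs Q = arcs Q'"
  proof (intro equalityI subsetI)
    fix e' assume "e' \<in> g ` arcs Q"
    then obtain e where "e \<in> arcs Q" "e' = g e" by blast
    then show "e' \<in> arcs Q'" using gN(1)[of e] ga by (cases "e \<in> range a") auto
  next
    fix e' assume e': "e' \<in> arcs Q'"
    show "e' \<in> g ` arcs Q"
    proof (cases "e' \<in> range a'")
      case True
      then obtain i where "e' = a' i" by blast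
      then have "e' = g (a i)" by (simp add: ga)
      then show ?thesis by simp
    next
      case False
      then have "arc_to_ends Q' e' \<in> map_prod f f ` arc_to_ends Q ` ?N" using e' N by blast
      then obtain e where e: "e \<in> ?N" "arc_to_ends Q' e' = map_prod f f (arc_to_ends Q e)"
        unfolding image_image by blast
      then have "arc_to_ends Q' (g e) = arc_to_ends Q' e'" using gN(2) by simp
      then have "g e = e'" using B.simple gN(1)[OF e(1)] e' False by (auto dest: inj_onD)
      then show ?thesis using e(1) by blast
    qed
  qed
  define \<phi> where "\<phi> = \<lparr>iso_verts = f, iso_arcs = g, iso_head = head Q', iso_tail = tail Q'\<rparr>"
  show thesis
  proof (rule that[of \<phi>])
    show "pre_digraph.digraph_isomorphism Q \<phi>"
      unfolding pre_digraph.digraph_isomorphism_def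
      using A.wf inj ginj gends by (auto simp: \<phi>_def arc_to_ends_def)
    show "app_iso \<phi> Q = Q'" by (simp add: app_iso_def \<phi>_def fV gA)
  qed (simp_all add: \<phi>_def fv ga fu)
qed

lemma wheel_exists:
  assumes n: "2 \<le> n" and per: "\<And>i j. n dvd i - j \<Longrightarrow> w i = w j"
  obtains Q :: "(nat, nat) pre_digraph" and v a u where "wheel Q n w v a u"
proof -
  \<comment> \<open>The second component separates cycle vertices, with \<open>[]\<close>, from tree
    vertices, with \<open>True # p\<close>.\<close>
  define v :: "int \<Rightarrow> nat" where "v i = to_nat (i mod n, [] :: bool list)" for i
  define u :: "int \<Rightarrow> bool list \<Rightarrow> nat" where "u i p = to_nat (i mod n, True # p)" for i p
  \<comment> \<open>Base arrows are encoded by their index, all other arrows by their pair of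
    ends.\<close>
  define a :: "int \<Rightarrow> nat" where "a i = to_nat (Inl (i mod n) :: int + nat \<times> nat)" for i
  define s :: "nat \<times> nat \<Rightarrow> nat" where "s x = to_nat (Inr x :: int + nat \<times> nat)" for x
  define Q where "Q = \<lparr>verts = range v \<union> (\<Union>i. u i ` opos (w i)), arcs = range a \<union> s ` (\<Union>i. spokes w v u i),
    tail = (\<lambda>e. case from_nat e :: int + nat \<times> nat of Inl i \<Rightarrow> src w v i | Inr x \<Rightarrow> fst x),
    head = (\<lambda>e. case from_nat e :: int + nat \<times> nat of Inl i \<Rightarrow> tgt w v i | Inr x \<Rightarrow> snd x)\<rparr>"
  have d: "i mod n = j mod n \<longleftrightarrow> n dvd i - j" for i j by (rule mod_eq_dvd_iff)
  have veq: "v i = v j \<longleftrightarrow> n dvd i - j" for i j by (simp add: v_def d)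
  have vmod: "v (i mod n) = v i" "v (i mod n + 1) = v (i + 1)" "w (i mod n) = w i" for i
    by (simp_all add: v_def mod_simps) (rule per, simp add: d[symmetric])
  have sinj: "s x = s y \<longleftrightarrow> x = y" for x y by (simp add: s_def)
  have sa: "s x \<noteq> a i" for x i by (simp add: s_def a_def)
  have ends_s: "arc_to_ends Q (s x) = x" for x by (simp add: arc_to_ends_def Q_def s_def)
  have N: "arcs Q - range a = s ` (\<Union>i. spokes w v u i)" using sa by (auto simp: Q_def)
  have "wheel Q n w v a u"
  proof
    show "a i = a j \<longleftrightarrow> n dvd i - j" for i j by (simp add: a_def d)
    show "u i = u j" if "n dvd i - j" for i j using that by (simp add: u_def d[symmetric] fun_eq_iff)
    show "n dvd i - j \<and> p = q" if "u i p = u j q" for i j p q using that by (simp add: u_def d)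
    show "v i \<noteq> u j p" for i j p by (simp add: v_def u_def)
    show "verts Q = range v \<union> (\<Union>i. u i ` opos (w i))" by (simp add: Q_def)
    show "arc_to_ends Q (a i) = (src w v i, tgt w v i)" for i
      by (simp add: arc_to_ends_def Q_def a_def src_def tgt_def vmod)
    show "range a \<subseteq> arcs Q" by (simp add: Q_def)
    show "inj_on (arc_to_ends Q) (arcs Q - range a)" unfolding N by (auto intro!: inj_onI simp: ends_s)
    show "arc_to_ends Q ` (arcs Q - range a) = (\<Union>i. spokes w v u i)" unfolding N image_image ends_s by simp
  qed (use n per veq in auto)
  then show thesis by (rule that)
qed

section \<open>Symmetric quivers and oriented 3-cycles\<close>

context wheel
begin

lemma dominates_cases:
  assumes "(x, y) \<in> arcs_ends Q"
  obtains (base) i where "x = src w v i" "y = tgt w v i" | (spoke) i where "(x, y) \<in> spokes w v u i"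
proof -
  obtain e where e: "e \<in> arcs Q" "arc_to_ends Q e = (x, y)" using assms by (rule arcs_endsE)
  show thesis
  proof (cases "e \<in> range a")
    case True
    then show ?thesis using e(2) base(1) wheel.base[OF wheel_axioms] by force
  next
    case False
    then show ?thesis using nonbase[OF e(1)] e(2) spoke by metis
  qed
qed

lemma spokes_irrefl: "(x, x) \<notin> spokes w v u i"
proof
  assume "(x, x) \<in> spokes w v u i"
  then show False
  proof (cases rule: spokes_cases)
    case (into t)
    then have "u i [] \<notin> range v" "u i [] = tgt w v i" using u_notin_range[of "[]" i] by (auto simp: opos_Some)
    then show False by (metis tgt_in_range)
  next
    case (out t)
    then have "u i [] \<notin> range v" "u i [] = src w v i" using u_notin_range[of "[]" i] by (auto simp: opos_Some)
    then show False by (metis src_in_range)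
  next
    case (inner t p q)
    then show False using u_eq[of p i q i] edges_in_pos[of p q t] edges_irrefl[of p t] by (auto simp: opos_Some)
  qed
qed

lemma spokes_out:
  assumes "(u i p, y) \<in> spokes w v u i" "p \<in> opos (w i)" "snd (w i) = Some t"
  obtains (src) "p = []" "y = src w v i" | (inner) q where "(p, q) \<in> edges t" "y = u i q" "q \<in> opos (w i)"
  using assms(1)
proof (cases rule: spokes_cases)
  case (into t')
  then show thesis using u_notin_range[OF assms(2)] tgt_in_range[of i] by simp
next
  case (out t')
  then show thesis using src assms(2,3) u_eq[OF assms(2), of "[]" i] by (simp add: opos_Some)
next
  case (inner t' p' q)
  then have "p' \<in> opos (w i)" "q \<in> opos (w i)" using edges_in_pos by (simp_all add: opos_Some)
  then show thesis using that(2)[of q] inner assms(3) u_eq[OF assms(2), of p' i] by simp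
qed

lemma spokes_in:
  assumes "(y, u i p) \<in> spokes w v u i" "p \<in> opos (w i)" "snd (w i) = Some t"
  obtains (tgt) "p = []" "y = tgt w v i" | (inner) q where "(q, p) \<in> edges t" "y = u i q" "q \<in> opos (w i)"
  using assms(1)
proof (cases rule: spokes_cases)
  case (into t')
  then show thesis using tgt assms(2,3) u_eq[OF assms(2), of "[]" i] by (simp add: opos_Some)
next
  case (out t')
  then show thesis using u_notin_range[OF assms(2)] src_in_range[of i] by simp
next
  case (inner t' q p')
  then have "p' \<in> opos (w i)" "q \<in> opos (w i)" using edges_in_pos by (simp_all add: opos_Some)
  then show thesis using that(2)[of q] inner assms(3) u_eq[OF assms(2), of p' i] by simp
qed

lemma loopfree: "loopfree_digraph Q"
proof -
  interpret wf_digraph Q by (rule wf)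
  show ?thesis
  proof
    fix e assume "e \<in> arcs Q"
    show "tail Q e \<noteq> head Q e"
    proof
      assume eq: "tail Q e = head Q e"
      have "(tail Q e, head Q e) \<in> arcs_ends Q" using \<open>e \<in> arcs Q\<close> by (auto simp: arcs_ends_conv)
      then show False
        using src_neq_tgt spokes_irrefl unfolding eq by (cases rule: dominates_cases) metis+
    qed
  qed
qed

section \<open>The attachment described by coordinates\<close>

definition zeta :: "'b \<rightharpoonup> 'a" where
  "zeta e = (if e \<in> range a then map_option (\<lambda>_. u (inv a e) []) (snd (w (inv a e))) else None)"

lemma zeta_a: "zeta (a i) = map_option (\<lambda>_. u i []) (snd (w i))"
proof -
  have "a (inv a (a i)) = a i" by (rule f_inv_into_f) simp
  then have "n dvd inv a (a i) - i" by (simp add: a_eq)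
  then have "u (inv a (a i)) = u i" "w (inv a (a i)) = w i" using u_per w_per by blast+
  then show ?thesis by (simp add: zeta_def)
qed

lemma zeta_Some: "zeta e = Some z \<longleftrightarrow> (\<exists>i t. e = a i \<and> snd (w i) = Some t \<and> z = u i [])"
proof
  assume "zeta e = Some z"
  moreover from this obtain i where "e = a i" by (auto simp: zeta_def split: if_splits)
  ultimately show "\<exists>i t. e = a i \<and> snd (w i) = Some t \<and> z = u i []" by (auto simp: zeta_a)
qed (auto simp: zeta_a)

lemma attachment_zeta:
  assumes nc: "nonoriented_cycle (Q \<restriction> range v)"
  shows "attachment Q (range v) zeta"
proof -
  have root_notin: "u i [] \<notin> range v" if "snd (w i) = Some t" for i t
    using that u_notin_range[of "[]" i] by (simp add: opos_Some)
  have ran: "z \<in> ran zeta \<longleftrightarrow> (\<exists>i t. snd (w i) = Some t \<and> z = u i [])" for z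
    unfolding ran_def mem_Collect_eq zeta_Some by blast
  \<comment> \<open>The index belonging to a root is determined only modulo \<open>n\<close>; all
    these indices give the same set of vertices.\<close>
  define P where "P z = (\<Union>i \<in> {i. snd (w i) \<noteq> None \<and> u i [] = z}. u i ` opos (w i))" for z
  have P: "P (u i []) = u i ` opos (w i)" if t: "snd (w i) = Some t" for i t
  proof -
    have "u j ` opos (w j) = u i ` opos (w i)" if "snd (w j) \<noteq> None" "u j [] = u i []" for j
    proof -
      have "n dvd j - i" using u_eq[of "[]" j "[]" i] that t by (auto simp: opos_Some)
      then show ?thesis by (rule opos_per)
    qed
    then have "P (u i []) \<subseteq> u i ` opos (w i)" unfolding P_def by blast
    moreover have "u i ` opos (w i) \<subseteq> P (u i [])" unfolding P_def using t by blast
    ultimately show ?thesis by (rule equalityI)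
  qed
  show ?thesis
    unfolding attachment_def
  proof (intro conjI allI impI ballI)
    show "range v \<subseteq> verts Q" by auto
    show "nonoriented_cycle (Q \<restriction> range v)" by (rule nc)
    show "dom zeta \<subseteq> arcs (Q \<restriction> range v)" unfolding arcs_cycle by (auto simp: zeta_def split: if_splits)
    show "ran zeta \<subseteq> verts Q - range v"
    proof
      fix z assume "z \<in> ran zeta"
      then obtain i t where "snd (w i) = Some t" "z = u i []" using ran by blast
      then show "z \<in> verts Q - range v" using root_notin u_in_verts[of "[]" i] by (simp add: opos_Some)
    qed
    show "inj_on zeta (dom zeta)"
    proof (rule inj_onI)
      fix e e' assume "e \<in> dom zeta" "e' \<in> dom zeta" "zeta e = zeta e'"
      then obtain z where "zeta e = Some z" "zeta e' = Some z" by auto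
      then obtain i t j t' where "e = a i" "e' = a j" "snd (w i) = Some t" "snd (w j) = Some t'"
        "z = u i []" "z = u j []" unfolding zeta_Some by blast
      then show "e = e'" using u_eq[of "[]" i "[]" j] by (simp add: opos_Some a_eq)
    qed
  next
    fix e z assume "zeta e = Some z"
    then obtain i t where i: "e = a i" "snd (w i) = Some t" "z = u i []" unfolding zeta_Some by blast
    have ex1: "\<exists>!b. b \<in> arcs Q \<and> arc_to_ends Q b = x" if x: "x \<in> spokes w v u i" for x
    proof -
      obtain b where b: "b \<in> arcs Q" "arc_to_ends Q b = x" using x by (rule spoke_arc)
      have "b' = b" if "b' \<in> arcs Q" "arc_to_ends Q b' = x" for b'
        by (rule spoke_unique[of b' b i]) (simp_all add: that b x)
      then show ?thesis using b by blast
    qed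
    show "\<exists>!b. b \<in> arcs Q \<and> arc_to_ends Q b = (head Q e, z)" "\<exists>!b. b \<in> arcs Q \<and> arc_to_ends Q b = (z, tail Q e)"
      using ex1[of "(tgt w v i, u i [])"] ex1[of "(u i [], src w v i)"] i
      by (simp_all add: head_a tail_a spokes_def)
  next
    fix e assume e: "e \<in> arcs Q" "tail Q e \<in> range v \<or> head Q e \<in> range v"
    show "e \<in> arcs (Q \<restriction> range v) \<or> (\<exists>b z. zeta b = Some z \<and>
        (arc_to_ends Q e = (head Q b, z) \<or> arc_to_ends Q e = (z, tail Q b)))"
    proof (cases "e \<in> range a")
      case False
      then obtain i where "arc_to_ends Q e \<in> spokes w v u i" using nonbase e(1) by blast
      then show ?thesis
      proof (cases rule: spokes_cases)
        case (into t)
        then show ?thesis by (intro disjI2 exI[of _ "a i"] exI[of _ "u i []"]) (simp add: zeta_a head_a)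
      next
        case (out t)
        then show ?thesis by (intro disjI2 exI[of _ "a i"] exI[of _ "u i []"]) (simp add: zeta_a tail_a)
      next
        case (inner t p q)
        then have "p \<in> opos (w i)" "q \<in> opos (w i)" using edges_in_pos by (auto simp: opos_Some)
        then show ?thesis using e(2) inner(3) u_notin_range by (auto simp: arc_to_ends_def)
      qed
    qed (use arcs_cycle in blast)
  next
    have Pdisj: "disjoint_family_on P (ran zeta)"
      unfolding disjoint_family_on_def
    proof (intro ballI impI)
      fix z z' assume "z \<in> ran zeta" "z' \<in> ran zeta" and ne: "z \<noteq> z'"
      then obtain i t j t' where ij: "snd (w i) = Some t" "z = u i []" "snd (w j) = Some t'" "z' = u j []"
        using ran by metis
      then have "\<not> n dvd i - j" using ne u_per by metis
      then have "u i ` opos (w i) \<inter> u j ` opos (w j) = {}" using u_eq by blast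
      then show "P z \<inter> P z' = {}" using P ij by metis
    qed
    have tree: "u i p \<in> (\<Union>z\<in>ran zeta. P z)" if "p \<in> opos (w i)" for i p
    proof -
      have "\<exists>t. snd (w i) = Some t" using that by (cases "snd (w i)") (auto simp: opos_def)
      then obtain t where t: "snd (w i) = Some t" ..
      then have "u i [] \<in> ran zeta" using ran by blast
      then show ?thesis using P[OF t] that by blast
    qed
    have Psub: "P z \<subseteq> verts Q - range v" for z
      unfolding P_def by (intro UN_least image_subsetI DiffI u_in_verts u_notin_range)
    have "(\<Union>z\<in>ran zeta. P z) = verts Q - range v"
    proof
      show "(\<Union>z\<in>ran zeta. P z) \<subseteq> verts Q - range v" using Psub by (rule UN_least)
      show "verts Q - range v \<subseteq> (\<Union>z\<in>ran zeta. P z)"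
      proof
        fix x assume "x \<in> verts Q - range v"
        then obtain i p where "p \<in> opos (w i)" "x = u i p" by (auto elim!: verts_cases)
        then show "x \<in> (\<Union>z\<in>ran zeta. P z)" using tree by blast
      qed
    qed
    moreover have "(\<Union>z\<in>ran zeta. arcs (Q \<restriction> P z)) = arcs (Q \<restriction> (verts Q - range v))"
    proof (intro equalityI subsetI)
      fix e assume e: "e \<in> arcs (Q \<restriction> (verts Q - range v))"
      then have "e \<notin> range a" using base_ends_range by auto
      then obtain i where "arc_to_ends Q e \<in> spokes w v u i" using nonbase e by auto
      then show "e \<in> (\<Union>z\<in>ran zeta. arcs (Q \<restriction> P z))"
      proof (cases rule: spokes_cases)
        case (inner t p q)
        then have "u i p \<in> P (u i [])" "u i q \<in> P (u i [])" using P edges_in_pos by (auto simp: opos_Some)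
        moreover have "u i [] \<in> ran zeta" using ran inner by blast
        ultimately show ?thesis using e inner by (auto simp: arc_to_ends_def)
      qed (use e in \<open>auto simp: arc_to_ends_def\<close>)
    qed (use Psub in auto)
    moreover have "rooted_type_A (Q \<restriction> P z) z" if z: "z \<in> ran zeta" for z
    proof -
      obtain i t where i: "snd (w i) = Some t" "z = u i []" using z unfolding ran by blast
      have "P z = u i ` pos t" unfolding i(2) P[OF i(1)] opos_Some[OF i(1)] ..
      then show ?thesis using emb_rooted[OF emb[OF i(1)]] i(2) by simp
    qed
    ultimately show "\<exists>P. disjoint_family_on P (ran zeta) \<and> (\<Union>z\<in>ran zeta. P z) = verts Q - range v \<and>
        (\<Union>z\<in>ran zeta. arcs (Q \<restriction> P z)) = arcs (Q \<restriction> (verts Q - range v)) \<and>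
        (\<forall>z\<in>ran zeta. rooted_type_A (Q \<restriction> P z) z)"
      using Pdisj by blast
  qed
qed

end

section \<open>Coordinates with mirror-symmetric word\<close>

locale sym_wheel = wheel +
  assumes mirror: "w (- 1 - i) = flip (w i)"
begin

text \<open>For odd \<open>n = 2 * k + 1\<close> the reflection would fix position \<open>k\<close>
  modulo \<open>n\<close>, although it flips its letter.\<close>

lemma even_n: "even n"
proof (rule ccontr)
  assume "odd n"
  then obtain k where k: "n = 2 * k + 1" by (auto elim: oddE)
  have "w (- 1 - k) = w k" 
  proof (rule w_per)
    have "- 1 - k - k = - n" by (simp add: k)
    then show "n dvd - 1 - k - k" by simp
  qed
  then show False using mirror[of k] by simp
qed

text \<open>A base arrow and its mirror image point in opposite directions round the cycle.\<close>

lemma nonoriented: "nonoriented_cycle (Q \<restriction> range v)"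
proof -
  interpret c: cyc "Q \<restriction> range v" n v a by (rule cycle)
  obtain i j where "fst (w i)" "\<not> fst (w j)" using mirror[of 0] by (cases "fst (w 0)") (metis flip_simps(4))+
  then show ?thesis using c.nonoriented_cycle[of i j] by (simp add: tail_a head_a src_def tgt_def)
qed

text \<open>Arrows at tree vertices are handled by \<open>edges_asym\<close> and the shape of the
  spokes. On the base cycle, opposite arrows between the same vertices could only occur for
  \<open>n = 2\<close>, where mirror symmetry makes the two arrows parallel.\<close>

lemma no_2_cycle: "(x, y) \<in> arcs_ends Q \<Longrightarrow> (y, x) \<in> arcs_ends Q \<Longrightarrow> False"
proof -
  assume xy: "(x, y) \<in> arcs_ends Q" and yx: "(y, x) \<in> arcs_ends Q"
  have at_tree: False if x: "x = u i p" "p \<in> opos (w i)" "snd (w i) = Some t"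
    and xy: "(x, y) \<in> arcs_ends Q" and yx: "(y, x) \<in> arcs_ends Q" for i p t x y
  proof -
    have s: "(u i p, y) \<in> spokes w v u i" "(y, u i p) \<in> spokes w v u i"
      using dominates_touch[OF x(2) xy] dominates_touch[OF x(2) yx] x by auto
    from s(1) x(2,3) show False
    proof (cases rule: spokes_out)
      case src
      from s(2) x(2,3) show False
      proof (cases rule: spokes_in)
        case tgt
        then show False using src src_neq_tgt by simp
      next
        case (inner q)
        then show False using src edges_in_pos[of q p t] u_notin_range[of q i] x(3) src_in_range[of i] by (simp add: opos_Some)
      qed
    next
      case (inner q)
      note q = inner(3)
      from s(2) x(2,3) show False
      proof (cases rule: spokes_in)
        case tgt
        then show False using inner u_notin_range[OF q] tgt_in_range[of i] by simp
      next
        case (inner q')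
        then have "q' = q" using u_eq[OF q, of q' i] inner \<open>y = u i q\<close> by simp
        then show False using inner \<open>(p, q) \<in> edges t\<close> edges_asym by blast
      qed
    qed
  qed
  have "x \<in> verts Q" "y \<in> verts Q" using xy wf wf_digraph.adj_in_verts by metis+
  have opos_obtain: "\<exists>t. snd (w i) = Some t" if "p \<in> opos (w i)" for i p
    using that by (cases "snd (w i)") (auto simp: opos_def)
  from \<open>x \<in> verts Q\<close> show False
  proof (cases rule: verts_cases)
    case (tree i p)
    then show False using at_tree[of x i p _ y] opos_obtain xy yx by blast
  next
    case x: (cycle i)
    from \<open>y \<in> verts Q\<close> show False
    proof (cases rule: verts_cases)
      case (tree i p)
      then show False using at_tree[of y i p _ x] opos_obtain xy yx by blast
    next
      case (cycle j)
      have r: "x \<in> range v" "y \<in> range v" using x cycle by auto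
      obtain i where i: "x = src w v i" "y = tgt w v i" using dominates_base[OF xy r] .
      obtain j where j: "y = src w v j" "x = tgt w v j" using dominates_base[OF yx r(2,1)] .
      have "{v i, v (i + 1)} = {v j, v (j + 1)}" using i j src_tgt[of i] src_tgt[of j] by auto
      then have "(v i = v j) \<or> (v i = v (j + 1) \<and> v (i + 1) = v j)" by (auto simp: doubleton_eq_iff)
      then show False
      proof
        assume "v i = v j"
        then have "n dvd i - j" by (simp add: v_eq)
        then show False using src_per[of i j] i j src_neq_tgt[of j] by simp
      next
        \<comment> \<open>Here \<open>n\<close> divides 2, and \<open>i\<close> and \<open>j\<close>
          are mirror images modulo \<open>n\<close>. The flip of the letter compensates the exchange
          of the ends, so both arrows have the same source.\<close>
        assume eq: "v i = v (j + 1) \<and> v (i + 1) = v j"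
        then have d: "n dvd i - (j + 1)" "n dvd i + 1 - j" by (simp_all add: v_eq)
        then have "n dvd 2" using dvd_diff[OF d(2,1)] by simp
        then have "n dvd 2 * (j + 1) + (i - (j + 1))" using d(1) by (intro dvd_add dvd_mult2)
        moreover have "2 * (j + 1) + (i - (j + 1)) = - (- 1 - j - i)" by simp
        ultimately have "n dvd - 1 - j - i" by (metis dvd_minus_iff)
        then have "w i = flip (w j)" using w_per[of "- 1 - j" i] mirror[of j] by simp
        then have "src w v i = src w v j" using eq by (simp add: src_def)
        then show False using i j src_neq_tgt[of i] by simp
      qed
    qed
  qed
qed

lemma quiver: "quiver Q"
  unfolding quiver_def using fin connected loopfree no_2_cycle by blast

definition tri :: "int \<Rightarrow> 'a set set" where
  "tri i = (case snd (w i) of None \<Rightarrow> {}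
     | Some t \<Rightarrow> insert {v i, v (i + 1), u i []} (image (u i) ` cyc3 (edges t)))"

lemma tri_per: "n dvd i - j \<Longrightarrow> tri i = tri j"
  using w_per[of i j] u_per[of i j] v_per[of i j] v_per[of "i + 1" "j + 1"] by (simp add: tri_def split: option.split)

lemma tri_root: "snd (w i) = Some t \<Longrightarrow> {u i [], src w v i, tgt w v i} \<in> tri i"
  using src_tgt[of i] by (simp add: tri_def insert_commute)

text \<open>The spokes lead from the target of the base arrow to the root and from there to its
  source. So the other two vertices are both on the cycle, which gives the triangle at the root, or
  both in the tree; a mixed triangle would need a connecting arrow in the wrong direction.\<close>

lemma triangle_tree:
  assumes x: "x = u i p" "p \<in> opos (w i)" and R: "(x, y) \<in> arcs_ends Q" "(y, z) \<in> arcs_ends Q" "(z, x) \<in> arcs_ends Q"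
  shows "{x, y, z} \<in> tri i"
proof -
    obtain t where t: "snd (w i) = Some t" using x(2) by (rule oposE)
  have s: "(u i p, y) \<in> spokes w v u i" "(z, u i p) \<in> spokes w v u i"
    using dominates_touch[OF x(2) R(1)] dominates_touch[OF x(2) R(3)] x by auto
  from s(1) x(2) t show ?thesis
  proof (cases rule: spokes_out)
    case src
    from s(2) x(2) t show ?thesis
    proof (cases rule: spokes_in)
      case tgt
      then show ?thesis using src x tri_root[OF t] by simp
    next
      case (inner q)
      note q = inner(3)
      have "(y, u i q) \<in> spokes w v u i" using dominates_touch[OF q R(2)] inner by simp
      from this q t show ?thesis
      proof (cases rule: spokes_in)
        case tgt
        then show ?thesis using src src_neq_tgt by simp
      next
        case (inner q')
        then show ?thesis using inner src u_notin_range[of q' i] src_in_range[of i] by simp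
      qed
    qed
  next
    case (inner q)
    note q = inner(3)
    have yz: "(u i q, z) \<in> spokes w v u i" using dominates_touch[OF q R(2)] inner by simp
    from s(2) x(2) t show ?thesis
    proof (cases rule: spokes_in)
      case tgt
      from yz q t show ?thesis
      proof (cases rule: spokes_out)
        case src
        then show ?thesis using tgt src_neq_tgt by metis
      next
        case (inner q')
        then show ?thesis using inner tgt u_notin_range[of q' i] tgt_in_range[of i] by simp
      qed
    next
      case r: (inner r)
      note ro = r(3)
      have "(q, r) \<in> edges t"
        using yz q t
      proof (cases rule: spokes_out)
        case src
        then show ?thesis using r u_notin_range[OF ro] src_in_range[of i] by simp
      next
        case (inner r')
        then show ?thesis using inner r u_eq[OF ro, of r' i] by simp
      qed
      then have "{p, q, r} \<in> cyc3 (edges t)" using \<open>(p, q) \<in> edges t\<close> r by (intro cyc3I)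
      moreover have "{x, y, z} = u i ` {p, q, r}" using x inner r by simp
      ultimately have "{x, y, z} \<in> image (u i) ` cyc3 (edges t)" by (simp only: imageI)
      then show ?thesis using t by (simp only: tri_def option.case insertI2)
    qed
  qed
qed

text \<open>Stated with an odd \<open>s\<close> for a parity argument: three base arrows never close
  up, as \<open>n\<close> is even.\<close>

lemma base_step:
  assumes "(v i, y) \<in> arcs_ends Q" "y \<in> range v"
  obtains s where "odd s" "y = v (i + s)"
proof -
  obtain j where j: "v i = src w v j" "y = tgt w v j" using dominates_base[OF assms(1) _ assms(2)] by blast
  show thesis
  proof (cases "fst (w j)")
    case True
    then have "v i = v j" "y = v (j + 1)" using j by (simp_all add: src_def tgt_def)
    then have "y = v (i + 1)" by (simp add: v_eq dvd_diff_commute)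
    then show thesis using that[of 1] by simp
  next
    case False
    then have "v i = v (j + 1)" "y = v j" using j by (simp_all add: src_def tgt_def)
    then have "y = v (i + - 1)" by (simp add: v_eq dvd_diff_commute algebra_simps)
    then show thesis using that[of "- 1"] by simp
  qed
qed

text \<open>Parity excludes 3-cycles inside the base cycle. Any other one contains a tree vertex and
  can be rotated so as to start there.\<close>

lemma oriented_3_cycles_eq: "oriented_3_cycles Q = (\<Union>i. tri i)"
proof (intro equalityI subsetI)
  fix c assume "c \<in> oriented_3_cycles Q"
  then obtain x y z where c: "c = {x, y, z}" and R: "(x, y) \<in> arcs_ends Q" "(y, z) \<in> arcs_ends Q" "(z, x) \<in> arcs_ends Q"
    unfolding oriented_3_cycles_def by blast
  have V: "x \<in> verts Q" "y \<in> verts Q" "z \<in> verts Q" using R wf wf_digraph.adj_in_verts by metis+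
  have "\<exists>i. {x, y, z} \<in> tri i"
  proof (cases "x \<in> range v \<and> y \<in> range v \<and> z \<in> range v")
    case True
    then obtain i where i: "x = v i" by blast
    then obtain s1 where s1: "odd s1" "y = v (i + s1)" using base_step R(1) True by metis
    then obtain s2 where s2: "odd s2" "z = v (i + s1 + s2)" using base_step R(2) True by metis
    then obtain s3 where s3: "odd s3" "x = v (i + s1 + s2 + s3)" using base_step R(3) True by metis
    then have "n dvd i + s1 + s2 + s3 - i" using i by (metis v_eq)
    then have "even (i + s1 + s2 + s3 - i)" using even_n by (rule dvd_trans[rotated])
    then show ?thesis using s1(1) s2(1) s3(1) by simp
  next
    case False
    then consider "x \<notin> range v" | "y \<notin> range v" | "z \<notin> range v" by blast
    then show ?thesis
    proof cases
      case 1
      then obtain i p where "x = u i p" "p \<in> opos (w i)" using V by (auto elim!: verts_cases)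
      then show ?thesis using triangle_tree[OF _ _ R] by blast
    next
      case 2
      then obtain i p where "y = u i p" "p \<in> opos (w i)" using V by (auto elim!: verts_cases)
      then have "{y, z, x} \<in> tri i" using triangle_tree[OF _ _ R(2,3,1)] by blast
      then show ?thesis by (auto simp: insert_commute)
    next
      case 3
      then obtain i p where "z = u i p" "p \<in> opos (w i)" using V by (auto elim!: verts_cases)
      then have "{z, x, y} \<in> tri i" using triangle_tree[OF _ _ R(3,1,2)] by blast
      then show ?thesis by (auto simp: insert_commute)
    qed
  qed
  then show "c \<in> (\<Union>i. tri i)" using c by blast
next
  fix c assume "c \<in> (\<Union>i. tri i)"
  then obtain i where c: "c \<in> tri i" by blast
  then obtain t where t: "snd (w i) = Some t" by (auto simp: tri_def split: option.splits)
  from c t consider "c = {v i, v (i + 1), u i []}" | d where "d \<in> cyc3 (edges t)" "c = u i ` d"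
    by (auto simp: tri_def)
  then show "c \<in> oriented_3_cycles Q"
  proof cases
    case 1
    then have "c = {src w v i, tgt w v i, u i []}" using src_tgt[of i] by auto
    moreover have "(tgt w v i, u i []) \<in> arcs_ends Q" "(u i [], src w v i) \<in> arcs_ends Q"
      using t by (auto intro!: spokes_dominates[of _ i] simp: spokes_def)
    ultimately show ?thesis unfolding oriented_3_cycles_def using base_dominates[of i] by blast
  next
    case 2
    from 2(1) obtain p q r where pqr: "d = {p, q, r}" "(p, q) \<in> edges t" "(q, r) \<in> edges t" "(r, p) \<in> edges t"
      by (rule cyc3E)
    have "(u i p, u i q) \<in> arcs_ends Q" if "(p, q) \<in> edges t" for p q
      using that t by (intro spokes_dominates[of _ i]) (force simp: spokes_def)
    from this[OF pqr(2)] this[OF pqr(3)] this[OF pqr(4)] have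
      "{u i p, u i q, u i r} \<in> oriented_3_cycles Q"
      unfolding oriented_3_cycles_def by blast
    then show ?thesis using 2(2) pqr(1) by simp
  qed
qed

text \<open>Every set in \<open>tri i\<close> contains a vertex of the tree at position
  \<open>i\<close>, so different positions modulo \<open>n\<close> contribute different
  sets.\<close>

lemma card_oriented_3_cycles: "card (oriented_3_cycles Q) = (\<Sum>i\<in>{0..<n}. ltri (w i))"
proof -
  have fin: "finite (tri i)" for i by (auto simp: tri_def finite_cyc3_edges split: option.split)
  have sub: "c \<subseteq> range v \<union> u i ` opos (w i) \<and> c \<inter> u i ` opos (w i) \<noteq> {}" if c: "c \<in> tri i" for c i
  proof -
    from c obtain t where t: "snd (w i) = Some t" by (auto simp: tri_def split: option.splits)
    from c t consider "c = {v i, v (i + 1), u i []}" | d where "d \<in> cyc3 (edges t)" "c = u i ` d"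
      by (auto simp: tri_def)
    then show ?thesis
    proof cases
      case 1
      then show ?thesis using t by (auto simp: opos_Some)
    next
      case 2
      then have "d \<subseteq> opos (w i)" using cyc3_edges_subset t by (auto simp: opos_Some)
      moreover have "d \<noteq> {}" using 2(1) by (auto elim!: cyc3E)
      ultimately show ?thesis using 2(2) by blast
    qed
  qed
  have "card (\<Union>i. tri i) = (\<Sum>i\<in>{0..<n}. card (tri i))"
  proof (rule sum_UN_card[OF fin tri_per])
    fix i j c assume c: "c \<in> tri i" "c \<in> tri j"
    obtain p where p: "p \<in> opos (w i)" "u i p \<in> c" using sub[OF c(1)] by blast
    then obtain q where "q \<in> opos (w j)" "u i p = u j q" using sub[OF c(2)] u_notin_range[OF p(1)] by blast
    then show "n dvd i - j" using u_eq[OF p(1)] by blast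
  qed
  moreover have "card (tri i) = ltri (w i)" for i
  proof (cases "snd (w i)")
    case (Some t)
    have inj: "inj_on (u i) (pos t)" using u_eq[of _ i _ i] Some by (auto simp: inj_on_def opos_Some)
    have "inj_on (image (u i)) (cyc3 (edges t))"
      using inj_on_image_Pow[OF inj] cyc3_edges_subset by (rule inj_on_subset)
    then have "card (image (u i) ` cyc3 (edges t)) = ttri t" by (simp add: card_image card_cyc3_edges)
    moreover have "{v i, v (i + 1), u i []} \<notin> image (u i) ` cyc3 (edges t)"
    proof
      assume "{v i, v (i + 1), u i []} \<in> image (u i) ` cyc3 (edges t)"
      then obtain d where d: "d \<in> cyc3 (edges t)" "{v i, v (i + 1), u i []} = u i ` d" by blast
      have "v i \<in> u i ` d" unfolding d(2)[symmetric] by simp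
      then have "v i \<in> u i ` opos (w i)" using d(1) cyc3_edges_subset[of t] Some by (auto simp: opos_Some)
      then show False using cycle_tree_disjoint by blast
    qed
    ultimately show ?thesis using Some by (simp add: tri_def ltri_def finite_cyc3_edges)
  qed (simp add: tri_def ltri_def)
  ultimately show ?thesis unfolding oriented_3_cycles_eq by simp
qed

lemma in_quivers_A_tilde:
  assumes "card (verts Q) = Suc m"
  shows "Q \<in> quivers_A_tilde m"
proof -
  have "\<exists>!C. C \<subseteq> verts Q \<and> nonoriented_cycle (Q \<restriction> C)"
    using nonoriented unique_cycle by (intro ex1I[of _ "range v"]) auto
  then show ?thesis
    unfolding quivers_A_tilde_def using quiver assms attachment_zeta[OF nonoriented] by blast
qed

text \<open>The reflection in vertex 0 gives a second coordinate system with the same word, and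
  \<open>wheel_iso\<close> turns it into an automorphism reversing the cycle.\<close>

lemma symmetric: "symmetric_quiver Q"
proof -
  have n: "n > 0" using two_le by simp
  let ?T = "(lst n v, lst n a)"
  have setT: "set (fst ?T) = range v" using set_lst[of n v] v_per n by simp
  have "(\<lambda>i. flip (w (0 - 1 - i))) = w" by (rule ext) (simp add: mirror)
  then have rev: "wheel Q n w (\<lambda>i. v (- i)) (\<lambda>i. a (- 1 - i)) (\<lambda>i. u (- 1 - i))"
    using wheel_reversal[of 0] by simp
  obtain \<phi> where \<phi>: "pre_digraph.digraph_isomorphism Q \<phi>" "app_iso \<phi> Q = Q"
    "\<And>i. iso_verts \<phi> (v i) = v (- i)" "\<And>i. iso_arcs \<phi> (a i) = a (- 1 - i)"
    "\<And>i p. p \<in> opos (w i) \<Longrightarrow> iso_verts \<phi> (u i p) = u (- 1 - i) p"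
    using wheel_iso[OF wheel_axioms rev] by metis
  have "realization Q zeta ?T"
    unfolding realization_def setT using attachment_zeta[OF nonoriented] cyc.traversal[OF cycle] by simp
  moreover have "same_realization Q zeta ?T Q zeta (reverse_traversal ?T)"
    unfolding same_realization_def setT
  proof (intro exI[of _ \<phi>] conjI ballI)
    fix e assume "e \<in> arcs (Q \<restriction> range v)"
    then obtain i where e: "e = a i" unfolding arcs_cycle by blast
    show "zeta (iso_arcs \<phi> e) = map_option (iso_verts \<phi>) (zeta e)"
      unfolding e \<phi>(4) zeta_a mirror flip_simps
      by (cases "snd (w i)") (simp_all add: \<phi>(5) opos_Some)
  next
    have "map (iso_verts \<phi>) (lst n v) = lst n (\<lambda>i. v (- i))" "map (iso_arcs \<phi>) (lst n a) = lst n (\<lambda>i. a (- 1 - i))"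
      by (simp_all add: map_lst o_def \<phi>)
    then show "same_direction (map (iso_verts \<phi>) (fst ?T), map (iso_arcs \<phi>) (snd ?T)) (reverse_traversal ?T)"
      using reverse_traversal_lst[of n v a, OF v_per a_per n]
      by (simp add: same_direction_def) (rule exI[of _ 0], simp)
  qed (rule \<phi>)+
  ultimately show ?thesis unfolding symmetric_quiver_def by blast
qed

end

section \<open>Coordinates of a given symmetric quiver\<close>

text \<open>The direction of a base arrow is visible in \<open>Q\<close>, and a tree is determined
  by its root through \<open>emb_unique\<close>.\<close>

lemma wheel_word_eq:
  assumes "wheel Q n w v a u" "wheel Q n w' v a u'"
    and roots: "\<And>i. map_option (\<lambda>_. u i []) (snd (w i)) = map_option (\<lambda>_. u' i []) (snd (w' i))"
  shows "w = w'"
proof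
  fix i
  interpret A: wheel Q n w v a u by fact
  interpret B: wheel Q n w' v a u' by fact
  have "src w v i = src w' v i" using A.base B.base by (metis prod.inject)
  then have "fst (w i) = fst (w' i)" using A.v_Suc[of i] by (auto simp: src_def split: if_splits)
  moreover have "snd (w i) = snd (w' i)"
  proof (cases "snd (w i)")
    case None
    then show ?thesis using roots[of i] by (cases "snd (w' i)") auto
  next
    case (Some t)
    then obtain t' where t': "snd (w' i) = Some t'" "u i [] = u' i []"
      using roots[of i] by (cases "snd (w' i)") auto
    then show ?thesis using emb_unique[OF A.emb[OF Some] B.emb[OF t'(1)] t'(2)] Some by simp
  qed
  ultimately show "w i = w' i" by (rule prod_eqI)
qed

text \<open>An attached root has neighbours on the cycle on both sides, and only a root of the other
  coordinate system has such arrows. They recover the ends of its base arrow, but not the arrow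
  itself when \<open>n = 2\<close>.\<close>

lemma wheel_same_roots:
  assumes "wheel Q n w v a u" "wheel Q n w' v a u'" and t: "snd (w i) = Some t"
  obtains j where "snd (w' j) = Some t" "u i [] = u' j []" "{v i, v (i + 1)} = {v j, v (j + 1)}"
proof -
  interpret A: wheel Q n w v a u by fact
  interpret B: wheel Q n w' v a u' by fact
  have s: "(tgt w v i, u i []) \<in> arcs_ends Q" "(u i [], src w v i) \<in> arcs_ends Q"
    using t by (auto intro!: A.spokes_dominates[of _ i] simp: spokes_def)
  have o: "[] \<in> opos (w i)" using t by (simp add: opos_Some)
  have "u i [] \<in> verts Q" using o by (rule A.u_in_verts)
  then obtain j p where jp: "p \<in> opos (w' j)" "u i [] = u' j p"
    using A.u_notin_range[OF o] by (auto elim!: B.verts_cases)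
  have "\<exists>t'. snd (w' j) = Some t'" using jp(1) by (cases "snd (w' j)") (auto simp: opos_def)
  then obtain t' where t': "snd (w' j) = Some t'" ..
  have notr: "u' j q \<notin> range v" if "(q, p) \<in> edges t' \<or> (p, q) \<in> edges t'" for q
    using that edges_in_pos t' by (intro B.u_notin_range) (auto simp: opos_Some)
  have "(u' j p, src w v i) \<in> spokes w' v u' j" "(tgt w v i, u' j p) \<in> spokes w' v u' j"
    using B.dominates_touch[OF jp(1) s(1)] B.dominates_touch[OF jp(1) s(2)] jp(2) by simp_all
  then have p: "p = []" "src w v i = src w' v j" "tgt w v i = tgt w' v j"
    using B.spokes_out[OF _ jp(1) t'] B.spokes_in[OF _ jp(1) t'] notr A.src_in_range A.tgt_in_range by metis+
  then have vv: "{v i, v (i + 1)} = {v j, v (j + 1)}"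
    using A.src_tgt[of i] B.src_tgt[of j] by simp
  have "t = t'"
    by (rule emb_unique[OF A.emb[OF t] B.emb[OF t', folded vv]]) (simp add: jp(2) p(1))
  then show thesis using that t' jp(2) p(1) vv by blast
qed

lemma sym_wheel_word:
  assumes "sym_wheel Q n w v a u"
  obtains S where "S \<noteq> []" "n = 2 * int (length S)" "w = word S"
proof -
  interpret sym_wheel Q n w v a u by fact
  obtain m' where m': "n = 2 * m'" using even_n by blast
  define m where "m = nat m'"
  have m: "n = 2 * int m" "m > 0" using two_le m' by (simp_all add: m_def)
  show thesis
  proof (rule that)
    show "w = word (map (\<lambda>i. w (int i)) [0..<m])"
    proof -
      have "w (i + 2 * int m) = w i" for i by (rule w_per) (simp add: m)
      then show ?thesis using word_determined[of w m] mirror m(2) by simp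
    qed
  qed (use m in auto)
qed

lemma sum_word:
  fixes f :: "letter \<Rightarrow> nat"
  assumes "\<And>x. f (flip x) = f x"
  shows "(\<Sum>i\<in>{0..<2 * int (length S)}. f (word S i)) = 2 * sum_list (map f S)"
proof -
  let ?m = "int (length S)"
  have "{0..<2 * ?m} = {0..<?m} \<union> {?m..<2 * ?m}" by auto
  then have "(\<Sum>i\<in>{0..<2 * ?m}. f (word S i)) = (\<Sum>i\<in>{0..<?m}. f (word S i)) + (\<Sum>i\<in>{?m..<2 * ?m}. f (word S i))"
    by (simp add: sum.union_disjoint)
  also have "(\<Sum>i\<in>{?m..<2 * ?m}. f (word S i)) = (\<Sum>i\<in>{0..<?m}. f (word S i))"
    by (rule sum.reindex_bij_witness[of _ "\<lambda>i. 2 * ?m - 1 - i" "\<lambda>i. 2 * ?m - 1 - i"])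
      (auto simp: word_def Let_def assms)
  also have "(\<Sum>i\<in>{0..<?m}. f (word S i)) = (\<Sum>i\<in>{0..<length S}. f (word S (int i)))"
    by (rule sum.reindex_bij_witness[of _ int nat]) auto
  also have "\<dots> = sum_list (map f S)"
    by (simp add: sum_list_sum_nth word_nth)
  finally show ?thesis by simp
qed

text \<open>Both systems traverse the same cycle, so after a shift, with a reflection absorbed by
  the mirror symmetry, they may be assumed to use the same vertices and arrows of it. What remains
  is to compare the attached trees, and here a double arrow behaves differently.\<close>

lemma sym_wheel_unique:
  assumes "sym_wheel Q n w v a u" "sym_wheel Q n' w' v' a' u'"
  shows "n' = n" "\<exists>j. \<forall>i. w' i = w (i + j)"
proof -
  interpret A: sym_wheel Q n w v a u by fact
  interpret B: sym_wheel Q n' w' v' a' u' by fact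
  have "range v' \<subseteq> verts Q" by auto
  then have C: "range v' = range v" using A.unique_cycle[OF _ B.nonoriented] by blast
  interpret c: cyc "Q \<restriction> range v" n v a by (rule A.cycle)
  have c': "cyc (Q \<restriction> range v) n' v' a'" using B.cycle C by simp
  show n: "n' = n" by (rule c.dihedral(1)[OF c'])
  have "\<exists>j u''. wheel Q n (\<lambda>i. w (i + j)) v' a' u''"
  proof -
    obtain k where k: "(\<forall>i. v' i = v (i + k) \<and> a' i = a (i + k)) \<or> (\<forall>i. v' i = v (k - i) \<and> a' i = a (k - 1 - i))"
      using c.dihedral(2)[OF c'] by blast
    then show ?thesis
    proof
      assume "\<forall>i. v' i = v (i + k) \<and> a' i = a (i + k)"
      then have "v' = (\<lambda>i. v (i + k))" "a' = (\<lambda>i. a (i + k))" by auto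
      then show ?thesis using A.wheel_shift by blast
    next
      assume "\<forall>i. v' i = v (k - i) \<and> a' i = a (k - 1 - i)"
      then have "v' = (\<lambda>i. v (k - i))" "a' = (\<lambda>i. a (k - 1 - i))" by auto
      \<comment> \<open>Reversing a mirror-symmetric word gives a shift of it.\<close>
      moreover have "flip (w (k - 1 - i)) = w (i + - k)" for i
        using A.mirror[of "k - 1 - i"] by (simp add: algebra_simps)
      then have "(\<lambda>i. flip (w (k - 1 - i))) = (\<lambda>i. w (i + - k))" by (rule ext)
      ultimately show ?thesis using A.wheel_reversal[of k] by metis
    qed
  qed
  then obtain j u'' where D: "wheel Q n (\<lambda>i. w (i + j)) v' a' u''" by blast
  have E: "wheel Q n w' v' a' u'" using B.wheel_axioms n by simp
  show "\<exists>j. \<forall>i. w' i = w (i + j)"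
  proof (cases "n = 2")
    case True
    \<comment> \<open>Modulo 2 the reflection \<open>- 1 - i\<close> is the shift
      \<open>i + 1\<close>; so both arrows carry the same tree or none, and it does not matter which
      root is assigned to which of them.\<close>
    have alt: "w (i + 1) = flip (w i)" "w' (i + 1) = flip (w' i)" for i
    proof -
      have "n dvd i + 1 - (- 1 - i)" by (simp add: True)
      then have "w (i + 1) = w (- 1 - i)" "w' (i + 1) = w' (- 1 - i)"
        using A.w_per B.w_per n by blast+
      then show "w (i + 1) = flip (w i)" "w' (i + 1) = flip (w' i)" using A.mirror B.mirror by simp_all
    qed
    have alt': "w (i - 1) = flip (w i)" "w' (i - 1) = flip (w' i)" for i
      using alt[of "i - 1"] by simp_all
    have snd: "snd (w i) = snd (w 0)" "snd (w' i) = snd (w' 0)" for i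
      by (induction i rule: int_induct[of _ 0]) (simp_all add: alt alt')
    have "snd (w 0) = snd (w' 0)"
    proof (cases "snd (w 0)")
      case (Some t)
      then have "snd (w (0 + j)) = Some t" using snd(1) by metis
      then show ?thesis using wheel_same_roots[OF D E, of 0 t] snd(2) Some by metis
    next
      case None
      show ?thesis
      proof (cases "snd (w' 0)")
        case (Some t)
        then show ?thesis using wheel_same_roots[OF E D Some] snd(1) None by (metis option.distinct(1))
      qed (simp add: None)
    qed
    \<comment> \<open>With equal trees only the orientation is left open, and the two letters of
      \<open>w\<close> realize both possibilities.\<close>
    then have "w' 0 = w 0 \<or> w' 0 = w (0 + 1)" unfolding alt by (auto simp: prod_eq_iff)
    then obtain l where l: "w' 0 = w l" by blast
    have "w' i = w (i + l)" for i
    proof (induction i rule: int_induct[of _ 0])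
      case base
      then show ?case using l by simp
    next
      case (step1 i)
      then show ?case using alt(1)[of "i + l"] alt(2)[of i] by (simp add: algebra_simps)
    next
      case (step2 i)
      then show ?case using alt'(1)[of "i + l"] alt'(2)[of i] by (simp add: algebra_simps)
    qed
    then show ?thesis by blast
  next
    case False
    then have n3: "n > 2" using A.two_le by simp
    \<comment> \<open>For \<open>n > 2\<close> a base arrow is determined by its two ends, so roots
      are matched at the same position.\<close>
    have same: "n dvd i - k" if "{v' i, v' (i + 1)} = {v' k, v' (k + 1)}" for i k
    proof (rule ccontr)
      assume "\<not> n dvd i - k"
      then have "v' i = v' (k + 1)" "v' (i + 1) = v' k"
        using that by (auto simp: doubleton_eq_iff B.v_eq n)
      then have "n dvd i - (k + 1)" "n dvd i + 1 - k" by (simp_all add: B.v_eq n)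
      then have "n dvd (i + 1 - k) - (i - (k + 1))" by (rule dvd_diff[rotated])
      then have "n dvd 2" by simp
      then show False using n3 by (auto dest: zdvd_imp_le)
    qed
    have "(\<lambda>i. w (i + j)) = w'"
    proof (rule wheel_word_eq[OF D E])
      fix i
      have DE: "snd (w' i) = Some t \<and> u'' i [] = u' i []" if t: "snd (w (i + j)) = Some t" for t
      proof -
        obtain k where k: "snd (w' k) = Some t" "u'' i [] = u' k []" "{v' i, v' (i + 1)} = {v' k, v' (k + 1)}"
          using wheel_same_roots[OF D E t] by metis
        then have "n dvd i - k" using same by blast
        then show ?thesis using k B.w_per[of i k] B.u_per[of i k] n by simp
      qed
      moreover have ED: "snd (w (i + j)) = Some t" if t: "snd (w' i) = Some t" for t
      proof -
        obtain k where k: "snd (w (k + j)) = Some t" "{v' i, v' (i + 1)} = {v' k, v' (k + 1)}"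
          using wheel_same_roots[OF E D t] by metis
        then have "n dvd i - k" using same by blast
        then show ?thesis using k A.w_per[of "i + j" "k + j"] by simp
      qed
      ultimately show "map_option (\<lambda>_. u'' i []) (snd (w (i + j))) = map_option (\<lambda>_. u' i []) (snd (w' i))"
        by (cases "snd (w (i + j))"; cases "snd (w' i)") auto
    qed
    then show ?thesis by (metis)
  qed
qed

text \<open>Introduces coordinates along a given traversal and keeps \<zeta>. For each attached root
  any tree supplied by \<open>rooted_coordinates\<close> may be chosen; that the choice is forced is
  the content of \<open>emb_unique\<close>.\<close>

lemma attachment_wheel:
  assumes wf: "wf_digraph Q" and att: "attachment Q C \<zeta>" and cy: "cyc (Q \<restriction> C) n v a"
  obtains w u where "wheel Q n w v a u" "\<And>i. \<zeta> (a i) = map_option (\<lambda>_. u i []) (snd (w i))"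
proof -
  interpret wf_digraph Q by fact
  interpret c: cyc "Q \<restriction> C" n v a by fact
  from att have C: "C \<subseteq> verts Q" and dom: "dom \<zeta> \<subseteq> arcs (Q \<restriction> C)" and ran: "ran \<zeta> \<subseteq> verts Q - C"
    and inj: "inj_on \<zeta> (dom \<zeta>)"
    and ex1': "\<forall>b z. \<zeta> b = Some z \<longrightarrow> (\<exists>!e. e \<in> arcs Q \<and> arc_to_ends Q e = (head Q b, z)) \<and>
       (\<exists>!e. e \<in> arcs Q \<and> arc_to_ends Q e = (z, tail Q b))"
    and inc': "\<forall>e\<in>arcs Q. tail Q e \<in> C \<or> head Q e \<in> C \<longrightarrow> e \<in> arcs (Q \<restriction> C) \<or>
        (\<exists>b z. \<zeta> b = Some z \<and> (arc_to_ends Q e = (head Q b, z) \<or> arc_to_ends Q e = (z, tail Q b)))"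
    and P': "\<exists>P. disjoint_family_on P (ran \<zeta>) \<and> (\<Union>z\<in>ran \<zeta>. P z) = verts Q - C \<and>
      (\<Union>z\<in>ran \<zeta>. arcs (Q \<restriction> P z)) = arcs (Q \<restriction> (verts Q - C)) \<and>
      (\<forall>z\<in>ran \<zeta>. rooted_type_A (Q \<restriction> P z) z)"
    unfolding attachment_def by - (elim conjE, assumption)+
  have ex1: "\<exists>!e. e \<in> arcs Q \<and> arc_to_ends Q e = (head Q b, z)"
    "\<exists>!e. e \<in> arcs Q \<and> arc_to_ends Q e = (z, tail Q b)" if "\<zeta> b = Some z" for b z
    using ex1'[rule_format, OF that] by - (elim conjE, assumption)+
  have inc: "e \<in> arcs (Q \<restriction> C) \<or>
        (\<exists>b z. \<zeta> b = Some z \<and> (arc_to_ends Q e = (head Q b, z) \<or> arc_to_ends Q e = (z, tail Q b)))"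
    if "e \<in> arcs Q" "tail Q e \<in> C \<or> head Q e \<in> C" for e
    by (rule inc'[rule_format, OF that])
  from P' obtain P where P: "disjoint_family_on P (ran \<zeta>)" "(\<Union>z\<in>ran \<zeta>. P z) = verts Q - C"
      "(\<Union>z\<in>ran \<zeta>. arcs (Q \<restriction> P z)) = arcs (Q \<restriction> (verts Q - C))"
      "\<And>z. z \<in> ran \<zeta> \<Longrightarrow> rooted_type_A (Q \<restriction> P z) z" by (elim exE conjE) blast
  have rv: "range v = C" and ra: "range a = arcs (Q \<restriction> C)" using c.range_v c.range_a by simp_all
  have "\<forall>z\<in>ran \<zeta>. \<exists>tf. inj_on (snd tf) (pos (fst tf)) \<and> snd tf ` pos (fst tf) = P z \<and> snd tf [] = z \<and>
    inj_on (arc_to_ends Q) (arcs (Q \<restriction> P z)) \<and>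
    arc_to_ends Q ` arcs (Q \<restriction> P z) = map_prod (snd tf) (snd tf) ` edges (fst tf)"
  proof
    fix z assume "z \<in> ran \<zeta>"
    from rooted_coordinates[OF P(4)[OF this]] obtain t f where "inj_on f (pos t)" "f ` pos t = verts (Q \<restriction> P z)" "f [] = z"
      "inj_on (arc_to_ends (Q \<restriction> P z)) (arcs (Q \<restriction> P z))"
      "arc_to_ends (Q \<restriction> P z) ` arcs (Q \<restriction> P z) = map_prod f f ` edges t" .
    then show "\<exists>tf. inj_on (snd tf) (pos (fst tf)) \<and> snd tf ` pos (fst tf) = P z \<and> snd tf [] = z \<and>
      inj_on (arc_to_ends Q) (arcs (Q \<restriction> P z)) \<and>
      arc_to_ends Q ` arcs (Q \<restriction> P z) = map_prod (snd tf) (snd tf) ` edges (fst tf)"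
      unfolding induce_subgraph_verts induce_ends by (intro exI[of _ "(t, f)"]) (simp only: fst_conv snd_conv)
  qed
  from bchoice[OF this] obtain TF where TF: "\<forall>z\<in>ran \<zeta>. inj_on (snd (TF z)) (pos (fst (TF z))) \<and>
    snd (TF z) ` pos (fst (TF z)) = P z \<and> snd (TF z) [] = z \<and>
    inj_on (arc_to_ends Q) (arcs (Q \<restriction> P z)) \<and>
    arc_to_ends Q ` arcs (Q \<restriction> P z) = map_prod (snd (TF z)) (snd (TF z)) ` edges (fst (TF z))" ..
  define T F where "T z = fst (TF z)" and "F z = snd (TF z)" for z
  have TF': "inj_on (F z) (pos (T z))" "F z ` pos (T z) = P z" "F z [] = z" "inj_on (arc_to_ends Q) (arcs (Q \<restriction> P z))"
    "arc_to_ends Q ` arcs (Q \<restriction> P z) = map_prod (F z) (F z) ` edges (T z)" if "z \<in> ran \<zeta>" for z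
    unfolding T_def F_def using TF[rule_format, OF that] by - (elim conjE, assumption)+
  define w where "w i = (tail Q (a i) = v i, map_option T (\<zeta> (a i)))" for i
  \<comment> \<open>\<open>v 0\<close> is a dummy value: without an attached root,
    \<open>opos (w i)\<close> is empty.\<close>
  define u where "u i = (case \<zeta> (a i) of None \<Rightarrow> \<lambda>_. v 0 | Some z \<Rightarrow> F z)" for i
  have roots: "\<zeta> (a i) = map_option (\<lambda>_. u i []) (snd (w i))" for i
    using TF'(3)[OF ranI] by (cases "\<zeta> (a i)") (simp_all add: w_def u_def)
  have opos: "\<exists>z. \<zeta> (a i) = Some z \<and> z \<in> ran \<zeta> \<and> p \<in> pos (T z) \<and> u i = F z" if "p \<in> opos (w i)" for i p
    using that by (cases "\<zeta> (a i)") (auto simp: w_def u_def opos_def ranI)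
  have uP: "u i ` opos (w i) = P z" if "\<zeta> (a i) = Some z" for i z
    using that TF'(2)[OF ranI[of \<zeta> "a i" z, OF that]] by (simp add: u_def w_def opos_def)
  have uP0: "opos (w i) = {}" if "\<zeta> (a i) = None" for i using that by (simp add: w_def opos_def)
  have ran_iff: "z \<in> ran \<zeta> \<longleftrightarrow> (\<exists>i. \<zeta> (a i) = Some z)" for z
  proof
    assume "z \<in> ran \<zeta>"
    then obtain b where b: "\<zeta> b = Some z" by (auto simp: ran_def)
    then have "b \<in> range a" using dom ra by blast
    then show "\<exists>i. \<zeta> (a i) = Some z" using b by blast
  qed (auto intro: ranI)
  have PU: "(\<Union>i. u i ` opos (w i)) = verts Q - C"
  proof -
    have "(\<Union>i. u i ` opos (w i)) = (\<Union>z\<in>ran \<zeta>. P z)"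
    proof (intro equalityI subsetI)
      fix x assume "x \<in> (\<Union>i. u i ` opos (w i))"
      then obtain i where i: "x \<in> u i ` opos (w i)" by blast
      then obtain z where z: "\<zeta> (a i) = Some z" using uP0[of i] by (cases "\<zeta> (a i)") auto
      have "x \<in> P z" using i unfolding uP[OF z] .
      then show "x \<in> (\<Union>z\<in>ran \<zeta>. P z)" by (rule UN_I[OF ranI[of \<zeta> "a i" z, OF z]])
    next
      fix x assume "x \<in> (\<Union>z\<in>ran \<zeta>. P z)"
      then obtain z i where "\<zeta> (a i) = Some z" "x \<in> P z" using ran_iff by blast
      then have "x \<in> u i ` opos (w i)" using uP[of i z] by simp
      then show "x \<in> (\<Union>i. u i ` opos (w i))" by blast
    qed
    then show ?thesis using P(2) by simp
  qed
  have tl: "tail Q (a i) = src w v i" and hd: "head Q (a i) = tgt w v i" for i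
    using c.arc_ends_cases[of i] c.v_Suc[of i] by (auto simp: src_def tgt_def w_def)
  have sp: "spokes w v u i = {(head Q (a i), z), (z, tail Q (a i))} \<union> arc_to_ends Q ` arcs (Q \<restriction> P z)"
    if "\<zeta> (a i) = Some z" for i z
    using that TF'(3,5)[OF ranI[of \<zeta> "a i" z, OF that]] by (simp only: spokes_def tl hd) (simp add: w_def u_def)
  have sp0: "spokes w v u i = {}" if "\<zeta> (a i) = None" for i using that by (simp add: spokes_def w_def)
  have N: "arcs Q - range a = {e \<in> arcs Q. tail Q e \<notin> C \<or> head Q e \<notin> C}" unfolding ra by auto
  have cases: "(\<exists>b z. \<zeta> b = Some z \<and> (arc_to_ends Q e = (head Q b, z) \<or> arc_to_ends Q e = (z, tail Q b)))
     \<or> (\<exists>z\<in>ran \<zeta>. e \<in> arcs (Q \<restriction> P z))" if e: "e \<in> arcs Q - range a" for e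
  proof (cases "tail Q e \<in> C \<or> head Q e \<in> C")
    case True
    then show ?thesis using inc[of e] e unfolding ra by blast
  next
    case False
    then have "e \<in> arcs (Q \<restriction> (verts Q - C))" using e by simp
    then show ?thesis unfolding P(3)[symmetric] by blast
  qed
  have PC: "P z \<subseteq> verts Q - C" if "z \<in> ran \<zeta>" for z using that P(2) by blast
  have zP: "z \<in> P z" if "z \<in> ran \<zeta>" for z using TF'(2,3)[OF that] Nil_in_pos by (metis imageI)
  have "wheel Q n w v a u"
  proof
    show "w i = w j" "u i = u j" if "n dvd i - j" for i j
      using c.v_periodic[OF that] c.a_periodic[OF that] by (simp_all add: w_def u_def)
    show "n dvd i - j \<and> p = q" if pq: "p \<in> opos (w i)" "q \<in> opos (w j)" "u i p = u j q" for i j p q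
    proof -
      obtain z where z: "\<zeta> (a i) = Some z" "z \<in> ran \<zeta>" "p \<in> pos (T z)" "u i = F z" using opos[OF pq(1)] by blast
      obtain z' where z': "\<zeta> (a j) = Some z'" "z' \<in> ran \<zeta>" "q \<in> pos (T z')" "u j = F z'" using opos[OF pq(2)] by blast
      have "F z p \<in> P z" "F z' q \<in> P z'" using z(3) z'(3) TF'(2)[OF z(2)] TF'(2)[OF z'(2)] by blast+
      then have "F z p \<in> P z \<inter> P z'" using pq(3) z(4) z'(4) by simp
      then have "z = z'" using P(1) z(2) z'(2) by (auto simp: disjoint_family_on_def)
      then have "a i = a j" using inj_onD[OF inj, of "a i" "a j"] z(1) z'(1) by (simp add: domI)
      moreover have "p = q" using inj_onD[OF TF'(1)[OF z(2)]] pq(3) z z' \<open>z = z'\<close> by simp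
      ultimately show ?thesis by (simp add: c.a_eq)
    qed
    show "v i \<noteq> u j p" if "p \<in> opos (w j)" for i j p
    proof -
      have "u j p \<in> verts Q - C" using that PU by blast
      then show ?thesis using rv by (metis DiffD2 rangeI)
    qed
    show "verts Q = range v \<union> (\<Union>i. u i ` opos (w i))" unfolding PU rv using C by blast
    show "arc_to_ends Q (a i) = (src w v i, tgt w v i)" for i by (simp add: arc_to_ends_def tl hd)
    show "range a \<subseteq> arcs Q" unfolding ra by auto
    show "inj_on (arc_to_ends Q) (arcs Q - range a)"
    proof (rule inj_onI)
      fix e e' assume e: "e \<in> arcs Q - range a" "e' \<in> arcs Q - range a" and eq: "arc_to_ends Q e = arc_to_ends Q e'"
      from cases[OF e(1)] show "e = e'"
      proof
        assume "\<exists>b z. \<zeta> b = Some z \<and> (arc_to_ends Q e = (head Q b, z) \<or> arc_to_ends Q e = (z, tail Q b))"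
        then obtain b z where "\<zeta> b = Some z" "arc_to_ends Q e = (head Q b, z) \<or> arc_to_ends Q e = (z, tail Q b)" by blast
        then show ?thesis using ex1[of b z] e eq by (metis DiffD1)
      next
        assume "\<exists>z\<in>ran \<zeta>. e \<in> arcs (Q \<restriction> P z)"
        then obtain z where z: "z \<in> ran \<zeta>" "e \<in> arcs (Q \<restriction> P z)" by blast
        then have "e' \<in> arcs (Q \<restriction> P z)" using e(2) eq by (simp add: arc_to_ends_def)
        then show ?thesis using inj_onD[OF TF'(4)[OF z(1)] eq z(2)] by blast
      qed
    qed
    show "arc_to_ends Q ` (arcs Q - range a) = (\<Union>i. spokes w v u i)"
    proof (intro equalityI subsetI)
      fix x assume "x \<in> arc_to_ends Q ` (arcs Q - range a)"
      then obtain e where e: "e \<in> arcs Q - range a" "x = arc_to_ends Q e" by blast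
      from cases[OF e(1)] show "x \<in> (\<Union>i. spokes w v u i)"
      proof
        assume "\<exists>b z. \<zeta> b = Some z \<and> (arc_to_ends Q e = (head Q b, z) \<or> arc_to_ends Q e = (z, tail Q b))"
        then obtain b z where bz: "\<zeta> b = Some z" "arc_to_ends Q e = (head Q b, z) \<or> arc_to_ends Q e = (z, tail Q b)" by blast
        then have "b \<in> range a" using dom ra by blast
        then obtain i where "b = a i" by blast
        then have "x \<in> spokes w v u i" using sp[of i z] bz e(2) by auto
        then show ?thesis by blast
      next
        assume "\<exists>z\<in>ran \<zeta>. e \<in> arcs (Q \<restriction> P z)"
        then obtain z where z: "z \<in> ran \<zeta>" "e \<in> arcs (Q \<restriction> P z)" by blast
        then obtain i where "\<zeta> (a i) = Some z" using ran_iff by blast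
        then have "x \<in> spokes w v u i" using sp[of i z] z(2) e(2) by blast
        then show ?thesis by blast
      qed
    next
      fix x assume "x \<in> (\<Union>i. spokes w v u i)"
      then obtain i where i: "x \<in> spokes w v u i" by blast
      then obtain z where z: "\<zeta> (a i) = Some z" using sp0[of i] by (cases "\<zeta> (a i)") auto
      have zr: "z \<in> ran \<zeta>" using z by (rule ranI)
      then have zC: "z \<notin> C" using ran by blast
      from i consider "x = (head Q (a i), z)" | "x = (z, tail Q (a i))" | e where "e \<in> arcs (Q \<restriction> P z)" "x = arc_to_ends Q e"
        unfolding sp[OF z] by blast
      then show "x \<in> arc_to_ends Q ` (arcs Q - range a)"
      proof cases
        case 1
        then obtain e where e: "e \<in> arcs Q" "arc_to_ends Q e = x" using ex1(1)[OF z] by blast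
        then have "e \<in> arcs Q - range a" unfolding N using 1 zC by (auto simp: arc_to_ends_def)
        then show ?thesis using e by blast
      next
        case 2
        then obtain e where e: "e \<in> arcs Q" "arc_to_ends Q e = x" using ex1(2)[OF z] by blast
        then have "e \<in> arcs Q - range a" unfolding N using 2 zC by (auto simp: arc_to_ends_def)
        then show ?thesis using e by blast
      next
        case 3
        then have "e \<in> arcs Q - range a" unfolding N using PC[OF zr] by auto
        then show ?thesis using 3 by blast
      qed
    qed
  qed (simp_all add: c.two_le c.v_eq c.a_eq)
  then show thesis using that roots by blast
qed

text \<open>The given automorphism sends vertex \<open>i\<close> to \<open>k - i\<close> for some
  \<open>k\<close>. As it respects \<zeta>, transporting the coordinates by it and reflecting the
  indices yield systems with the same roots, hence the same word, even for a double arrow. This is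
  mirror symmetry about \<open>k\<close>, up to the choice of origin.\<close>

lemma symmetric_sym_wheel:
  assumes wf: "wf_digraph Q" and sym: "symmetric_quiver Q"
  obtains n w v a u where "sym_wheel Q n w v a u"
proof -
  from sym obtain \<zeta> vs as \<phi> where real: "realization Q \<zeta> (vs, as)"
    and \<phi>: "pre_digraph.digraph_isomorphism Q \<phi>" "app_iso \<phi> Q = Q"
      "\<And>b. b \<in> arcs (Q \<restriction> set vs) \<Longrightarrow> \<zeta> (iso_arcs \<phi> b) = map_option (iso_verts \<phi>) (\<zeta> b)"
    and dir: "same_direction (map (iso_verts \<phi>) vs, map (iso_arcs \<phi>) as) (reverse_traversal (vs, as))"
    unfolding symmetric_quiver_def same_realization_def by auto
  define C where "C = set vs"
  have att: "attachment Q C \<zeta>" and tr: "cycle_traversal (Q \<restriction> C) (vs, as)"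
    using real by (simp_all add: realization_def C_def)
  define n where "n = int (length vs)"
  obtain v a where va: "cyc (Q \<restriction> C) n v a" "vs = lst n v" "as = lst n a"
    using traversal_cyc[OF tr] unfolding n_def by blast
  interpret c: cyc "Q \<restriction> C" n v a by fact
  obtain w u where W: "wheel Q n w v a u" "\<And>i. \<zeta> (a i) = map_option (\<lambda>_. u i []) (snd (w i))"
    using attachment_wheel[OF wf att va(1)] by blast
  interpret W: wheel Q n w v a u by (rule W(1))
  have n: "n > 0" using c.two_le by simp
  have per: "iso_verts \<phi> (v i) = iso_verts \<phi> (v j)" "iso_arcs \<phi> (a i) = iso_arcs \<phi> (a j)" if "n dvd i - j" for i j
    using c.v_periodic[OF that] c.a_periodic[OF that] by simp_all
  obtain k' where "reverse_traversal (lst n v, lst n a) =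
      (rotate k' (map (iso_verts \<phi>) (lst n v)), rotate k' (map (iso_arcs \<phi>) (lst n a)))"
    using dir unfolding va(2,3) same_direction_def by (metis fst_conv snd_conv prod.collapse)
  then have eq: "lst n (\<lambda>i. v (- i)) = lst n (\<lambda>i. iso_verts \<phi> (v (i + int k')))"
    "lst n (\<lambda>i. a (- 1 - i)) = lst n (\<lambda>i. iso_arcs \<phi> (a (i + int k')))"
    unfolding reverse_traversal_lst[of n v a, OF c.v_periodic c.a_periodic n, simplified] map_lst
    using rotate_lst[of n "iso_verts \<phi> \<circ> v" k'] rotate_lst[of n "iso_arcs \<phi> \<circ> a" k'] per n by simp_all
  have "(\<lambda>i. v (- i)) = (\<lambda>i. iso_verts \<phi> (v (i + int k')))"
    by (rule lst_inject[OF eq(1) n]) (simp_all add: c.v_eq dvd_diff_commute per)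
  moreover have "(\<lambda>i. a (- 1 - i)) = (\<lambda>i. iso_arcs \<phi> (a (i + int k')))"
    by (rule lst_inject[OF eq(2) n]) (simp_all add: c.a_eq dvd_diff_commute per)
  ultimately have eqs: "v (- i) = iso_verts \<phi> (v (i + int k'))" "a (- 1 - i) = iso_arcs \<phi> (a (i + int k'))" for i
    by (simp_all add: fun_eq_iff)
  define k where "k = int k'"
  have \<phi>v: "iso_verts \<phi> (v i) = v (k - i)" and \<phi>a: "iso_arcs \<phi> (a i) = a (k - 1 - i)" for i
    using eqs(1)[of "i - k"] eqs(2)[of "i - k"] by (simp_all add: k_def algebra_simps)
  have "wheel (app_iso \<phi> Q) n w (\<lambda>i. v (k - i)) (\<lambda>i. a (k - 1 - i)) (\<lambda>i p. iso_verts \<phi> (u i p))"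
    using W.wheel_app_iso[OF \<phi>(1)] by (simp only: \<phi>v \<phi>a)
  then have W1: "wheel Q n w (\<lambda>i. v (k - i)) (\<lambda>i. a (k - 1 - i)) (\<lambda>i p. iso_verts \<phi> (u i p))"
    by (simp only: \<phi>(2))
  have "w = (\<lambda>i. flip (w (k - 1 - i)))"
  proof (rule wheel_word_eq[OF W1 W.wheel_reversal])
    fix i
    have "a i \<in> arcs (Q \<restriction> set vs)" using c.a_in_arcs by (simp only: C_def)
    then have "\<zeta> (a (k - 1 - i)) = map_option (iso_verts \<phi>) (\<zeta> (a i))" using \<phi>(3)[of "a i"] \<phi>a by simp
    then show "map_option (\<lambda>_. iso_verts \<phi> (u i [])) (snd (w i)) =
        map_option (\<lambda>_. u (k - 1 - i) []) (snd (flip (w (k - 1 - i))))"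
      unfolding W(2) flip_simps by (cases "snd (w i)"; cases "snd (w (k - 1 - i))") auto
  qed
  then have mir: "w i = flip (w (k - 1 - i))" for i by (rule fun_cong)
  have "even k"
  proof (rule ccontr)
    assume "odd k"
    then obtain l where "k = 2 * l + 1" by (auto elim: oddE)
    then show False using mir[of l] by simp
  qed
  then obtain l where l: "k = 2 * l" by blast
  \<comment> \<open>Vertex \<open>l\<close> is fixed by the automorphism; taking it as the origin
    turns \<open>k - 1 - i\<close> into \<open>- 1 - i\<close>.\<close>
  have "w (- 1 - i + l) = flip (w (i + l))" for i
    using mir[of "- 1 - i + l"] by (simp add: l algebra_simps)
  then have "sym_wheel Q n (\<lambda>i. w (i + l)) (\<lambda>i. v (i + l)) (\<lambda>i. a (i + l)) (\<lambda>i. u (i + l))"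
    by (intro sym_wheel.intro W.wheel_shift sym_wheel_axioms.intro)
  then show thesis by (rule that)
qed

section \<open>Counting isomorphism classes\<close>

lemma word_per: "2 * int (length S) dvd i - j \<Longrightarrow> word S i = word S j"
  by (simp add: word_def mod_eq_dvd_iff[symmetric])

definition has_code :: "('a, 'b) pre_digraph \<Rightarrow> letter list \<Rightarrow> bool" where
  "has_code Q S \<longleftrightarrow> S \<noteq> [] \<and> (\<exists>v a u. sym_wheel Q (2 * int (length S)) (word S) v a u)"

lemma has_codeI:
  assumes "S \<noteq> []" "wheel Q (2 * int (length S)) (word S) v a u"
  shows "has_code Q S"
  using assms word_mirror[OF assms(1)] unfolding has_code_def
  by (meson sym_wheel.intro sym_wheel_axioms.intro)

lemma has_codeE:
  assumes "has_code Q S"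
  obtains v a u where "sym_wheel Q (2 * int (length S)) (word S) v a u"
  using assms unfolding has_code_def by blast

lemma has_code_exists:
  assumes "S \<noteq> []"
  obtains Q :: "(nat, nat) pre_digraph" where "has_code Q S"
proof -
  have "2 \<le> 2 * int (length S)" using assms by (cases S) auto
  then obtain Q :: "(nat, nat) pre_digraph" and v a u where "wheel Q (2 * int (length S)) (word S) v a u"
    using wheel_exists[of "2 * int (length S)" "word S"] word_per by blast
  then show thesis using has_codeI[OF assms] that by blast
qed

lemma has_code_iso:
  assumes "has_code Q S" "has_code Q' S"
  shows "digraph_iso Q Q'"
proof -
  obtain v a u v' a' u' where "sym_wheel Q (2 * int (length S)) (word S) v a u"
    "sym_wheel Q' (2 * int (length S)) (word S) v' a' u'"
    using assms by (metis has_codeE)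
  then have "wheel Q (2 * int (length S)) (word S) v a u" "wheel Q' (2 * int (length S)) (word S) v' a' u'"
    by (simp_all add: sym_wheel_def)
  then show ?thesis unfolding digraph_iso_def using wheel_iso by metis
qed

lemma has_code_app:
  assumes "has_code Q S" "digraph_iso Q Q'"
  shows "has_code Q' S"
proof -
  obtain v a u where "sym_wheel Q (2 * int (length S)) (word S) v a u"
    using assms(1) by (rule has_codeE)
  then interpret sym_wheel Q "2 * int (length S)" "word S" v a u .
  show ?thesis
    using assms wheel_app_iso has_codeI[of S Q'] unfolding digraph_iso_def has_code_def by metis
qed

lemma has_code_unique:
  assumes "has_code Q S" "has_code Q S'"
  shows "S' \<in> codes_of S"
proof -
  obtain v a u v' a' u' where "sym_wheel Q (2 * int (length S)) (word S) v a u"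
    "sym_wheel Q (2 * int (length S')) (word S') v' a' u'"
    using assms by (metis has_codeE)
  from sym_wheel_unique[OF this] show ?thesis by (simp add: codes_of_def)
qed

lemma has_code_codes_of:
  assumes "has_code Q S" "S' \<in> codes_of S"
  shows "has_code Q S'"
proof -
  obtain v a u where "sym_wheel Q (2 * int (length S)) (word S) v a u"
    using assms(1) by (rule has_codeE)
  then interpret sym_wheel Q "2 * int (length S)" "word S" v a u .
  obtain j where j: "length S' = length S" "\<And>i. word S' i = word S (i + j)" using assms(2) by (auto simp: codes_of_def)
  have "S' \<noteq> []" using j(1) assms(1) by (auto simp: has_code_def)
  moreover have "word S' = (\<lambda>i. word S (i + j))" using j(2) by auto
  ultimately show ?thesis using wheel_shift[of j] j(1) by (metis has_codeI)
qed

lemma codes_of_sym: "S' \<in> codes_of S \<Longrightarrow> S \<in> codes_of S'"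
proof -
  assume "S' \<in> codes_of S"
  then obtain j where j: "length S' = length S" "\<And>i. word S' i = word S (i + j)" by (auto simp: codes_of_def)
  have "word S i = word S' (i + - j)" for i by (simp add: j(2))
  then show ?thesis unfolding codes_of_def using j(1) by (auto intro!: exI[of _ "- j"])
qed

lemma has_code_card:
  assumes "has_code Q S"
  shows "card (verts Q) = 2 * sum_list (map lsize S)" "card (oriented_3_cycles Q) = 2 * sum_list (map ltri S)"
proof -
  obtain v a u where "sym_wheel Q (2 * int (length S)) (word S) v a u"
    using assms by (rule has_codeE)
  then interpret sym_wheel Q "2 * int (length S)" "word S" v a u .
  show "card (verts Q) = 2 * sum_list (map lsize S)"
    unfolding card_verts by (rule sum_word) (simp add: lsize_def)
  show "card (oriented_3_cycles Q) = 2 * sum_list (map ltri S)"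
    unfolding card_oriented_3_cycles by (rule sum_word) (simp add: ltri_def)
qed

lemma has_code_iff:
  assumes "r \<ge> 1"
  shows "Q \<in> quivers_A_tilde (2 * r - 1) \<and> symmetric_quiver Q \<longleftrightarrow> (\<exists>S. has_code Q S \<and> sum_list (map lsize S) = r)"
proof
  assume "\<exists>S. has_code Q S \<and> sum_list (map lsize S) = r"
  then obtain S where S: "has_code Q S" "sum_list (map lsize S) = r" by blast
  obtain v a u where "sym_wheel Q (2 * int (length S)) (word S) v a u"
    using S(1) by (rule has_codeE)
  then interpret sym_wheel Q "2 * int (length S)" "word S" v a u .
  have "card (verts Q) = Suc (2 * r - 1)" using has_code_card(1)[OF S(1)] S(2) assms by simp
  then show "Q \<in> quivers_A_tilde (2 * r - 1) \<and> symmetric_quiver Q" using in_quivers_A_tilde symmetric by blast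
next
  assume Q: "Q \<in> quivers_A_tilde (2 * r - 1) \<and> symmetric_quiver Q"
  then have "quiver Q" and card: "card (verts Q) = Suc (2 * r - 1)" by (auto simp: quivers_A_tilde_def)
  then have "wf_digraph Q" by (simp add: quiver_def fin_digraph_def)
  then obtain n w v a u where W: "sym_wheel Q n w v a u" using Q symmetric_sym_wheel by blast
  from sym_wheel_word[OF W] obtain S where S: "S \<noteq> []" "n = 2 * int (length S)" "w = word S" .
  then have "has_code Q S" using W unfolding has_code_def by blast
  moreover from has_code_card(1)[OF this] have "sum_list (map lsize S) = r" using card assms by simp
  ultimately show "\<exists>S. has_code Q S \<and> sum_list (map lsize S) = r" by blast
qed

text \<open>Sending a code to the isomorphism class of its quiver is onto, and its fibres are the
  sets \<open>codes_of S\<close>, each with two elements.\<close>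

lemma card_iso_classes:
  assumes fin: "finite A" and ne: "\<And>S. S \<in> A \<Longrightarrow> S \<noteq> []"
    and closed: "\<And>S. S \<in> A \<Longrightarrow> codes_of S \<subseteq> A"
  shows "2 * card (iso_classes {Q. \<exists>S\<in>A. has_code Q S}) = card A"
proof -
  define f where "f S = {Q :: (nat, nat) pre_digraph. has_code Q S}" for S
  have cls: "{Q'. digraph_iso Q Q'} = f S" if "has_code Q S" for Q :: "(nat, nat) pre_digraph" and S
    unfolding f_def using that has_code_iso has_code_app by blast
  have "iso_classes {Q. \<exists>S\<in>A. has_code Q S} = f ` A"
  proof (intro equalityI subsetI)
    fix c assume "c \<in> iso_classes {Q. \<exists>S\<in>A. has_code Q S}"
    then obtain Q :: "(nat, nat) pre_digraph" where "Q \<in> {Q. \<exists>S\<in>A. has_code Q S}" "c = {(Q, Q'). digraph_iso Q Q'} `` {Q}"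
      unfolding iso_classes_def by (rule quotientE)
    then obtain S where "S \<in> A" "has_code Q S" "c = {Q'. digraph_iso Q Q'}" by auto
    then show "c \<in> f ` A" using cls by blast
  next
    fix c assume "c \<in> f ` A"
    then obtain S where S: "S \<in> A" "c = f S" by blast
    obtain Q :: "(nat, nat) pre_digraph" where Q: "has_code Q S" by (rule has_code_exists[OF ne[OF S(1)]])
    have "{(Q, Q'). digraph_iso Q Q'} `` {Q} \<in> iso_classes {Q. \<exists>S\<in>A. has_code Q S}"
      unfolding iso_classes_def using Q S(1) by (intro quotientI) blast
    moreover have "{(Q, Q'). digraph_iso Q Q'} `` {Q} = c" using cls[OF Q] S(2) by auto
    ultimately show "c \<in> iso_classes {Q. \<exists>S\<in>A. has_code Q S}" by simp
  qed
  moreover have "f S' = f S \<longleftrightarrow> S' \<in> codes_of S" if S: "S \<in> A" for S S'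
  proof
    assume eq: "f S' = f S"
    obtain Q :: "(nat, nat) pre_digraph" where Q: "has_code Q S" by (rule has_code_exists[OF ne[OF S]])
    then have "has_code Q S'" using eq by (auto simp: f_def)
    then show "S' \<in> codes_of S" using Q has_code_unique by blast
  next
    assume "S' \<in> codes_of S"
    then show "f S' = f S" unfolding f_def using has_code_codes_of codes_of_sym by blast
  qed
  then have "{S' \<in> A. f S' = f S} = codes_of S" if "S \<in> A" for S
    using that closed by blast
  then have "card {S' \<in> A. f S' = c} = 2" if "c \<in> f ` A" for c
    using that card_codes_of[OF ne] by auto
  then have "card A = 2 * card (f ` A)"
    using sum.image_gen[OF fin, of "\<lambda>_. 1 :: nat" f] by simp
  ultimately show ?thesis by simp
qed

text \<open>Both sums are half of an invariant of a quiver having \<open>S\<close> and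
  \<open>S'\<close> as codes, so no computation with words is required.\<close>

lemma codes_of_sums:
  assumes "S \<noteq> []" "S' \<in> codes_of S"
  shows "sum_list (map lsize S') = sum_list (map lsize S)" "sum_list (map ltri S') = sum_list (map ltri S)"
proof -
  obtain Q :: "(nat, nat) pre_digraph" where Q: "has_code Q S" using has_code_exists[OF assms(1)] by blast
  have "has_code Q S'" by (rule has_code_codes_of[OF Q assms(2)])
  from has_code_card[OF this] has_code_card[OF Q]
  show "sum_list (map lsize S') = sum_list (map lsize S)" "sum_list (map ltri S') = sum_list (map ltri S)" by simp_all
qed

theorem theorem3p8:
  fixes r r\<^sub>2 :: nat
  assumes "r \<ge> 1"
  shows "real (card (iso_classes {Q \<in> quivers_A_tilde (2 * r - 1). symmetric_quiver Q}))
           = 1 / 2 * real ((2 * r) choose r)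
       \<and> real (card (iso_classes {Q \<in> quivers_A_tilde (2 * r - 1). symmetric_quiver Q \<and>
             card (oriented_3_cycles Q) = 2 * r\<^sub>2}))
           = 2 powi (int r - 2 * int r\<^sub>2 - 1)
               * real (multinomial r [int r\<^sub>2, int r\<^sub>2, int r - 2 * int r\<^sub>2])"
proof -
  define A where "A = {S :: letter list. sum_list (map lsize S) = r}"
  define A' where "A' = {S \<in> A. sum_list (map ltri S) = r\<^sub>2}"
  have A: "codes 0 r = Pair [] ` A" by (auto simp: codes_def A_def)
  have A': "{x \<in> codes 0 r. ntri x = r\<^sub>2} = Pair [] ` A'" by (auto simp: A A'_def ntri_def)
  have inj: "inj_on (Pair []) X" for X :: "letter list set" by (simp add: inj_on_def)
  have cA: "card A = (2 * r) choose r" using card_codes[of 0 r] by (simp add: A card_image[OF inj])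
  have cA': "card A' = steps r r\<^sub>2 r\<^sub>2" using card_codes_ntri[of 0 r r\<^sub>2] by (simp add: A' card_image[OF inj])
  have fin: "finite A" using finite_codes[of 0 r] unfolding A by (simp add: finite_image_iff inj)
  have ne: "S \<noteq> []" if "S \<in> A" for S using that assms by (auto simp: A_def)
  have closed: "codes_of S \<subseteq> A" if "S \<in> A" for S
    using codes_of_sums(1)[OF ne[OF that]] that by (auto simp: A_def)
  have closed': "codes_of S \<subseteq> A'" if "S \<in> A'" for S
    using codes_of_sums(2)[OF ne] closed that by (auto simp: A'_def)
  have "{Q \<in> quivers_A_tilde (2 * r - 1). symmetric_quiver Q} = {Q :: (nat, nat) pre_digraph. \<exists>S\<in>A. has_code Q S}"
    using has_code_iff[OF assms] by (auto simp: A_def)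
  then have 1: "2 * card (iso_classes {Q \<in> quivers_A_tilde (2 * r - 1). symmetric_quiver Q}) = (2 * r) choose r"
    using card_iso_classes[OF fin ne closed] cA by simp
  have "{Q \<in> quivers_A_tilde (2 * r - 1). symmetric_quiver Q \<and> card (oriented_3_cycles Q) = 2 * r\<^sub>2} =
      {Q :: (nat, nat) pre_digraph. \<exists>S\<in>A'. has_code Q S}" (is "?L = ?R")
  proof (intro equalityI subsetI)
    fix Q assume Q: "Q \<in> ?L"
    then obtain S where "has_code Q S" "S \<in> A" using has_code_iff[OF assms, of Q] by (auto simp: A_def)
    then show "Q \<in> ?R" using has_code_card(2)[of Q S] Q by (auto simp: A'_def)
  next
    fix Q assume "Q \<in> ?R"
    then obtain S where "has_code Q S" "S \<in> A'" by blast
    then show "Q \<in> ?L" using has_code_iff[OF assms, of Q] has_code_card(2)[of Q S] by (auto simp: A'_def A_def)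
  qed
  then have "2 * card (iso_classes {Q \<in> quivers_A_tilde (2 * r - 1). symmetric_quiver Q \<and>
      card (oriented_3_cycles Q) = 2 * r\<^sub>2}) = steps r r\<^sub>2 r\<^sub>2"
    using card_iso_classes[of A'] fin ne closed' cA' by (simp add: A'_def)
  then have 2: "2 * real (card (iso_classes {Q \<in> quivers_A_tilde (2 * r - 1). symmetric_quiver Q \<and>
      card (oriented_3_cycles Q) = 2 * r\<^sub>2})) =
      2 powi (int r - 2 * int r\<^sub>2) * real (multinomial r [int r\<^sub>2, int r\<^sub>2, int r - 2 * int r\<^sub>2])"
    unfolding steps_multinomial[symmetric] by linarith
  \<comment> \<open>The exponent on the right may be negative (it is -1 for
    \<open>r = 2 * r\<^sub>2\<close>), so the division by 2 takes place in the reals.\<close>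
  have "(2 :: real) powi (int r - 2 * int r\<^sub>2) = 2 * 2 powi (int r - 2 * int r\<^sub>2 - 1)"
    by (simp add: power_int_diff)
  then show ?thesis using 1 2 by simp
qed

end
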